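(* Let $a\in L^\infty(\mathbb{R}^n\times\mathbb{R}^n)\cap C^\infty(\mathbb{R}^n\times(\mathbb{R}^n\setminus\{0\}))$ satisfy $c_{\alpha,\beta}(a):=\sup_{x,\,\xi\ne0}|\xi|^{|\alpha|-|\beta|}|\partial_\xi^\alpha\partial_x^\beta a(x,\xi)|<\infty$ for all multiindices $\alpha,\beta$, and $a(x,D)^\sharp1=0$. There is a constant $C$ depending only on $n$ and the quantities $c_{\alpha,\beta}(a)$ such that, for all tiles $u,v\in\mathbb{D}$ with $u\le v$, all $y\in\mathbb{R}^n$, all $\eta_0,\eta_1\in\omega_v$ and all $f\in L^2(\mathbb{R}^n)$, $$|a_{v,\eta_0}(x,D)f(y)-a_{u,\eta_0}(x,D)f(y)|\le C\inf_{z\in Q(y,\ell(I_u))}\left(M_{\ge\ell(I_u)}f(z)+\sup_{\varepsilon>0}\left|a(x,D-\eta_1)[\chi_{\mathbb{R}^n\setminus Q(z,\varepsilon)}f](z)\right|\right).$$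
   Context: Fourier transform: $\mathcal{F}f(\xi)=\int f(x)e^{-2\pi ix\cdot\xi}dx$. For a symbol $b(x,\xi)$, $b(x,D)f(y)=\int b(y,\xi)e^{2\pi iy\cdot\xi}\mathcal{F}f(\xi)\,d\xi$ denotes the value at $y$ of the function obtained by applying the operator with symbol $b$. The condition $a(x,D)^\sharp 1=0$ (formal adjoint) means $\int a(x,D)f(x)\,dx=0$ for all Schwartz $f$ with all moments vanishing. Cubes: $Q(x,r)=\{y:\max_i|x_i-y_i|\le r\}$, $Q(r)=Q(0,r)$. Dyadic cubes: $Q_{\nu m}=\prod_{j=1}^n[2^{-\nu}m_j,2^{-\nu}(m_j+1))$, with center $c(Q_{\nu m})$ and side length $\ell(Q_{\nu m})=2^{-\nu}$. A tile is $s=I_s\times\omega_s$ with $I_s=Q_{\nu m}$, $\omega_s=Q_{-\nu m'}$ ($\nu\in\mathbb{Z}$, $m,m'\in\mathbb{Z}^n$); $\mathbb{D}$ is the set of all tiles; $u\le v$ means $I_u\subset I_v$ and $\omega_u\supset\omega_v$. $\Phi$ is a fixed Schwartz function with $\chi_{Q(9/100)}\le\Phi\le\chi_{Q(1/10)}$, and $\Psi=\Phi-\Phi(2\cdot)$. For $s\in\mathbb{D}$, $\eta\in\mathbb{R}^n$, $a_{s,\eta}(x,\xi)=a(x,\xi-\eta)\,\Phi\!\left(\frac{\xi-c(\omega_s)}{6\,\ell(\omega_s)}\right)$. $M_{\ge b}f(x)=\sup_{r\ge b}r^{-n}\int_{Q(x,r)}|f(y)|\,dy$ for $b>0$. Truncated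 operators: $a(x,D-\eta)$ is the operator with symbol $a(x,\xi-\eta)$, and for $g$ vanishing near $z$, $a(x,D-\eta)g(z)=\int e^{2\pi i\eta\cdot(z-w)}k(z,z-w)g(w)\,dw$, where $k(x,z)=\sum_{j\in\mathbb{Z}}\int a(x,\xi)\Psi(2^{-j}\xi)e^{2\pi i\xi\cdot z}\,d\xi$ for $z\ne0$. *)

theory Defs
  imports "HOL-Analysis.Analysis"
begin

section \<open>Smooth and Schwartz functions\<close>

text \<open>\<open>C\<^sup>k\<close> on an open set: differentiable, with all directional derivatives of class \<open>C\<^sup>k\<^sup>-\<^sup>1\<close>.\<close>

primrec Ck_on :: "nat \<Rightarrow> 'a::real_normed_vector set \<Rightarrow> ('a \<Rightarrow> 'b::real_normed_vector) \<Rightarrow> bool" where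
  "Ck_on 0 S f \<longleftrightarrow> continuous_on S f"
| "Ck_on (Suc k) S f \<longleftrightarrow> (\<forall>x\<in>S. f differentiable (at x)) \<and>
     (\<forall>v. Ck_on k S (\<lambda>x. frechet_derivative f (at x) v))"

definition smooth_on :: "'a::real_normed_vector set \<Rightarrow> ('a \<Rightarrow> 'b::real_normed_vector) \<Rightarrow> bool" where
  "smooth_on S f \<longleftrightarrow> (\<forall>k. Ck_on k S f)"

type_synonym 'n multiindex = "'n \<Rightarrow> nat"

definition mi_deg :: "'n::finite multiindex \<Rightarrow> nat" where
  "mi_deg \<alpha> = (\<Sum>i\<in>UNIV. \<alpha> i)"

definition monomial :: "'n::finite multiindex \<Rightarrow> real^'n \<Rightarrow> real" where
  "monomial \<alpha> x = (\<Prod>i\<in>UNIV. (x $ i) ^ \<alpha> i)"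

definition partial_deriv :: "'n::finite \<Rightarrow> (real^'n \<Rightarrow> 'b::real_normed_vector) \<Rightarrow> real^'n \<Rightarrow> 'b" where
  "partial_deriv i f x = vector_derivative (\<lambda>t. f (x + t *\<^sub>R axis i 1)) (at 0)"

text \<open>The partial derivatives are taken in the order of an arbitrary fixed enumeration of the
  coordinates; the order is immaterial for the smooth functions considered here.\<close>

definition multi_deriv :: "'n::finite multiindex \<Rightarrow> (real^'n \<Rightarrow> 'b::real_normed_vector) \<Rightarrow> real^'n \<Rightarrow> 'b" where
  "multi_deriv \<alpha> f =
     fold (\<lambda>i g. (partial_deriv i ^^ \<alpha> i) g) (SOME xs. distinct xs \<and> set xs = UNIV) f"

definition schwartz :: "(real^'n::finite \<Rightarrow> 'b::real_normed_vector) \<Rightarrow> bool" where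
  "schwartz f \<longleftrightarrow> smooth_on UNIV f \<and>
     (\<forall>\<alpha> \<beta>. bounded (range (\<lambda>x. monomial \<alpha> x *\<^sub>R multi_deriv \<beta> f x)))"

section \<open>Cubes and tiles\<close>

definition cube :: "real^'n::finite \<Rightarrow> real \<Rightarrow> (real^'n) set" where
  "cube x r = {y. \<forall>i. \<bar>x $ i - y $ i\<bar> \<le> r}"

definition dyadic_cube :: "int \<Rightarrow> int^'n::finite \<Rightarrow> (real^'n) set" where
  "dyadic_cube \<nu> m = {x. \<forall>j. 2 powi (- \<nu>) * of_int (m $ j) \<le> x $ j \<and>
                             x $ j < 2 powi (- \<nu>) * (of_int (m $ j) + 1)}"

definition dyadic_side :: "int \<Rightarrow> real" where
  "dyadic_side \<nu> = 2 powi (- \<nu>)"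

definition dyadic_center :: "int \<Rightarrow> int^'n::finite \<Rightarrow> real^'n" where
  "dyadic_center \<nu> m = (\<chi> j. 2 powi (- \<nu>) * (of_int (m $ j) + 1 / 2))"

text \<open>\<open>Tile \<nu> m m'\<close> stands for the tile \<open>Q\<^bsub>\<nu>,m\<^esub> \<times> Q\<^bsub>-\<nu>,m'\<^esub>\<close>. A dyadic cube determines its scale and
  position, so tiles correspond bijectively to these indices.\<close>

datatype 'n tile = Tile (scale: int) (pos: "int^'n") (freq: "int^'n")

definition tile_I :: "'n::finite tile \<Rightarrow> (real^'n) set" where
  "tile_I s = dyadic_cube (scale s) (pos s)"

definition tile_\<omega> :: "'n::finite tile \<Rightarrow> (real^'n) set" where
  "tile_\<omega> s = dyadic_cube (- scale s) (freq s)"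

definition len_I :: "'n::finite tile \<Rightarrow> real" where
  "len_I s = dyadic_side (scale s)"

definition len_\<omega> :: "'n::finite tile \<Rightarrow> real" where
  "len_\<omega> s = dyadic_side (- scale s)"

definition center_\<omega> :: "'n::finite tile \<Rightarrow> real^'n" where
  "center_\<omega> s = dyadic_center (- scale s) (freq s)"

definition tile_le :: "'n::finite tile \<Rightarrow> 'n tile \<Rightarrow> bool" where
  "tile_le u v \<longleftrightarrow> tile_I u \<subseteq> tile_I v \<and> tile_\<omega> v \<subseteq> tile_\<omega> u"

section \<open>Lebesgue spaces, Fourier transform, pseudodifferential operators\<close>

definition in_L2 :: "('a::euclidean_space \<Rightarrow> complex) \<Rightarrow> bool" where
  "in_L2 f \<longleftrightarrow> f \<in> borel_measurable lebesgue \<and> integrable lebesgue (\<lambda>x. (norm (f x))\<^sup>2)"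

definition in_Linfty :: "('a::euclidean_space \<Rightarrow> complex) \<Rightarrow> bool" where
  "in_Linfty f \<longleftrightarrow> f \<in> borel_measurable lebesgue \<and> (\<exists>B. AE x in lebesgue. norm (f x) \<le> B)"

definition fourier_integral :: "(real^'n::finite \<Rightarrow> complex) \<Rightarrow> real^'n \<Rightarrow> complex" where
  "fourier_integral f \<xi> = (LINT x|lebesgue. f x * cis (- 2 * pi * (x \<bullet> \<xi>)))"

text \<open>For \<open>f \<in> L\<^sup>2\<close> that is not integrable, the Fourier transform is the Plancherel extension, i.e.
  the \<open>L\<^sup>2\<close>-limit of the transforms of the truncations \<open>\<chi>\<^bsub>Q(N)\<^esub> f\<close>. The limit is determined only
  almost everywhere, whence the choice of a representative.\<close>

definition fourier :: "(real^'n::finite \<Rightarrow> complex) \<Rightarrow> real^'n \<Rightarrow> complex" where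
  "fourier f =
     (if integrable lebesgue f then fourier_integral f
      else (SOME g. in_L2 g \<and>
        (\<lambda>N::nat. \<integral>\<^sup>+\<xi>. ennreal ((norm (fourier_integral
            (\<lambda>x. indicator (cube 0 (real N)) x *\<^sub>R f x) \<xi> - g \<xi>))\<^sup>2) \<partial>lebesgue) \<longlonglongrightarrow> 0))"

definition psido :: "(real^'n::finite \<Rightarrow> real^'n \<Rightarrow> complex) \<Rightarrow> (real^'n \<Rightarrow> complex) \<Rightarrow> real^'n \<Rightarrow> complex" where
  "psido b f y = (LINT \<xi>|lebesgue. b y \<xi> * cis (2 * pi * (y \<bullet> \<xi>)) * fourier f \<xi>)"

text \<open>The quantity \<open>c\<^bsub>\<alpha>,\<beta>\<^esub>(a)\<close>; here \<open>\<alpha>\<close> counts derivatives in the frequency variable (second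
  argument) and \<open>\<beta>\<close> those in the space variable (first argument).\<close>

definition symbol_const ::
  "(real^'n::finite \<Rightarrow> real^'n \<Rightarrow> complex) \<Rightarrow> 'n multiindex \<Rightarrow> 'n multiindex \<Rightarrow> ennreal" where
  "symbol_const a \<alpha> \<beta> =
     (SUP (x, \<xi>) \<in> UNIV \<times> (- {0}).
        ennreal (norm \<xi> powi (int (mi_deg \<alpha>) - int (mi_deg \<beta>)) *
          norm (multi_deriv \<alpha> (\<lambda>\<zeta>. multi_deriv \<beta> (\<lambda>x'. a x' \<zeta>) x) \<xi>)))"

text \<open>\<open>a(x,D)\<^sup>\<sharp> 1 = 0\<close>. For symbols with all \<open>c\<^bsub>\<alpha>,\<beta>\<^esub>(a)\<close> finite, \<open>a(x,D) f\<close> is rapidly decreasing for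
  every such \<open>f\<close>, so that the integral exists.\<close>

definition adjoint_kills_one :: "(real^'n::finite \<Rightarrow> real^'n \<Rightarrow> complex) \<Rightarrow> bool" where
  "adjoint_kills_one a \<longleftrightarrow>
     (\<forall>f. schwartz f \<and> (\<forall>\<alpha>. (LINT x|lebesgue. monomial \<alpha> x *\<^sub>R f x) = 0) \<longrightarrow>
        (LINT x|lebesgue. psido a f x) = 0)"

definition tile_symbol ::
  "(real^'n::finite \<Rightarrow> real) \<Rightarrow> (real^'n \<Rightarrow> real^'n \<Rightarrow> complex) \<Rightarrow> 'n tile \<Rightarrow> real^'n \<Rightarrow>
     real^'n \<Rightarrow> real^'n \<Rightarrow> complex" where
  "tile_symbol \<Phi> a s \<eta> x \<xi> =
     a x (\<xi> - \<eta>) * of_real (\<Phi> ((1 / (6 * len_\<omega> s)) *\<^sub>R (\<xi> - center_\<omega> s)))"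

section \<open>Maximal function and truncated operators\<close>

definition maximal_ge :: "real \<Rightarrow> (real^'n::finite \<Rightarrow> complex) \<Rightarrow> real^'n \<Rightarrow> ennreal" where
  "maximal_ge b f x =
     (SUP r\<in>{b..}. ennreal (1 / r ^ CARD('n)) * (\<integral>\<^sup>+y\<in>cube x r. ennreal (norm (f y)) \<partial>lebesgue))"

definition Psi :: "(real^'n::finite \<Rightarrow> real) \<Rightarrow> real^'n \<Rightarrow> real" where
  "Psi \<Phi> \<xi> = \<Phi> \<xi> - \<Phi> (2 *\<^sub>R \<xi>)"

text \<open>Meaningful for \<open>z \<noteq> 0\<close> only.\<close>

definition kernel ::
  "(real^'n::finite \<Rightarrow> real) \<Rightarrow> (real^'n \<Rightarrow> real^'n \<Rightarrow> complex) \<Rightarrow> real^'n \<Rightarrow> real^'n \<Rightarrow> complex" where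
  "kernel \<Phi> a x z =
     (\<Sum>\<^sub>\<infinity>j::int. LINT \<xi>|lebesgue.
        a x \<xi> * of_real (Psi \<Phi> ((2 powi (- j)) *\<^sub>R \<xi>)) * cis (2 * pi * (\<xi> \<bullet> z)))"

text \<open>\<open>a(x,D - \<eta>) g(z)\<close> for \<open>g\<close> vanishing near \<open>z\<close>.\<close>

definition kernel_op ::
  "(real^'n::finite \<Rightarrow> real) \<Rightarrow> (real^'n \<Rightarrow> real^'n \<Rightarrow> complex) \<Rightarrow> real^'n \<Rightarrow>
     (real^'n \<Rightarrow> complex) \<Rightarrow> real^'n \<Rightarrow> complex" where
  "kernel_op \<Phi> a \<eta> g z =
     (LINT w|lebesgue. cis (2 * pi * (\<eta> \<bullet> (z - w))) * kernel \<Phi> a z (z - w) * g w)"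

end

theory Submission
  imports Defs
begin

text \<open>Near \<open>\<eta>\<^sub>0\<close> both tile cutoffs equal 1, so the difference of the two tile symbols is a smooth piece at
  frequency scale \<open>\<ell>(\<omega>\<^sub>v)\<close>, another at scale \<open>\<ell>(\<omega>\<^sub>u)\<close>, and minus the sum of the Littlewood--Paley pieces
  of \<open>a(y, \<xi> - \<eta>\<^sub>0)\<close> at the dyadic scales in between. The first two have kernels dominated by \<open>L\<^sup>1\<close>-dilates
  of an integrable bump and are controlled by the maximal function. Up to a unimodular constant the sum
  is compared with the difference of the truncations of \<open>a(x, D - \<eta>\<^sub>1)\<close> at \<open>z\<close> to radii \<open>\<ell>(I\<^sub>u)\<close> and
  \<open>1 / \<ell>(\<omega>\<^sub>v)\<close>: with \<open>r = \<ell>(I\<^sub>u)\<close> and \<open>\<rho> = \<ell>(\<omega>\<^sub>v)\<close>, moving \<open>y\<close> to \<open>z\<close> costs a factor \<open>2\<^sup>jr\<close> in the piece at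
  frequency \<open>2\<^sup>j\<close>, changing \<open>\<eta>\<^sub>0\<close> to \<open>\<eta>\<^sub>1\<close> a factor \<open>2\<^sup>-\<^sup>j\<rho>\<close>, and pieces outside their natural range of
  positions decay geometrically, so all errors sum to a multiple of the maximal function.\<close>

section \<open>The sup norm, cubes and the characters of \<open>\<real>\<^sup>n\<close>\<close>

text \<open>The symbol bounds come in one order of differentiation only, frequency after space.
  Kernel decay is therefore extracted by finite differences along a single axis, which commute with
  a spatial derivative for free. The decay order is n + 2: order n + 1 makes the kernels integrable
  uniformly in the scale, and the spare power absorbs the factor 2^j |x| that arises when \<eta>0 is
  replaced by \<eta>1. With I = \<open>scale v\<close> and J = \<open>scale u\<close> one has I
  \<le> J, and the side lengths of \<omega>(v) and of the space cube of u are 2^I and 2^-J. The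
  unimodular constant is e^(2 pi i \<eta>0 . (y - z)): the phase \<eta>0 . (y - w) is the sum of
  this one, of the phase \<eta>1 . (z - w) of the truncated operator, and of a slowly varying
  remainder. For f in L^2 the transform is a chosen limit of transforms of truncations, so the
  kernel formula for a frequency-localized operator requires its own passage to the limit; hence the
  completeness of L^2 and the L^2 bound for the transform.\<close>

lemma infnorm_attained:
  fixes x :: "real^'n"
  obtains i where "infnorm x = \<bar>x $ i\<bar>"
proof -
  have "infnorm x = Max ((\<lambda>i. \<bar>x \<bullet> i\<bar>) ` Basis)"
    by (rule infnorm_Max)
  also have "\<dots> \<in> (\<lambda>i. \<bar>x \<bullet> i\<bar>) ` Basis"
    by (rule Max_in) auto
  finally obtain b where "b \<in> Basis" "infnorm x = \<bar>x \<bullet> b\<bar>" by auto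
  then show ?thesis
    using that by (auto simp: Basis_vec_def inner_axis)
qed

lemma mem_cube: "y \<in> cube x r \<longleftrightarrow> infnorm (x - y) \<le> r" for x y :: "real^'n"
proof
  assume "y \<in> cube x r"
  then have "\<bar>(x - y) $ i\<bar> \<le> r" for i by (auto simp: cube_def)
  then show "infnorm (x - y) \<le> r" by (metis infnorm_attained)
next
  assume *: "infnorm (x - y) \<le> r"
  have "\<bar>(x - y) $ i\<bar> \<le> r" for i
    using component_le_infnorm_cart[of "x - y" i] * by linarith
  then show "y \<in> cube x r" by (auto simp: cube_def)
qed

lemma cube_eq_cbox: "cube x r = cbox (x - (\<chi> i. r)) (x + (\<chi> i. r))" for x :: "real^'n"
  by (auto simp: cube_def mem_box_cart abs_le_iff algebra_simps)

lemma cube_measurable [measurable]: "cube (x::real^'n) r \<in> sets borel"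
  by (simp add: cube_eq_cbox)

lemma emeasure_cube:
  fixes x :: "real^'n"
  assumes "r \<ge> 0"
  shows "emeasure lborel (cube x r) = ennreal ((2 * r) ^ CARD('n))"
proof -
  have "cbox (x - (\<chi> i. r)) (x + (\<chi> i. r)) \<noteq> {}"
    using assms by (auto simp: interval_ne_empty_cart)
  then show ?thesis
    unfolding cube_eq_cbox emeasure_eq_measure2[of lborel]
    by (subst emeasure_eq_ennreal_measure)
       (auto simp: content_cbox_cart emeasure_lborel_cbox_eq)
qed

lemma infnorm_borel [measurable]: "infnorm \<in> borel_measurable (borel :: (real^'n) measure)"
  by (intro borel_measurable_continuous_onI continuous_on_infnorm continuous_on_id)

lemma norm_le_card_infnorm: "norm x \<le> CARD('n) * infnorm x" for x :: "real^'n"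
proof -
  have "norm x \<le> sqrt (DIM(real^'n)) * infnorm x" by (rule norm_le_infnorm)
  also have "sqrt (real DIM(real^'n)) \<le> real CARD('n)"
  proof -
    have "1 \<le> CARD('n)" by (simp add: Suc_leI)
    then have "real CARD('n) * 1 \<le> real CARD('n) * real CARD('n)"
      by (intro mult_left_mono) auto
    then show ?thesis by (intro real_le_lsqrt) (auto simp: power2_eq_square)
  qed
  finally show ?thesis by (simp add: infnorm_pos_le mult_right_mono)
qed

lemma abs_inner_le_infnorm:
  "\<bar>x \<bullet> y\<bar> \<le> CARD('n) * infnorm x * infnorm y" for x y :: "real^'n"
proof -
  have "\<bar>x \<bullet> y\<bar> \<le> (\<Sum>i\<in>UNIV. \<bar>x $ i\<bar> * \<bar>y $ i\<bar>)"
    unfolding inner_vec_def by (rule order.trans[OF sum_abs]) (simp add: abs_mult)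
  also have "\<dots> \<le> (\<Sum>i\<in>(UNIV::'n set). infnorm x * infnorm y)"
    by (intro sum_mono mult_mono component_le_infnorm_cart infnorm_pos_le) auto
  finally show ?thesis by simp
qed

definition e2pi :: "real \<Rightarrow> complex" where
  "e2pi t = cis (2 * pi * t)"

lemma norm_e2pi [simp]: "norm (e2pi t) = 1"
  by (simp add: e2pi_def)

lemma e2pi_add: "e2pi (s + t) = e2pi s * e2pi t"
  by (simp add: e2pi_def cis_mult algebra_simps)

lemma e2pi_0 [simp]: "e2pi 0 = 1"
  by (simp add: e2pi_def)

lemma cnj_e2pi [simp]: "cnj (e2pi t) = e2pi (- t)"
  by (simp add: e2pi_def cis_cnj)

lemma continuous_on_e2pi [continuous_intros]:
  "continuous_on S f \<Longrightarrow> continuous_on S (\<lambda>x. e2pi (f x))"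
  unfolding e2pi_def by (intro continuous_intros)

lemma e2pi_borel [measurable]: "e2pi \<in> borel_measurable borel"
  by (intro borel_measurable_continuous_onI continuous_intros)

lemma e2pi_has_vector_derivative:
  "((\<lambda>t. e2pi (b + c * t)) has_vector_derivative (2 * pi * c) *\<^sub>R (\<i> * e2pi (b + c * t))) (at t within S)"
proof -
  have "((\<lambda>z. exp (\<i> * (of_real (2 * pi) * (of_real b + of_real c * z)))) has_field_derivative
      (of_real (2 * pi * c)) * (\<i> * e2pi (b + c * t))) (at (of_real t))"
    unfolding e2pi_def cis_conv_exp by (auto intro!: derivative_eq_intros simp: algebra_simps)
  from has_vector_derivative_real_field[OF this, of S] show ?thesis
    by (simp add: e2pi_def cis_conv_exp scaleR_conv_of_real)
qed

text \<open>A chord is shorter than its arc: |e^(is) - 1| = 2 |sin (s/2)|.\<close>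

lemma norm_e2pi_diff_1_le: "norm (e2pi t - 1) \<le> 2 * pi * \<bar>t\<bar>"
  using dist_exp_i_1[of "2 * pi * t"] abs_sin_x_le_abs_x[of "2 * pi * t / 2"] 
  by (simp add: e2pi_def cis_conv_exp dist_norm abs_mult)

section \<open>Finite differences and oscillatory integrals\<close>

definition fd :: "real^'n \<Rightarrow> (real^'n \<Rightarrow> complex) \<Rightarrow> real^'n \<Rightarrow> complex" where
  "fd v g x = g (x + v) - g x"

lemma fd_funpow_Suc: "(fd v ^^ Suc N) g x = (fd v ^^ N) g (x + v) - (fd v ^^ N) g x"
  by (simp add: fd_def)

lemma fd_funpow_diff: "(fd v ^^ N) (\<lambda>x. g x - h x) x = (fd v ^^ N) g x - (fd v ^^ N) h x"
  by (induction N arbitrary: x) (simp_all add: fd_funpow_Suc del: funpow.simps(2))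

lemma integral_lborel_translate:
  fixes g :: "real^'n \<Rightarrow> 'b::{banach, second_countable_topology}"
  assumes [measurable]: "g \<in> borel_measurable borel"
  shows "(LINT x|lborel. g (x + v)) = (LINT x|lborel. g x)"
proof -
  have "(LINT x|lborel. g x) = (LINT x|distr lborel borel (\<lambda>x. v + x). g x)"
    by (simp add: lborel_distr_plus)
  also have "\<dots> = (LINT x|lborel. g (v + x))"
    by (subst integral_distr) auto
  finally show ?thesis by (simp add: add.commute)
qed

lemma integrable_lborel_translate:
  fixes g :: "real^'n \<Rightarrow> 'b::{banach, second_countable_topology}"
  assumes "integrable lborel g"
  shows "integrable lborel (\<lambda>x. g (x + v))"
proof -
  have "integrable (distr lborel borel (\<lambda>x. v + x)) g"
    using assms by (simp add: lborel_distr_plus)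
  then have "integrable lborel (\<lambda>x. g (v + x))"
    by (subst (asm) integrable_distr_eq) (use assms in auto)
  then show ?thesis by (simp add: add.commute)
qed

lemma integrable_times_e2pi:
  fixes g :: "real^'n \<Rightarrow> complex"
  assumes "integrable lborel g"
  shows "integrable lborel (\<lambda>\<xi>. g \<xi> * e2pi (\<xi> \<bullet> x))"
  by (rule Bochner_Integration.integrable_bound[OF assms]) (use assms in \<open>auto simp: norm_mult\<close>)

lemma integrable_fd_funpow:
  "integrable lborel g \<Longrightarrow> integrable lborel ((fd v ^^ N) g)"
proof (induction N)
  case (Suc N)
  then show ?case
    unfolding fd_funpow_Suc
    by (auto intro!: integrable_lborel_translate simp: fd_def[abs_def])
qed simp

text \<open>Translating by a vector on which the character is \<open>-1\<close> replaces integration by parts: each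
  finite difference gains a factor \<open>-2\<close>.\<close>

lemma integral_fd_e2pi:
  fixes g :: "real^'n \<Rightarrow> complex"
  assumes g: "integrable lborel g" and v: "e2pi (v \<bullet> x) = -1"
  shows "(LINT \<xi>|lborel. fd v g \<xi> * e2pi (\<xi> \<bullet> x)) = - 2 * (LINT \<xi>|lborel. g \<xi> * e2pi (\<xi> \<bullet> x))"
proof -
  have v': "e2pi (- (v \<bullet> x)) = -1"
    using arg_cong[OF v, of cnj] by simp
  have eq: "g (\<xi> + v) * e2pi (\<xi> \<bullet> x) = - (g (\<xi> + v) * e2pi ((\<xi> + v) \<bullet> x))" for \<xi>
    using v by (simp add: inner_add_left e2pi_add)
  have [measurable]: "g \<in> borel_measurable borel" using g by auto
  have int: "integrable lborel (\<lambda>\<xi>. g (\<xi> + v) * e2pi ((\<xi> + v) \<bullet> x))"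
    by (rule integrable_lborel_translate[where g="\<lambda>\<xi>. g \<xi> * e2pi (\<xi> \<bullet> x)"])
       (rule integrable_times_e2pi[OF g])
  have "(LINT \<xi>|lborel. fd v g \<xi> * e2pi (\<xi> \<bullet> x)) =
      (LINT \<xi>|lborel. - (g (\<xi> + v) * e2pi ((\<xi> + v) \<bullet> x)) - g \<xi> * e2pi (\<xi> \<bullet> x))"
    by (intro Bochner_Integration.integral_cong) (auto simp: fd_def left_diff_distrib eq)
  also have "\<dots> = - (LINT \<xi>|lborel. g (\<xi> + v) * e2pi ((\<xi> + v) \<bullet> x)) - (LINT \<xi>|lborel. g \<xi> * e2pi (\<xi> \<bullet> x))"
    using int integrable_times_e2pi[OF g]
    by (subst Bochner_Integration.integral_diff) auto
  also have "(LINT \<xi>|lborel. g (\<xi> + v) * e2pi ((\<xi> + v) \<bullet> x)) = (LINT \<xi>|lborel. g \<xi> * e2pi (\<xi> \<bullet> x))"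
    by (rule integral_lborel_translate[where g="\<lambda>\<xi>. g \<xi> * e2pi (\<xi> \<bullet> x)"]) measurable
  finally show ?thesis by simp
qed

lemma integral_fd_funpow_e2pi:
  fixes g :: "real^'n \<Rightarrow> complex"
  assumes g: "integrable lborel g" and v: "e2pi (v \<bullet> x) = -1"
  shows "(LINT \<xi>|lborel. (fd v ^^ N) g \<xi> * e2pi (\<xi> \<bullet> x)) =
    (- 2) ^ N * (LINT \<xi>|lborel. g \<xi> * e2pi (\<xi> \<bullet> x))"
proof (induction N)
  case (Suc N)
  then show ?case
    using integral_fd_e2pi[OF integrable_fd_funpow[OF g] v, of N] by simp
qed simp

text \<open>Each difference looks one step \<open>v\<close> ahead, so the support spreads by at most
  \<open>infnorm v\<close> per step.\<close>

lemma fd_funpow_support: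
  fixes g :: "real^'n \<Rightarrow> complex"
  assumes "\<And>\<xi>. \<xi> \<notin> cube c A \<Longrightarrow> g \<xi> = 0" and "\<xi> \<notin> cube c (A + real N * infnorm v)"
  shows "(fd v ^^ N) g \<xi> = 0"
  using assms(2)
proof (induction N arbitrary: \<xi>)
  case 0
  then show ?case using assms(1) by simp
next
  case (Suc N)
  have "infnorm (c - \<xi>) \<le> infnorm (c - (\<xi> + v)) + infnorm v"
    using infnorm_triangle[of "c - (\<xi> + v)" v] by simp
  then have "\<xi> + v \<notin> cube c (A + real N * infnorm v)" "\<xi> \<notin> cube c (A + real N * infnorm v)"
    using Suc.prems infnorm_pos_le[of v] by (auto simp: mem_cube algebra_simps)
  then show ?case unfolding fd_funpow_Suc using Suc.IH by simp
qed

lemma integrable_bounded_cube: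
  fixes g :: "real^'n \<Rightarrow> complex"
  assumes [measurable]: "g \<in> borel_measurable borel" and "A \<ge> 0"
    and B: "\<And>\<xi>. norm (g \<xi>) \<le> B" and supp: "\<And>\<xi>. \<xi> \<notin> cube c A \<Longrightarrow> g \<xi> = 0"
  shows "integrable lborel g" and "norm (LINT \<xi>|lborel. g \<xi>) \<le> B * (2 * A) ^ CARD('n)"
proof -
  have meas: "measure lborel (cube c A) = (2 * A) ^ CARD('n)"
    using emeasure_cube[OF \<open>A \<ge> 0\<close>, of c] \<open>A \<ge> 0\<close> by (simp add: measure_def)
  have int: "integrable lborel (\<lambda>\<xi>. B * indicator (cube c A) \<xi> :: real)"
    using emeasure_cube[OF \<open>A \<ge> 0\<close>, of c] by (intro integrable_mult_right integrable_real_indicator) auto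
  have le: "norm (g \<xi>) \<le> B * indicator (cube c A) \<xi>" for \<xi>
    using B[of \<xi>] supp[of \<xi>] by (auto simp: indicator_def)
  show "integrable lborel g"
    by (rule Bochner_Integration.integrable_bound[OF int])
       (use le in \<open>auto intro: order.trans[OF _ abs_ge_self]\<close>)
  have "norm (LINT \<xi>|lborel. g \<xi>) \<le> (LINT \<xi>|lborel. B * indicator (cube c A) \<xi>)"
    by (rule Bochner_Integration.integral_norm_bound_integral) (use le int \<open>integrable lborel g\<close> in auto)
  also have "\<dots> = B * (2 * A) ^ CARD('n)"
    using meas by simp
  finally show "norm (LINT \<xi>|lborel. g \<xi>) \<le> B * (2 * A) ^ CARD('n)" .
qed

text \<open>Difference form of |g| \<le> B and of the bound B l^-N for the N-th pure derivatives, as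
  for a bump living at scale l. All step lengths t are allowed because the step is chosen later,
  from the point at which the oscillatory integral is evaluated.\<close>

definition fd_bounded :: "nat \<Rightarrow> real \<Rightarrow> real \<Rightarrow> (real^'n \<Rightarrow> complex) \<Rightarrow> bool" where
  "fd_bounded N l B g \<longleftrightarrow> (\<forall>\<xi>. norm (g \<xi>) \<le> B) \<and>
     (\<forall>i t \<xi>. norm ((fd (t *\<^sub>R axis i 1) ^^ N) g \<xi>) \<le> B * (\<bar>t\<bar> / l) ^ N)"

text \<open>For l |x| \<le> 1 the trivial bound suffices, and 1 + l |x| \<le> 2 explains the factor
  2^N. Otherwise N differences are taken along the axis of the largest coordinate of x. They enlarge
  the support by at most N l, which is where A + N comes from.\<close>

lemma oscillatory_integral_bound:
  fixes g :: "real^'n \<Rightarrow> complex"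
  assumes [measurable]: "g \<in> borel_measurable borel" and "A \<ge> 0" "l > 0"
    and fdb: "fd_bounded N l B g" and supp: "\<And>\<xi>. \<xi> \<notin> cube c (A * l) \<Longrightarrow> g \<xi> = 0"
  shows "norm (LINT \<xi>|lborel. g \<xi> * e2pi (\<xi> \<bullet> x)) \<le>
    2 ^ N * (2 * (A + real N)) ^ CARD('n) * B * l ^ CARD('n) / (1 + l * infnorm x) ^ N"
proof -
  let ?n = "CARD('n)" and ?I = "LINT \<xi>|lborel. g \<xi> * e2pi (\<xi> \<bullet> x)"
  have B: "norm (g \<xi>) \<le> B" for \<xi> using fdb by (auto simp: fd_bounded_def)
  have B0: "B \<ge> 0" using B[of 0] norm_ge_zero order.trans by blast
  have intg: "integrable lborel g"
    by (rule integrable_bounded_cube(1)[of g "A * l" B c]) (use assms B in auto)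
  have xp: "infnorm x \<ge> 0" by (rule infnorm_pos_le)
  have V: "(2 * (A * l)) ^ ?n \<le> (2 * (A + real N)) ^ ?n * l ^ ?n"
    unfolding power_mult_distrib[symmetric] using \<open>A \<ge> 0\<close> \<open>l > 0\<close>
    by (intro power_mono) (auto simp: algebra_simps)
  show ?thesis
  proof (cases "l * infnorm x \<le> 1")
    case True
    have "norm ?I \<le> B * (2 * (A * l)) ^ ?n"
      by (rule integrable_bounded_cube(2)[of _ "A * l" B c]) (use assms B in \<open>auto simp: norm_mult\<close>)
    also have "\<dots> \<le> B * ((2 * (A + real N)) ^ ?n * l ^ ?n)"
      by (rule mult_left_mono[OF V B0])
    also have "\<dots> \<le> B * ((2 * (A + real N)) ^ ?n * l ^ ?n) * (2 ^ N / (1 + l * infnorm x) ^ N)"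
    proof -
      have "(1 + l * infnorm x) ^ N \<le> 2 ^ N"
        using True xp \<open>l > 0\<close> by (intro power_mono) auto
      moreover have "(1 + l * infnorm x) ^ N > 0"
        using xp \<open>l > 0\<close> by (simp add: add_pos_nonneg)
      ultimately have "1 \<le> 2 ^ N / (1 + l * infnorm x) ^ N" by (simp add: field_simps)
      moreover have "B * ((2 * (A + real N)) ^ ?n * l ^ ?n) \<ge> 0"
        using B0 \<open>A \<ge> 0\<close> \<open>l > 0\<close> by simp
      ultimately show ?thesis
        by (metis mult.right_neutral mult_left_mono)
    qed
    finally show ?thesis by (simp add: mult_ac)
  next
    case False
    obtain i where i: "infnorm x = \<bar>x $ i\<bar>" by (rule infnorm_attained)
    have x0: "infnorm x > 0" using False \<open>l > 0\<close> xp by (cases "infnorm x = 0") auto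
    \<comment> \<open>Half a period along the axis that realizes the sup norm: the character takes
      the value -1 at \<open>v\<close>.\<close>
    define t where "t = 1 / (2 * x $ i)"
    define v :: "real^'n" where "v = t *\<^sub>R axis i 1"
    have vx: "v \<bullet> x = 1 / 2" using x0 i by (simp add: v_def t_def inner_axis')
    then have ev: "e2pi (v \<bullet> x) = -1" by (subst vx) (simp add: e2pi_def)
    have at: "\<bar>t\<bar> = 1 / (2 * infnorm x)" by (simp add: t_def i)
    have "infnorm v = \<bar>t\<bar>"
    proof -
      have "infnorm (axis i 1 :: real^'n) = 1"
      proof (rule antisym)
        show "infnorm (axis i 1 :: real^'n) \<le> 1"
          using infnorm_le_norm[of "axis i 1 :: real^'n"] by simp
        show "1 \<le> infnorm (axis i 1 :: real^'n)"
          using component_le_infnorm_cart[of "axis i 1 :: real^'n" i] by simp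
      qed
      then show ?thesis by (simp add: v_def infnorm_mul)
    qed
    \<comment> \<open>Beyond |x| = 1/l the step is shorter than l, so the N differences stay
      supported in a cube of radius (A + N) l.\<close>
    moreover have "\<bar>t\<bar> \<le> l"
    proof -
      have "1 \<le> l * (2 * infnorm x)" using False x0 \<open>l > 0\<close> by (simp add: mult_ac)
      then show ?thesis using x0 by (simp add: at divide_le_eq)
    qed
    ultimately have vl: "infnorm v \<le> l" by simp
    define D where "D = B * (\<bar>t\<bar> / l) ^ N"
    have Db: "norm ((fd v ^^ N) g \<xi>) \<le> D" for \<xi>
      using fdb by (auto simp: fd_bounded_def v_def D_def)
    have D0: "D \<ge> 0" using B0 \<open>l > 0\<close> by (simp add: D_def)
    have Dsupp: "(fd v ^^ N) g \<xi> = 0" if "\<xi> \<notin> cube c (A * l + real N * infnorm v)" for \<xi>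
      by (rule fd_funpow_support[OF supp that])
    have [measurable]: "(fd v ^^ N) g \<in> borel_measurable borel"
      using integrable_fd_funpow[OF intg] by auto
    have "2 ^ N * norm ?I = norm (LINT \<xi>|lborel. (fd v ^^ N) g \<xi> * e2pi (\<xi> \<bullet> x))"
      unfolding integral_fd_funpow_e2pi[OF intg ev] by (simp add: norm_mult norm_power)
    also have "\<dots> \<le> D * (2 * (A * l + real N * infnorm v)) ^ ?n"
      by (rule integrable_bounded_cube(2)[where c=c])
         (use Db Dsupp \<open>A \<ge> 0\<close> \<open>l > 0\<close> infnorm_pos_le[of v] in \<open>auto simp: norm_mult\<close>)
    also have "\<dots> \<le> D * ((2 * (A + real N)) ^ ?n * l ^ ?n)"
      unfolding power_mult_distrib[symmetric]
      using \<open>A \<ge> 0\<close> \<open>l > 0\<close> infnorm_pos_le[of v] mult_left_mono[OF vl, of "real N"]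
      by (intro mult_left_mono[OF _ D0] power_mono) (auto simp: algebra_simps)
    also have "D = B * (1 / (2 * (l * infnorm x))) ^ N"
      by (simp add: D_def at mult_ac)
    also have "(1 / (2 * (l * infnorm x))) ^ N \<le> (1 / (1 + l * infnorm x)) ^ N"
      using False x0 \<open>l > 0\<close> by (intro power_mono) (auto simp: field_simps)
    finally have "2 ^ N * norm ?I \<le> B * (1 / (1 + l * infnorm x)) ^ N * ((2 * (A + real N)) ^ ?n * l ^ ?n)"
      using B0 \<open>A \<ge> 0\<close> \<open>l > 0\<close> by (simp add: mult_left_mono mult_right_mono mult.assoc)
    \<comment> \<open>The gain 2^N on the left is given away and then inserted on the right, so that
      both cases end with the same constant.\<close>
    moreover have "1 * norm ?I \<le> 2 ^ N * norm ?I" by (intro mult_right_mono) auto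
    ultimately have "norm ?I \<le> 1 * (B * (1 / (1 + l * infnorm x)) ^ N * ((2 * (A + real N)) ^ ?n * l ^ ?n))"
      by linarith
    also have "\<dots> \<le> 2 ^ N * (B * (1 / (1 + l * infnorm x)) ^ N * ((2 * (A + real N)) ^ ?n * l ^ ?n))"
      using B0 \<open>A \<ge> 0\<close> \<open>l > 0\<close> x0 by (intro mult_right_mono) auto
    finally show ?thesis by (simp add: power_one_over field_simps)
  qed
qed

section \<open>Functions with bounded derivatives in one coordinate direction\<close>

abbreviation line_deriv :: "'n \<Rightarrow> (real^'n::finite \<Rightarrow> complex) \<Rightarrow> complex \<Rightarrow> real^'n \<Rightarrow> bool" where
  "line_deriv i g D x \<equiv> ((\<lambda>t. g (x + t *\<^sub>R axis i 1)) has_vector_derivative D) (at 0)"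

text \<open>Each derivative along axis i costs a factor 1/l. The derivatives are existential
  witnesses rather than fixed operators: sums, products and gluing then need no discussion of
  Frechet derivatives, and one axis at a time is all that the differences ask for.\<close>

primrec line_bdd :: "nat \<Rightarrow> 'n \<Rightarrow> real \<Rightarrow> real \<Rightarrow> (real^'n::finite) set \<Rightarrow> (real^'n \<Rightarrow> complex) \<Rightarrow> bool" where
  "line_bdd 0 i l B S g \<longleftrightarrow> (\<forall>x\<in>S. norm (g x) \<le> B)"
| "line_bdd (Suc N) i l B S g \<longleftrightarrow> (\<forall>x\<in>S. norm (g x) \<le> B) \<and>
     (\<exists>g'. (\<forall>x\<in>S. line_deriv i g (g' x) x) \<and>
        line_bdd N i l (B / l) S g')"

lemma line_bdd_SucE:
  assumes "line_bdd (Suc N) i l B S g"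
  obtains g' where "\<forall>x\<in>S. norm (g x) \<le> B"
    "\<forall>x\<in>S. line_deriv i g (g' x) x"
    "line_bdd N i l (B / l) S g'"
proof -
  from assms obtain g' where "\<forall>x\<in>S. norm (g x) \<le> B"
    "\<forall>x\<in>S. line_deriv i g (g' x) x"
    "line_bdd N i l (B / l) S g'" by auto
  then show ?thesis by (intro that) auto
qed

lemma line_bdd_SucI:
  assumes "\<And>x. x \<in> S \<Longrightarrow> norm (g x) \<le> B"
    "\<And>x. x \<in> S \<Longrightarrow> line_deriv i g (g' x) x"
    "line_bdd N i l (B / l) S g'"
  shows "line_bdd (Suc N) i l B S g"
  using assms by auto

lemma line_bdd_bound: "line_bdd N i l B S g \<Longrightarrow> x \<in> S \<Longrightarrow> norm (g x) \<le> B"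
  by (cases N) auto

lemma line_bdd_mono:
  "line_bdd N i l B S g \<Longrightarrow> B \<le> C \<Longrightarrow> l > 0 \<Longrightarrow> T \<subseteq> S \<Longrightarrow> line_bdd N i l C T g"
proof (induction N arbitrary: g B C)
  case 0
  then show ?case using order.trans[OF _ \<open>B \<le> C\<close>] by auto
next
  case (Suc N)
  obtain g' where g: "\<forall>x\<in>S. norm (g x) \<le> B"
    "\<forall>x\<in>S. line_deriv i g (g' x) x"
    "line_bdd N i l (B / l) S g'" by (rule line_bdd_SucE[OF Suc.prems(1)])
  have "line_bdd N i l (C / l) T g'"
    by (rule Suc.IH[OF g(3)]) (use Suc.prems in \<open>auto simp: divide_right_mono\<close>)
  moreover have "norm (g x) \<le> C" if "x \<in> T" for x
    using order.trans[OF _ Suc.prems(2)] g(1) Suc.prems(4) that by blast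
  ultimately show ?case using g(2) Suc.prems(4) by (intro line_bdd_SucI) blast+
qed

lemma eventually_line_in_open:
  fixes x :: "real^'n"
  assumes "open S" "x \<in> S"
  obtains d where "d > 0" "\<And>t. \<bar>t\<bar> < d \<Longrightarrow> x + t *\<^sub>R axis i 1 \<in> S"
proof -
  obtain d where "d > 0" "ball x d \<subseteq> S" using assms by (auto simp: open_contains_ball)
  moreover have "x + t *\<^sub>R axis i 1 \<in> ball x d" if "\<bar>t\<bar> < d" for t
    using that by (simp add: dist_norm)
  ultimately show ?thesis by (intro that) auto
qed

lemma has_vector_derivative_line_cong:
  fixes x :: "real^'n"
  assumes "open S" "x \<in> S" "\<And>y. y \<in> S \<Longrightarrow> f y = g y"
    and "((\<lambda>t. f (x + t *\<^sub>R axis i 1)) has_vector_derivative D) (at 0)"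
  shows "((\<lambda>t. g (x + t *\<^sub>R axis i 1)) has_vector_derivative D) (at 0)"
proof -
  obtain d where d: "d > 0" "\<And>t. \<bar>t\<bar> < d \<Longrightarrow> x + t *\<^sub>R axis i 1 \<in> S"
    using eventually_line_in_open[OF assms(1,2)] by metis
  show ?thesis
    by (rule has_vector_derivative_transform_within_open[OF assms(4), of "{-d<..<d}"])
       (use d assms(3) in auto)
qed

text \<open>Openness makes the derivative at a point of \<open>S\<close> insensitive to the values
  off \<open>S\<close>.\<close>

lemma line_bdd_cong:
  assumes "open S"
  shows "line_bdd N i l B S f \<Longrightarrow> (\<And>y. y \<in> S \<Longrightarrow> f y = g y) \<Longrightarrow> line_bdd N i l B S g"
proof (induction N)
  case (Suc N)
  from Suc.prems(1) obtain g' where f: "\<forall>x\<in>S. norm (f x) \<le> B"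
    "\<forall>x\<in>S. line_deriv i f (g' x) x"
    "line_bdd N i l (B / l) S g'" by (rule line_bdd_SucE)
  note f = f[rule_format]
  show ?case
  proof (rule line_bdd_SucI[OF _ _ f(3)])
    fix x assume x: "x \<in> S"
    show "norm (g x) \<le> B" using f(1)[OF x] Suc.prems(2)[OF x] by simp
    show "line_deriv i g (g' x) x"
      by (rule has_vector_derivative_line_cong[OF assms x Suc.prems(2) f(2)[OF x]])
  qed
qed auto

lemma line_bdd_zero: "line_bdd N i l 0 S (\<lambda>x. 0)"
proof (induction N)
  case (Suc N)
  then show ?case by (auto intro!: exI[of _ "\<lambda>x. 0"])
qed auto

text \<open>The witnesses on the two open sets agree on the overlap because a derivative is unique,
  so they can be glued, inductively at every order.\<close>

lemma line_bdd_Un: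
  assumes "open S" "open T"
  shows "line_bdd N i l B S g \<Longrightarrow> line_bdd N i l B T g \<Longrightarrow> line_bdd N i l B (S \<union> T) g"
proof (induction N arbitrary: g B)
  case (Suc N)
  obtain f where f: "\<forall>x\<in>S. line_deriv i g (f x) x"
    "line_bdd N i l (B / l) S f" by (rule line_bdd_SucE[OF Suc.prems(1)])
  note f = f[rule_format]
  obtain h where h: "\<forall>x\<in>T. line_deriv i g (h x) x"
    "line_bdd N i l (B / l) T h" by (rule line_bdd_SucE[OF Suc.prems(2)])
  note h = h[rule_format]
  define k where "k x = (if x \<in> S then f x else h x)" for x
  have "k x = h x" if "x \<in> T" for x
    using vector_derivative_unique_at[OF f(1)[of x] h(1)[OF that]] by (auto simp: k_def)
  then have "line_bdd N i l (B / l) T k" by (intro line_bdd_cong[OF assms(2) h(2)]) auto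
  moreover have "line_bdd N i l (B / l) S k"
    by (intro line_bdd_cong[OF assms(1) f(2)]) (auto simp: k_def)
  ultimately have "line_bdd N i l (B / l) (S \<union> T) k" by (rule Suc.IH[rotated])
  moreover have "line_deriv i g (k x) x" if "x \<in> S \<union> T" for x
    using that f(1) h(1) by (auto simp: k_def)
  ultimately show ?case using Suc.prems by auto
qed auto

lemma line_bdd_add:
  "line_bdd N i l B S f \<Longrightarrow> line_bdd N i l C S g \<Longrightarrow> line_bdd N i l (B + C) S (\<lambda>x. f x + g x)"
proof (induction N arbitrary: f g B C)
  case 0
  then show ?case by (force intro: norm_triangle_mono)
next
  case (Suc N)
  obtain f' where f: "\<forall>x\<in>S. line_deriv i f (f' x) x"
    "line_bdd N i l (B / l) S f'" by (rule line_bdd_SucE[OF Suc.prems(1)])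
  note f = f[rule_format]
  obtain g' where g: "\<forall>x\<in>S. line_deriv i g (g' x) x"
    "line_bdd N i l (C / l) S g'" by (rule line_bdd_SucE[OF Suc.prems(2)])
  note g = g[rule_format]
  have "line_bdd N i l ((B + C) / l) S (\<lambda>x. f' x + g' x)"
    unfolding add_divide_distrib by (rule Suc.IH[OF f(2) g(2)])
  moreover have "((\<lambda>t. f (x + t *\<^sub>R axis i 1) + g (x + t *\<^sub>R axis i 1)) has_vector_derivative (f' x + g' x)) (at 0)"
    if "x \<in> S" for x using f(1) g(1) that by (intro has_vector_derivative_add)
  moreover have "\<forall>x\<in>S. norm (f x + g x) \<le> B + C"
    using Suc.prems by (auto intro: norm_triangle_mono)
  ultimately show ?case by (intro line_bdd_SucI) auto
qed

lemma line_bdd_sum: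
  assumes "finite I" "\<And>k. k \<in> I \<Longrightarrow> line_bdd N i l (B k) S (f k)"
  shows "line_bdd N i l (\<Sum>k\<in>I. B k) S (\<lambda>x. \<Sum>k\<in>I. f k x)"
  using assms by (induction I rule: finite_induct) (auto intro: line_bdd_add line_bdd_zero)

text \<open>Product rule: each derivative doubles the number of terms, hence 2^N.\<close>

lemma line_bdd_mult:
  "line_bdd N i l B S f \<Longrightarrow> line_bdd N i l C S g \<Longrightarrow> B \<ge> 0 \<Longrightarrow> C \<ge> 0 \<Longrightarrow> l > 0 \<Longrightarrow>
    line_bdd N i l (2 ^ N * (B * C)) S (\<lambda>x. f x * g x)"
proof (induction N arbitrary: f g B C)
  case 0
  then show ?case by (auto simp: norm_mult intro: mult_mono)
next
  case (Suc N)
  obtain f' where f: "\<forall>x\<in>S. line_deriv i f (f' x) x"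
    "line_bdd N i l (B / l) S f'" by (rule line_bdd_SucE[OF Suc.prems(1)])
  note f = f[rule_format]
  obtain g' where g: "\<forall>x\<in>S. line_deriv i g (g' x) x"
    "line_bdd N i l (C / l) S g'" by (rule line_bdd_SucE[OF Suc.prems(2)])
  note g = g[rule_format]
  \<comment> \<open>One order can be forgotten at the same bound; in the product rule an
    undifferentiated factor of order N + 1 meets a derivative of order N.\<close>
  have down: "line_bdd N i l B S f" if "line_bdd (Suc N) i l B S f" for B f
    using that
  proof (induction N arbitrary: B f)
    case (Suc N)
    from Suc.prems obtain f' where "\<forall>x\<in>S. norm (f x) \<le> B"
      "\<forall>x\<in>S. line_deriv i f (f' x) x"
      "line_bdd (Suc N) i l (B / l) S f'" by (subst (asm) line_bdd.simps(2)) auto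
    with Suc.IH[of "B / l" f'] show ?case by auto
  qed auto
  have fN: "line_bdd N i l B S f" "line_bdd N i l C S g" using Suc.prems down by blast+
  have "line_bdd N i l (2 ^ N * (B * (C / l))) S (\<lambda>x. f x * g' x)"
    by (rule Suc.IH[OF fN(1) g(2)]) (use Suc.prems in auto)
  moreover have "line_bdd N i l (2 ^ N * ((B / l) * C)) S (\<lambda>x. f' x * g x)"
    by (rule Suc.IH[OF f(2) fN(2)]) (use Suc.prems in auto)
  ultimately have "line_bdd N i l (2 ^ N * (B * (C / l)) + 2 ^ N * ((B / l) * C)) S (\<lambda>x. f x * g' x + f' x * g x)"
    by (rule line_bdd_add)
  then have "line_bdd N i l (2 ^ Suc N * (B * C) / l) S (\<lambda>x. f x * g' x + f' x * g x)"
    by (simp add: field_simps)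
  moreover have "((\<lambda>t. f (x + t *\<^sub>R axis i 1) * g (x + t *\<^sub>R axis i 1)) has_vector_derivative (f x * g' x + f' x * g x)) (at 0)"
    if "x \<in> S" for x using has_vector_derivative_mult[OF f(1)[OF that] g(1)[OF that]] by simp
  moreover have "norm (f x * g x) \<le> 2 ^ Suc N * (B * C)" if "x \<in> S" for x
  proof -
    have "norm (f x * g x) \<le> 1 * (B * C)"
      using Suc.prems that by (auto simp: norm_mult intro: mult_mono)
    also have "\<dots> \<le> 2 ^ Suc N * (B * C)"
      using Suc.prems by (intro mult_right_mono one_le_power) auto
    finally show ?thesis .
  qed
  ultimately show ?case by (intro line_bdd_SucI)
qed

text \<open>Every derivative of the rescaled function brings out a factor s, which the scale l / s
  records.\<close>

lemma line_bdd_affine: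
  assumes "s > 0" "l > 0"
  shows "line_bdd N i l B UNIV g \<Longrightarrow> line_bdd N i (l / s) B UNIV (\<lambda>x. g (s *\<^sub>R x + c))"
proof (induction N arbitrary: g B)
  case (Suc N)
  obtain g' where g: "\<forall>x\<in>UNIV. line_deriv i g (g' x) x"
    "line_bdd N i l (B / l) UNIV g'" by (rule line_bdd_SucE[OF Suc.prems])
  note g = g(1)[rule_format, OF UNIV_I] g(2)
  have "line_bdd N i (l / s) (B / l) UNIV (\<lambda>x. g' (s *\<^sub>R x + c))"
    by (rule Suc.IH[OF g(2)])
  then have *: "line_bdd N i (l / s) (2 ^ 0 * (s * (B / l))) UNIV (\<lambda>x. s *\<^sub>R g' (s *\<^sub>R x + c))"
  proof -
    have "line_bdd N i l' (s * C) S (\<lambda>x. s *\<^sub>R h x)" if "line_bdd N i l' C S h" for l' C S h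
      using that
    proof (induction N arbitrary: C h)
      case 0
      then show ?case using \<open>s > 0\<close> by auto
    next
      case (Suc N)
      obtain h' where h: "\<forall>x\<in>S. line_deriv i h (h' x) x"
        "line_bdd N i l' (C / l') S h'" by (rule line_bdd_SucE[OF Suc.prems])
      note h = h[rule_format]
      have "line_bdd N i l' (s * C / l') S (\<lambda>x. s *\<^sub>R h' x)"
        using Suc.IH[OF h(2)] by simp
      moreover have "((\<lambda>t. s *\<^sub>R h (x + t *\<^sub>R axis i 1)) has_vector_derivative s *\<^sub>R h' x) (at 0)" if "x \<in> S" for x
        using h(1)[OF that] by (rule has_vector_derivative_scaleR[OF DERIV_const, simplified])
      ultimately show ?case using line_bdd_bound[OF Suc.prems] \<open>s > 0\<close> by (intro line_bdd_SucI) auto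
    qed
    from this[OF \<open>line_bdd N i (l / s) (B / l) UNIV (\<lambda>x. g' (s *\<^sub>R x + c))\<close>] show ?thesis by simp
  qed
  have "((\<lambda>t. g (s *\<^sub>R (x + t *\<^sub>R axis i 1) + c)) has_vector_derivative s *\<^sub>R g' (s *\<^sub>R x + c)) (at 0)" for x
  proof -
    have "((\<lambda>t. g (s *\<^sub>R x + c + t *\<^sub>R axis i 1)) \<circ> (\<lambda>t. s * t) has_vector_derivative s *\<^sub>R g' (s *\<^sub>R x + c)) (at 0)"
      by (rule vector_diff_chain_at) (use g(1) in \<open>auto intro!: derivative_eq_intros\<close>)
    then show ?thesis by (simp add: o_def algebra_simps)
  qed
  then show ?case using line_bdd_bound[OF Suc.prems] * by (intro line_bdd_SucI) (auto simp: mult_ac)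
qed auto

lemma line_bdd_fd_bound:
  assumes "l > 0" "line_bdd (Suc N) i l B UNIV g"
  shows "norm (fd (h *\<^sub>R axis i 1) g x) \<le> B * (\<bar>h\<bar> / l)"
proof -
  obtain g' where g: "\<forall>x\<in>UNIV. line_deriv i g (g' x) x"
    "line_bdd N i l (B / l) UNIV g'" by (rule line_bdd_SucE[OF assms(2)])
  note g = g(1)[rule_format, OF UNIV_I] g(2)
  have g': "norm (g' y) \<le> B / l" for y using line_bdd_bound[OF g(2)] by simp
  have D: "((\<lambda>t. g (x + t *\<^sub>R axis i 1)) has_vector_derivative g' (x + s *\<^sub>R axis i 1)) (at s)" for s
  proof -
    have "((\<lambda>t. g (x + s *\<^sub>R axis i 1 + t *\<^sub>R axis i 1)) \<circ> (\<lambda>t. t - s) has_vector_derivative 1 *\<^sub>R g' (x + s *\<^sub>R axis i 1)) (at s)"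
      by (rule vector_diff_chain_at) (use g(1) in \<open>auto intro!: derivative_eq_intros\<close>)
    then show ?thesis by (simp add: o_def algebra_simps)
  qed
  have "norm (g (x + h *\<^sub>R axis i 1) - g (x + 0 *\<^sub>R axis i 1)) \<le> (B / l) * norm (h - 0)"
  proof (rule differentiable_bound[of UNIV])
    fix s :: real
    show "((\<lambda>t. g (x + t *\<^sub>R axis i 1)) has_derivative (\<lambda>t. t *\<^sub>R g' (x + s *\<^sub>R axis i 1))) (at s within UNIV)"
      using D by (simp add: has_vector_derivative_def)
    show "onorm (\<lambda>t. t *\<^sub>R g' (x + s *\<^sub>R axis i 1)) \<le> B / l"
    proof (rule onorm_le)
      fix t :: real
      show "norm (t *\<^sub>R g' (x + s *\<^sub>R axis i 1)) \<le> B / l * norm t"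
        using mult_left_mono[OF g'[of "x + s *\<^sub>R axis i 1"] abs_ge_zero[of t]] by (simp add: mult.commute)
    qed
  qed auto
  then show ?thesis by (simp add: fd_def)
qed

text \<open>Trades one derivative for one difference. The mean value inequality applies to g and to
  all its derivatives alike, since differencing commutes with differentiation along the
  axis.\<close>

lemma line_bdd_fd:
  assumes "l > 0"
  shows "line_bdd (Suc N) i l B UNIV g \<Longrightarrow> line_bdd N i l (B * (\<bar>h\<bar> / l)) UNIV (fd (h *\<^sub>R axis i 1) g)"
proof (induction N arbitrary: g B)
  case 0
  then show ?case using line_bdd_fd_bound[OF assms 0] by simp
next
  case (Suc N)
  obtain g' where g: "\<forall>x\<in>UNIV. line_deriv i g (g' x) x"
    "line_bdd (Suc N) i l (B / l) UNIV g'" by (rule line_bdd_SucE[OF Suc.prems])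
  note g = g(1)[rule_format, OF UNIV_I] g(2)
  have "line_bdd N i l (B * (\<bar>h\<bar> / l) / l) UNIV (fd (h *\<^sub>R axis i 1) g')"
    using Suc.IH[OF g(2)] by simp
  moreover have "((\<lambda>t. fd (h *\<^sub>R axis i 1) g (x + t *\<^sub>R axis i 1)) has_vector_derivative fd (h *\<^sub>R axis i 1) g' x) (at 0)" for x
    using has_vector_derivative_diff[OF g(1)[of "x + h *\<^sub>R axis i 1"] g(1)[of x]]
    by (simp add: fd_def add_ac)
  ultimately show ?case using line_bdd_fd_bound[OF assms Suc.prems] by (intro line_bdd_SucI)
qed

lemma line_bdd_fd_funpow:
  assumes "l > 0"
  shows "line_bdd N i l B UNIV g \<Longrightarrow> norm ((fd (h *\<^sub>R axis i 1) ^^ N) g x) \<le> B * (\<bar>h\<bar> / l) ^ N"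
proof (induction N arbitrary: g B)
  case (Suc N)
  from Suc.IH[OF line_bdd_fd[OF assms Suc.prems]] show ?case
    by (simp add: funpow_swap1 mult_ac)
qed auto

lemma line_bdd_imp_fd_bounded:
  assumes "l > 0" "\<And>i. line_bdd N i l B UNIV g"
  shows "fd_bounded N l B g"
  using assms line_bdd_fd_funpow line_bdd_bound unfolding fd_bounded_def by blast

text \<open>A derivative multiplies the character by 2 pi i v_i, of size at most 2 pi / l. The
  induction carries a constant prefactor \<open>w\<close> that absorbs it; since 2 pi \<ge> 1, the
  top power also dominates the lower orders.\<close>

lemma line_bdd_e2pi:
  assumes "l > 0" and "\<bar>v $ i\<bar> \<le> 1 / l"
  shows "line_bdd N i l ((2 * pi) ^ N) S (\<lambda>x::real^'n. e2pi (x \<bullet> v))"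
proof -
  have gen: "line_bdd N i l ((2 * pi) ^ N * norm w) S (\<lambda>x::real^'n. w * e2pi (x \<bullet> v))" for w :: complex
  proof (induction N arbitrary: w)
    case 0
    then show ?case by (simp add: norm_mult)
  next
    case (Suc N)
    have *: "norm (w * e2pi (x \<bullet> v)) \<le> (2 * pi) ^ Suc N * norm w" for x
    proof -
      have "1 \<le> (2 * pi) ^ Suc N" using pi_ge_two by (intro one_le_power) auto
      then have "1 * norm w \<le> (2 * pi) ^ Suc N * norm w" by (intro mult_right_mono) auto
      then show ?thesis by (simp add: norm_mult)
    qed
    define w' where "w' = w * (\<i> * of_real (2 * pi * v $ i))"
    have "norm w' \<le> 2 * pi * norm w / l"
    proof -
      have "norm w' = 2 * pi * norm w * \<bar>v $ i\<bar>" by (simp add: w'_def norm_mult)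
      also have "\<dots> \<le> 2 * pi * norm w * (1 / l)" using assms by (intro mult_left_mono) auto
      finally show ?thesis by simp
    qed
    then have "(2 * pi) ^ N * norm w' \<le> (2 * pi) ^ N * (2 * pi * norm w / l)"
      by (intro mult_left_mono) auto
    then have "line_bdd N i l ((2 * pi) ^ Suc N * norm w / l) S (\<lambda>x. w' * e2pi (x \<bullet> v))"
      by (intro line_bdd_mono[OF Suc.IH[of w']]) (use assms in \<open>auto simp: mult_ac\<close>)
    moreover have "((\<lambda>t. w * e2pi ((x + t *\<^sub>R axis i 1) \<bullet> v)) has_vector_derivative w' * e2pi (x \<bullet> v)) (at 0)" for x
    proof -
      have "((\<lambda>t. w * e2pi (x \<bullet> v + v $ i * t)) has_vector_derivative w * ((2 * pi * v $ i) *\<^sub>R (\<i> * e2pi (x \<bullet> v + v $ i * 0)))) (at 0)"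
        by (intro has_vector_derivative_mult_right e2pi_has_vector_derivative)
      moreover have "(x + t *\<^sub>R axis i 1) \<bullet> v = x \<bullet> v + v $ i * t" for t
        by (simp add: inner_add_left inner_axis')
      ultimately show ?thesis
        by (simp add: w'_def scaleR_conv_of_real mult_ac)
    qed
    ultimately show ?case using * by (intro line_bdd_SucI)
  qed
  from gen[of 1] show ?thesis by simp
qed

section \<open>Derivatives of smooth functions and of symbols\<close>

lemma frechet_derivative_cong_open:
  assumes "open S" "x \<in> S" "\<And>y. y \<in> S \<Longrightarrow> f y = g y" "f differentiable (at x)"
  shows "g differentiable (at x)" and "frechet_derivative g (at x) = frechet_derivative f (at x)"
proof -
  have "(f has_derivative frechet_derivative f (at x)) (at x)"
    using assms(4) frechet_derivative_works by blast
  then have "(g has_derivative frechet_derivative f (at x)) (at x)"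
    by (rule has_derivative_transform_within_open[OF _ assms(1,2)]) (use assms(3) in auto)
  then show "g differentiable (at x)" "frechet_derivative g (at x) = frechet_derivative f (at x)"
    using frechet_derivative_at[of g] by (auto simp: differentiable_def)
qed

lemma Ck_on_cong:
  assumes "open S"
  shows "Ck_on k S f \<Longrightarrow> (\<And>x. x \<in> S \<Longrightarrow> f x = g x) \<Longrightarrow> Ck_on k S g"
proof (induction k arbitrary: f g)
  case 0
  then show ?case by (simp cong: continuous_on_cong)
next
  case (Suc k)
  have d: "f differentiable (at x)" if "x \<in> S" for x using Suc.prems that by simp
  have "Ck_on k S (\<lambda>x. frechet_derivative g (at x) v)" for v
  proof (rule Suc.IH)
    show "Ck_on k S (\<lambda>x. frechet_derivative f (at x) v)" using Suc.prems by simp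
    show "frechet_derivative f (at x) v = frechet_derivative g (at x) v" if "x \<in> S" for x
      using frechet_derivative_cong_open(2)[OF assms that Suc.prems(2) d[OF that]] by simp
  qed
  then show ?case
    using frechet_derivative_cong_open(1)[OF assms _ Suc.prems(2) d] by simp
qed

lemma smooth_on_cong:
  "open S \<Longrightarrow> smooth_on S f \<Longrightarrow> (\<And>x. x \<in> S \<Longrightarrow> f x = g x) \<Longrightarrow> smooth_on S g"
  unfolding smooth_on_def using Ck_on_cong by metis

lemma smooth_onD:
  assumes "smooth_on S f"
  shows "continuous_on S f" and "x \<in> S \<Longrightarrow> f differentiable (at x)"
    and "smooth_on S (\<lambda>x. frechet_derivative f (at x) v)"
proof -
  have "Ck_on k S f" for k using assms by (simp add: smooth_on_def)
  from this[of 0] this[of "Suc k" for k]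
  show "continuous_on S f" "x \<in> S \<Longrightarrow> f differentiable (at x)"
    "smooth_on S (\<lambda>x. frechet_derivative f (at x) v)"
    by (auto simp: smooth_on_def)
qed

lemma has_vector_derivative_direction:
  fixes f :: "'a::real_normed_vector \<Rightarrow> 'b::real_normed_vector"
  assumes "f differentiable (at (x + t *\<^sub>R v))"
  shows "((\<lambda>t. f (x + t *\<^sub>R v)) has_vector_derivative frechet_derivative f (at (x + t *\<^sub>R v)) v) (at t)"
proof -
  have f: "(f has_derivative frechet_derivative f (at (x + t *\<^sub>R v))) (at (x + t *\<^sub>R v))"
    using assms frechet_derivative_works by blast
  have "((\<lambda>t. x + t *\<^sub>R v) has_derivative (\<lambda>s. s *\<^sub>R v)) (at t)"
    by (auto intro!: derivative_eq_intros)
  from diff_chain_at[OF this f] show ?thesis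
    by (simp add: o_def has_vector_derivative_def linear_cmul[OF has_derivative_linear[OF f]])
qed

lemma partial_deriv_eq_frechet:
  fixes f :: "real^'n \<Rightarrow> 'b::real_normed_vector"
  assumes "f differentiable (at x)"
  shows "((\<lambda>t. f (x + t *\<^sub>R axis i 1)) has_vector_derivative partial_deriv i f x) (at 0)"
    and "partial_deriv i f x = frechet_derivative f (at x) (axis i 1)"
proof -
  have *: "((\<lambda>t. f (x + t *\<^sub>R axis i 1)) has_vector_derivative frechet_derivative f (at x) (axis i 1)) (at 0)"
    using has_vector_derivative_direction[of f x 0 "axis i 1"] assms by simp
  then show "partial_deriv i f x = frechet_derivative f (at x) (axis i 1)"
    unfolding partial_deriv_def by (rule vector_derivative_at)
  with * show "((\<lambda>t. f (x + t *\<^sub>R axis i 1)) has_vector_derivative partial_deriv i f x) (at 0)"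
    by simp
qed

lemma smooth_on_partial_deriv:
  fixes f :: "real^'n \<Rightarrow> 'b::real_normed_vector"
  assumes "open S" "smooth_on S f"
  shows "smooth_on S (partial_deriv i f)"
  by (rule smooth_on_cong[OF assms(1) smooth_onD(3)[OF assms(2), of "axis i 1"]])
     (simp add: partial_deriv_eq_frechet(2)[OF smooth_onD(2)[OF assms(2)]])

lemma line_bdd_smooth:
  fixes f :: "real^'n \<Rightarrow> complex"
  assumes "open S" "l > 0"
  shows "smooth_on S f \<Longrightarrow> T \<subseteq> S \<Longrightarrow>
    (\<And>k \<xi>. k \<le> N \<Longrightarrow> \<xi> \<in> T \<Longrightarrow> norm ((partial_deriv i ^^ k) f \<xi>) \<le> B / l ^ k) \<Longrightarrow> line_bdd N i l B T f"
proof (induction N arbitrary: f B)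
  case 0
  from "0.prems"(3)[of 0] show ?case by simp
next
  case (Suc N)
  have "line_bdd N i l (B / l) T (partial_deriv i f)"
  proof (rule Suc.IH[OF smooth_on_partial_deriv[OF assms(1) Suc.prems(1)] Suc.prems(2)])
    fix k \<xi> assume "k \<le> N" "\<xi> \<in> T"
    then show "norm ((partial_deriv i ^^ k) (partial_deriv i f) \<xi>) \<le> B / l / l ^ k"
      using Suc.prems(3)[of "Suc k" \<xi>] by (simp add: funpow_swap1 mult.commute)
  qed
  moreover have "norm (f \<xi>) \<le> B" if "\<xi> \<in> T" for \<xi> using Suc.prems(3)[of 0 \<xi>] that by simp
  ultimately show ?case
    using smooth_onD(2)[OF Suc.prems(1)] Suc.prems(2)
    by (intro line_bdd_SucI) (auto intro: partial_deriv_eq_frechet(1))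
qed

definition single_mi :: "'n \<Rightarrow> nat \<Rightarrow> 'n multiindex" where
  "single_mi i k = (\<lambda>j. if j = i then k else 0)"

lemma mi_deg_single [simp]: "mi_deg (single_mi (i::'n::finite) k) = k"
  by (simp add: mi_deg_def single_mi_def)

lemma mi_deg_0 [simp]: "mi_deg (\<lambda>i::'n::finite. 0) = 0"
  by (simp add: mi_deg_def)

lemma multi_deriv_0 [simp]: "multi_deriv (\<lambda>i::'n::finite. 0) f = f"
proof -
  have "fold (\<lambda>i g. (partial_deriv i ^^ 0) g) xs f = f" for xs :: "'n list"
    by (induction xs) auto
  then show ?thesis by (simp add: multi_deriv_def)
qed

text \<open>The unspecified enumeration of the coordinates does no harm: every index other than i
  contributes a zeroth iterate, and distinctness makes i occur exactly once.\<close>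

lemma multi_deriv_single: "multi_deriv (single_mi (i::'n::finite) k) f = (partial_deriv i ^^ k) f"
proof -
  define xs where "xs = (SOME xs::'n list. distinct xs \<and> set xs = UNIV)"
  have "\<exists>xs::'n list. distinct xs \<and> set xs = UNIV"
    using finite_distinct_list[of "UNIV::'n set"] by auto
  from someI_ex[OF this] have xs: "distinct xs" "set xs = UNIV" by (simp_all add: xs_def)
  have "fold (\<lambda>j g. (partial_deriv j ^^ single_mi i k j) g) ys f =
      (if i \<in> set ys then (partial_deriv i ^^ k) f else f)" if "distinct ys" for ys
    using that by (induction ys arbitrary: f) (auto simp: single_mi_def)
  from this[OF xs(1)] show ?thesis using xs(2) by (simp add: multi_deriv_def xs_def)
qed

section \<open>Numerical bounds extracted from the symbol seminorms\<close>

lemma symbol_const_bound: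
  fixes a :: "real^'n \<Rightarrow> real^'n \<Rightarrow> complex"
  assumes "symbol_const a \<alpha> \<beta> < \<infinity>" and "\<xi> \<noteq> 0"
  shows "norm \<xi> powi (int (mi_deg \<alpha>) - int (mi_deg \<beta>)) *
      norm (multi_deriv \<alpha> (\<lambda>\<zeta>. multi_deriv \<beta> (\<lambda>x'. a x' \<zeta>) x) \<xi>) \<le> enn2real (symbol_const a \<alpha> \<beta>)"
proof -
  have "ennreal (norm \<xi> powi (int (mi_deg \<alpha>) - int (mi_deg \<beta>)) *
      norm (multi_deriv \<alpha> (\<lambda>\<zeta>. multi_deriv \<beta> (\<lambda>x'. a x' \<zeta>) x) \<xi>)) \<le> symbol_const a \<alpha> \<beta>"
    unfolding symbol_const_def by (rule SUP_upper2[of "(x, \<xi>)"]) (use assms in auto)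
  also have "\<dots> = ennreal (enn2real (symbol_const a \<alpha> \<beta>))"
    using assms by (simp add: ennreal_enn2real_if less_top)
  finally show ?thesis by (simp add: ennreal_le_iff)
qed

text \<open>Only pure frequency derivatives, combined with at most one derivative in space, are used.\<close>

definition symbol_size :: "('n::finite multiindex \<Rightarrow> 'n multiindex \<Rightarrow> ennreal) \<Rightarrow> real" where
  "symbol_size c = (\<Sum>i\<in>UNIV. \<Sum>k\<le>CARD('n) + 2.
     enn2real (c (single_mi i k) (\<lambda>_. 0)) + (\<Sum>j\<in>UNIV. enn2real (c (single_mi i k) (single_mi j 1))))"

lemma symbol_size_nonneg: "symbol_size c \<ge> 0"
  unfolding symbol_size_def by (intro sum_nonneg add_nonneg_nonneg) auto

lemma symbol_size_ge:
  fixes c :: "'n::finite multiindex \<Rightarrow> 'n multiindex \<Rightarrow> ennreal"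
  assumes "k \<le> CARD('n) + 2"
  shows "enn2real (c (single_mi i k) (\<lambda>_. 0)) \<le> symbol_size c"
    and "enn2real (c (single_mi i k) (single_mi j 1)) \<le> symbol_size c"
proof -
  let ?f = "\<lambda>i k. enn2real (c (single_mi i k) (\<lambda>_. 0)) + (\<Sum>j\<in>UNIV. enn2real (c (single_mi i k) (single_mi j 1)))"
  have pos: "?f i k \<ge> 0" for i k by (intro sum_nonneg add_nonneg_nonneg) auto
  have "?f i k \<le> (\<Sum>k\<le>CARD('n) + 2. ?f i k)"
    by (rule member_le_sum) (use assms pos in auto)
  also have "\<dots> \<le> symbol_size c"
    unfolding symbol_size_def
    by (rule member_le_sum[where f="\<lambda>i. \<Sum>k\<le>CARD('n) + 2. ?f i k"]) (simp_all add: sum_nonneg pos del: sum.atMost_Suc)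
  finally have *: "?f i k \<le> symbol_size c" .
  have j: "enn2real (c (single_mi i k) (single_mi j 1)) \<le> (\<Sum>j\<in>UNIV. enn2real (c (single_mi i k) (single_mi j 1)))"
    by (rule member_le_sum) auto
  have nn: "enn2real (c (single_mi i k) (\<lambda>_. 0)) \<ge> 0" "(\<Sum>j\<in>UNIV. enn2real (c (single_mi i k) (single_mi j 1))) \<ge> 0"
    by (auto intro: sum_nonneg)
  show "enn2real (c (single_mi i k) (\<lambda>_. 0)) \<le> symbol_size c" using * nn by linarith
  show "enn2real (c (single_mi i k) (single_mi j 1)) \<le> symbol_size c" using * nn j by linarith
qed

text \<open>An open neighbourhood of l/25 \<le> |\<xi>| \<le> 2l, the region in which all cutoffs at
  scale l live. The margin lets bounds on the annulus be glued to the zero bound on the open sets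
  |\<xi>| < l/25 and |\<xi>| > 2l.\<close>

definition annulus :: "real \<Rightarrow> (real^'n::finite) set" where
  "annulus l = {\<xi>. l / 30 < infnorm \<xi> \<and> infnorm \<xi> < 3 * l}"

lemma open_annulus: "open (annulus l :: (real^'n::finite) set)"
  unfolding annulus_def by (intro open_Collect_conj open_Collect_less continuous_intros)

text \<open>The symbol estimates with one constant \<open>M\<close>, on annuli where |\<xi>| is
  comparable to l. \<open>a' j\<close> is the j-th spatial derivative, larger by a factor l. Nothing
  is said about the value at \<xi> = 0, where a may be discontinuous.\<close>

locale symbol =
  fixes a :: "real^'n::finite \<Rightarrow> real^'n \<Rightarrow> complex" and a' :: "'n \<Rightarrow> real^'n \<Rightarrow> real^'n \<Rightarrow> complex"
    and M :: real
  assumes M_nonneg: "M \<ge> 0"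
    and cont: "continuous_on (- {0}) (a x)"
    and bdd: "l > 0 \<Longrightarrow> line_bdd (CARD('n) + 2) i l M (annulus l) (a x)"
    and bdd': "l > 0 \<Longrightarrow> line_bdd (CARD('n) + 2) i l (M * l) (annulus l) (a' j x)"
    and deriv: "\<xi> \<noteq> 0 \<Longrightarrow> ((\<lambda>t. a (x + t *\<^sub>R w) \<xi>) has_vector_derivative
        (\<Sum>j\<in>UNIV. (w $ j) *\<^sub>R a' j (x + t *\<^sub>R w) \<xi>)) (at t)"
    and bounded: "\<xi> \<noteq> 0 \<Longrightarrow> norm (a x \<xi>) \<le> M"

text \<open>By the chain rule, derivatives of the slice in direction v are slices of joint
  derivatives in direction (0, v), so the induction has to run over all smooth F.\<close>

lemma smooth_on_slice:
  fixes F :: "'a::real_normed_vector \<times> 'b::real_normed_vector \<Rightarrow> 'c::real_normed_vector"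
  assumes "open S" "smooth_on (UNIV \<times> S) F"
  shows "smooth_on S (\<lambda>\<xi>. F (x, \<xi>))"
proof -
  have "Ck_on k S (\<lambda>\<xi>. F (x, \<xi>))" if "smooth_on (UNIV \<times> S) F"
    for k and F :: "'a \<times> 'b \<Rightarrow> 'c"
    using that
  proof (induction k arbitrary: F)
    case 0
    have "continuous_on S (F \<circ> (\<lambda>\<xi>. (x, \<xi>)))"
      by (intro continuous_on_compose continuous_intros continuous_on_subset[OF smooth_onD(1)[OF 0]]) auto
    then show ?case by (simp add: o_def)
  next
    case (Suc k)
    have *: "((\<lambda>\<xi>. F (x, \<xi>)) has_derivative (\<lambda>v. frechet_derivative F (at (x, \<xi>)) (0, v))) (at \<xi>)" if "\<xi> \<in> S" for \<xi>
    proof -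
      have "(F has_derivative frechet_derivative F (at (x, \<xi>))) (at (x, \<xi>))"
        using smooth_onD(2)[OF Suc.prems, of "(x, \<xi>)"] that frechet_derivative_works by blast
      moreover have "((\<lambda>\<xi>. (x, \<xi>)) has_derivative (\<lambda>v. (0, v))) (at \<xi>)"
        by (auto intro!: derivative_eq_intros)
      ultimately show ?thesis using diff_chain_at[of "\<lambda>\<xi>. (x, \<xi>)" _ \<xi> F] by (simp add: o_def)
    qed
    have "Ck_on k S (\<lambda>\<xi>. frechet_derivative (\<lambda>\<xi>. F (x, \<xi>)) (at \<xi>) v)" for v
      by (rule Ck_on_cong[OF assms(1) Suc.IH[OF smooth_onD(3)[OF Suc.prems, of "(0, v)"]]])
         (use frechet_derivative_at[OF *] in metis)
    then show ?case using * by (auto simp: differentiable_def)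
  qed
  then show ?thesis using assms(2) by (simp add: smooth_on_def)
qed

text \<open>On the annulus |\<xi>| \<ge> l/30 turns |\<xi>|^-k into at most 30^(n+2) l^-k, and the
  extra |\<xi>| of a spatial derivative is at most 3 n l, the n coming from the comparison of the
  Euclidean norm with the sup norm.\<close>

lemma symbol_of_symbol_const:
  fixes a :: "real^'n::finite \<Rightarrow> real^'n \<Rightarrow> complex"
  assumes smooth: "smooth_on (UNIV \<times> (- {0})) (\<lambda>(x, \<xi>). a x \<xi>)"
    and fin: "\<And>\<alpha> \<beta>. symbol_const a \<alpha> \<beta> < \<infinity>"
  shows "symbol a (\<lambda>j x \<xi>. partial_deriv j (\<lambda>x'. a x' \<xi>) x)
    (30 ^ (CARD('n) + 2) * (3 * CARD('n)) * symbol_size (symbol_const a))"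
proof -
  let ?n = "CARD('n)" and ?a' = "\<lambda>j x \<xi>. partial_deriv j (\<lambda>x'. a x' \<xi>) x"
  let ?F = "\<lambda>(x, \<xi>). a x \<xi>" and ?S = "- {0} :: (real^'n) set"
  define Z where "Z = symbol_size (symbol_const a)"
  have Z: "Z \<ge> 0" by (simp add: Z_def symbol_size_nonneg)
  have n: "1 \<le> real ?n * 3" by (simp add: Suc_le_eq order.trans[of _ "real ?n"])
  define M where "M = 30 ^ (?n + 2) * (3 * ?n) * Z"
  have op: "open (UNIV \<times> ?S :: ((real^'n) \<times> (real^'n)) set)" by (intro open_Times) auto
  have an: "annulus l \<subseteq> ?S" if "l > 0" for l
    using that by (auto simp: annulus_def infnorm_0)
  have M: "30 ^ (?n + 2) * Z \<le> M" "M \<ge> 0"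
    using n Z mult_left_mono[of 1 "3 * real ?n" "30 ^ (?n + 2) * Z"]
    by (simp_all add: M_def mult_ac)
  have lower: "1 / norm \<xi> ^ k \<le> 30 ^ (?n + 2) / l ^ k" if "l > 0" "\<xi> \<in> annulus l" "k \<le> ?n + 2"
    for l k and \<xi> :: "real^'n"
  proof -
    have "l / 30 \<le> norm \<xi>" using infnorm_le_norm[of \<xi>] that by (auto simp: annulus_def)
    then have "1 / norm \<xi> ^ k \<le> 1 / (l / 30) ^ k"
      using that by (intro divide_left_mono power_mono mult_pos_pos zero_less_power) auto
    also have "\<dots> = 30 ^ k / l ^ k" by (simp add: power_divide)
    also have "\<dots> \<le> 30 ^ (?n + 2) / l ^ k"
      using that by (intro divide_right_mono power_increasing) auto
    finally show ?thesis .
  qed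
  have b0: "norm ((partial_deriv i ^^ k) (a x) \<xi>) \<le> Z / norm \<xi> ^ k" if "k \<le> ?n + 2" "\<xi> \<noteq> 0" for i k x \<xi>
  proof -
    have "norm \<xi> ^ k * norm ((partial_deriv i ^^ k) (a x) \<xi>) \<le> Z"
      using symbol_const_bound[OF fin that(2), of "single_mi i k" "\<lambda>_. 0" x] symbol_size_ge(1)[OF that(1), of "symbol_const a" i]
      by (simp add: multi_deriv_single Z_def)
    then show ?thesis using that by (simp add: field_simps)
  qed
  have b1: "norm ((partial_deriv i ^^ k) (?a' j x) \<xi>) \<le> norm \<xi> * Z / norm \<xi> ^ k" if "k \<le> ?n + 2" "\<xi> \<noteq> 0" for i j k x \<xi>
  proof -
    have "norm \<xi> powi (int k - 1) * norm ((partial_deriv i ^^ k) (?a' j x) \<xi>) \<le> Z"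
      using symbol_const_bound[OF fin that(2), of "single_mi i k" "single_mi j 1" x] symbol_size_ge(2)[OF that(1), of "symbol_const a" i j]
      by (simp add: multi_deriv_single Z_def)
    moreover have "norm \<xi> powi (int k - 1) = norm \<xi> ^ k / norm \<xi>"
      using that by (simp add: power_int_diff)
    ultimately show ?thesis using that by (simp add: field_simps)
  qed
  have sa: "smooth_on ?S (a x)" for x
    using smooth_on_slice[OF _ smooth, of x] by (simp add: open_Compl)
  have pd: "((\<lambda>x'. a x' \<xi>) has_derivative (\<lambda>v. frechet_derivative ?F (at (x, \<xi>)) (v, 0))) (at x)" if "\<xi> \<noteq> 0" for x \<xi>
  proof -
    have "(?F has_derivative frechet_derivative ?F (at (x, \<xi>))) (at (x, \<xi>))"
      using smooth_onD(2)[OF smooth, of "(x, \<xi>)"] that frechet_derivative_works by blast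
    moreover have "((\<lambda>x. (x, \<xi>)) has_derivative (\<lambda>v. (v, 0))) (at x)"
      by (auto intro!: derivative_eq_intros)
    ultimately show ?thesis using diff_chain_at[of "\<lambda>x. (x, \<xi>)" _ x ?F] by (simp add: o_def)
  qed
  have pd': "(\<lambda>x'. a x' \<xi>) differentiable (at x)" if "\<xi> \<noteq> 0" for x \<xi>
    using pd[OF that] by (auto simp: differentiable_def)
  \<comment> \<open>A spatial derivative of a is a derivative of the joint function in direction
    (e_j, 0), hence jointly smooth, and its frequency slices are smooth as well.\<close>
  have "smooth_on (UNIV \<times> ?S) (\<lambda>(x, \<xi>). ?a' j x \<xi>)" for j
  proof (rule smooth_on_cong[OF op smooth_onD(3)[OF smooth, of "(axis j 1, 0)"]])
    fix p :: "(real^'n) \<times> (real^'n)" assume p: "p \<in> UNIV \<times> ?S"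
    obtain x \<xi> where [simp]: "p = (x, \<xi>)" by (cases p)
    show "frechet_derivative ?F (at p) (axis j 1, 0) = (\<lambda>(x, \<xi>). ?a' j x \<xi>) p"
      using fun_cong[OF frechet_derivative_at[OF pd[of \<xi> x]], of "axis j 1"] partial_deriv_eq_frechet(2)[OF pd'[of \<xi> x], of j] p
      by simp
  qed
  then have sa': "smooth_on ?S (?a' j x)" for j x
    using smooth_on_slice[of ?S "\<lambda>(x, \<xi>). ?a' j x \<xi>" x] by (simp add: open_Compl)
  have "symbol a ?a' M"
  proof
    show "M \<ge> 0" by fact
    show "continuous_on ?S (a x)" for x using smooth_onD(1)[OF sa] .
    fix l :: real and i j :: 'n and x assume l: "l > 0"
    show "line_bdd (?n + 2) i l M (annulus l) (a x)"
    proof (rule line_bdd_smooth[OF _ l sa an[OF l]])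
      fix k and \<xi> :: "real^'n" assume k: "k \<le> ?n + 2" and \<xi>: "\<xi> \<in> annulus l"
      have "norm ((partial_deriv i ^^ k) (a x) \<xi>) \<le> Z * (1 / norm \<xi> ^ k)"
        using b0[OF k, of \<xi>] an[OF l] \<xi> by auto
      also have "\<dots> \<le> Z * (30 ^ (?n + 2) / l ^ k)"
        by (rule mult_left_mono[OF lower[OF l \<xi> k] Z])
      also have "\<dots> \<le> M / l ^ k" using M l by (simp add: divide_right_mono mult.commute)
      finally show "norm ((partial_deriv i ^^ k) (a x) \<xi>) \<le> M / l ^ k" .
    qed auto
    show "line_bdd (?n + 2) i l (M * l) (annulus l) (?a' j x)"
    proof (rule line_bdd_smooth[OF _ l sa' an[OF l]])
      fix k and \<xi> :: "real^'n" assume k: "k \<le> ?n + 2" and \<xi>: "\<xi> \<in> annulus l"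
      have "norm \<xi> \<le> ?n * infnorm \<xi>" by (rule norm_le_card_infnorm)
      also have "\<dots> \<le> ?n * (3 * l)" using \<xi> by (intro mult_left_mono) (auto simp: annulus_def)
      finally have up: "norm \<xi> * Z \<le> ?n * (3 * l) * Z" using Z by (rule mult_right_mono)
      have "norm ((partial_deriv i ^^ k) (?a' j x) \<xi>) \<le> (norm \<xi> * Z) * (1 / norm \<xi> ^ k)"
        using b1[OF k, of \<xi>] an[OF l] \<xi> by auto
      also have "\<dots> \<le> (?n * (3 * l) * Z) * (30 ^ (?n + 2) / l ^ k)"
        using Z l by (intro mult_mono[OF up lower[OF l \<xi> k]]) auto
      also have "\<dots> = M * l / l ^ k" by (simp add: M_def mult_ac)
      finally show "norm ((partial_deriv i ^^ k) (?a' j x) \<xi>) \<le> M * l / l ^ k" .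
    qed auto
  next
    fix \<xi> x :: "real^'n" assume "\<xi> \<noteq> 0"
    have "1 * Z \<le> 30 ^ (?n + 2) * Z" using Z by (intro mult_right_mono one_le_power) auto
    \<comment> \<open>At order 0 the coordinate is immaterial, hence
      \<open>undefined\<close>.\<close>
    with b0[of 0 \<xi> undefined x] \<open>\<xi> \<noteq> 0\<close> M(1) show "norm (a x \<xi>) \<le> M" by simp
  next
    fix \<xi> x w :: "real^'n" and t assume \<xi>: "\<xi> \<noteq> 0"
    let ?f = "\<lambda>x'. a x' \<xi>"
    have lin: "linear (frechet_derivative ?f (at (x + t *\<^sub>R w)))"
      using pd'[OF \<xi>] by (rule linear_frechet_derivative)
    have "frechet_derivative ?f (at (x + t *\<^sub>R w)) w =
        frechet_derivative ?f (at (x + t *\<^sub>R w)) (\<Sum>j\<in>UNIV. (w $ j) *\<^sub>R axis j 1)"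
      using basis_expansion[of w] by (simp add: scalar_mult_eq_scaleR)
    also have "\<dots> = (\<Sum>j\<in>UNIV. (w $ j) *\<^sub>R ?a' j (x + t *\<^sub>R w) \<xi>)"
      using pd'[OF \<xi>] by (simp add: linear_sum[OF lin] linear_cmul[OF lin] partial_deriv_eq_frechet(2))
    finally show "((\<lambda>t. a (x + t *\<^sub>R w) \<xi>) has_vector_derivative
        (\<Sum>j\<in>UNIV. (w $ j) *\<^sub>R ?a' j (x + t *\<^sub>R w) \<xi>)) (at t)"
      using has_vector_derivative_direction[of ?f x t w, OF pd'[OF \<xi>]] by simp
  qed
  then show ?thesis by (simp add: M_def Z_def)
qed

section \<open>The bump and bounds for its derivatives\<close>

locale bump =
  fixes \<Phi> :: "real^'n::finite \<Rightarrow> real" and P :: real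
  assumes P_ge: "P \<ge> 1"
    and \<Phi>_cont: "continuous_on UNIV \<Phi>"
    and \<Phi>_bdd: "line_bdd (CARD('n) + 2) i 1 P UNIV (\<lambda>\<xi>. of_real (\<Phi> \<xi>))"
    and \<Phi>_1: "infnorm \<xi> \<le> 9 / 100 \<Longrightarrow> \<Phi> \<xi> = 1"
    and \<Phi>_0: "infnorm \<xi> > 1 / 10 \<Longrightarrow> \<Phi> \<xi> = 0"
    and \<Phi>_nonneg: "\<Phi> \<xi> \<ge> 0" and \<Phi>_le_1: "\<Phi> \<xi> \<le> 1"

text \<open>The Schwartz seminorms with weight 1 and pure derivatives up to order n + 2 are finitely
  many finite numbers; \<open>P\<close> is 1 plus their sum. The bump is made complex-valued because
  line bounds are stated for complex functions.\<close>

lemma bump_of_schwartz: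
  fixes \<Phi> :: "real^'n::finite \<Rightarrow> real"
  assumes "schwartz \<Phi>" and lo: "\<And>x. indicator (cube 0 (9/100)) x \<le> \<Phi> x"
    and up: "\<And>x. \<Phi> x \<le> indicator (cube 0 (1/10)) x"
  shows "\<exists>P. bump \<Phi> P"
proof -
  have sm: "smooth_on UNIV \<Phi>" using assms(1) by (simp add: schwartz_def)
  have smk: "smooth_on UNIV ((partial_deriv i ^^ k) \<Phi>)" for i k
    by (induction k) (auto intro: smooth_on_partial_deriv sm)
  have of_real_pd: "(partial_deriv i ^^ k) (\<lambda>\<xi>. of_real (\<Phi> \<xi>) :: complex) = (\<lambda>\<xi>. of_real ((partial_deriv i ^^ k) \<Phi> \<xi>))" for i k
  proof (induction k)
    case (Suc k)
    show ?case
    proof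
      fix \<xi>
      have "((\<lambda>t. of_real ((partial_deriv i ^^ k) \<Phi> (\<xi> + t *\<^sub>R axis i 1)) :: complex) has_vector_derivative
          of_real (partial_deriv i ((partial_deriv i ^^ k) \<Phi>) \<xi>)) (at 0)"
        by (rule has_vector_derivative_of_real)
           (use partial_deriv_eq_frechet(1)[of "(partial_deriv i ^^ k) \<Phi>" \<xi> i] smooth_onD(2)[OF smk]
             in \<open>auto simp: has_real_derivative_iff_has_vector_derivative\<close>)
      from vector_derivative_at[OF this]
      show "(partial_deriv i ^^ Suc k) (\<lambda>\<xi>. of_real (\<Phi> \<xi>) :: complex) \<xi> = of_real ((partial_deriv i ^^ Suc k) \<Phi> \<xi>)"
        by (simp add: Suc.IH partial_deriv_def[of i "\<lambda>\<xi>. of_real ((partial_deriv i ^^ k) \<Phi> \<xi>)"])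
    qed
  qed simp
  have "\<exists>B. \<forall>\<xi>. \<bar>(partial_deriv i ^^ k) \<Phi> \<xi>\<bar> \<le> B" for i k
  proof -
    have "bounded (range (\<lambda>x. monomial (\<lambda>_. 0) x *\<^sub>R multi_deriv (single_mi i k) \<Phi> x))"
      using assms(1) unfolding schwartz_def by blast
    then show ?thesis by (auto simp: monomial_def multi_deriv_single bounded_iff)
  qed
  then have ex: "\<exists>B. \<forall>\<xi>. \<bar>(partial_deriv i ^^ k) \<Phi> \<xi>\<bar> \<le> B" for i k .
  define B where "B i k = (SOME B. \<forall>\<xi>. \<bar>(partial_deriv i ^^ k) \<Phi> \<xi>\<bar> \<le> B)" for i k
  have B: "\<bar>(partial_deriv i ^^ k) \<Phi> \<xi>\<bar> \<le> B i k" for i k \<xi>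
    unfolding B_def by (rule someI_ex[OF ex, rule_format])
  define P where "P = 1 + (\<Sum>i\<in>UNIV. \<Sum>k\<le>CARD('n) + 2. \<bar>B i k\<bar>)"
  have BP: "B i k \<le> P" if "k \<le> CARD('n) + 2" for i k
  proof -
    have "\<bar>B i k\<bar> \<le> (\<Sum>k\<le>CARD('n) + 2. \<bar>B i k\<bar>)" by (rule member_le_sum) (use that in auto)
    also have "\<dots> \<le> (\<Sum>i\<in>UNIV. \<Sum>k\<le>CARD('n) + 2. \<bar>B i k\<bar>)"
      by (rule member_le_sum[where f="\<lambda>i. \<Sum>k\<le>CARD('n) + 2. \<bar>B i k\<bar>"]) (auto intro: sum_nonneg)
    finally show ?thesis by (simp add: P_def)
  qed
  have smc: "smooth_on UNIV (\<lambda>\<xi>. of_real (\<Phi> \<xi>) :: complex)"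
  proof -
    have "Ck_on k UNIV (\<lambda>\<xi>. of_real (f \<xi>) :: complex)" if "smooth_on UNIV f" for k and f :: "real^'n \<Rightarrow> real"
      using that
    proof (induction k arbitrary: f)
      case 0
      then show ?case using smooth_onD(1)[OF 0] by (auto intro: continuous_intros)
    next
      case (Suc k)
      have *: "((\<lambda>\<xi>. of_real (f \<xi>) :: complex) has_derivative (\<lambda>v. of_real (frechet_derivative f (at \<xi>) v))) (at \<xi>)" for \<xi>
        using smooth_onD(2)[OF Suc.prems, of \<xi>] frechet_derivative_works by (intro has_derivative_of_real) auto
      have "frechet_derivative (\<lambda>\<xi>. of_real (f \<xi>) :: complex) (at \<xi>) = (\<lambda>v. of_real (frechet_derivative f (at \<xi>) v))" for \<xi>
        using frechet_derivative_at[OF *] by simp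
      then show ?case using * Suc.IH[OF smooth_onD(3)[OF Suc.prems]] by (auto simp: differentiable_def)
    qed
    then show ?thesis using sm by (simp add: smooth_on_def)
  qed
  have "bump \<Phi> P"
  proof
    show "P \<ge> 1" by (auto simp: P_def intro!: sum_nonneg)
    show "continuous_on UNIV \<Phi>" by (rule smooth_onD(1)[OF sm])
    show "line_bdd (CARD('n) + 2) i 1 P UNIV (\<lambda>\<xi>. of_real (\<Phi> \<xi>))" for i
      by (rule line_bdd_smooth[OF _ _ smc]) (auto simp: of_real_pd intro: order.trans[OF B BP])
    fix \<xi> :: "real^'n"
    show "\<Phi> \<xi> \<ge> 0" using order.trans[OF indicator_pos_le lo] .
    show "\<Phi> \<xi> \<le> 1" using order.trans[OF up indicator_le_1] .
    show "\<Phi> \<xi> = 1" if "infnorm \<xi> \<le> 9 / 100"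
      using lo[of \<xi>] \<open>\<Phi> \<xi> \<le> 1\<close> that by (auto simp: mem_cube infnorm_neg indicator_def)
    show "\<Phi> \<xi> = 0" if "infnorm \<xi> > 1 / 10"
      using up[of \<xi>] \<open>\<Phi> \<xi> \<ge> 0\<close> that by (auto simp: mem_cube infnorm_neg indicator_def)
  qed
  then show ?thesis ..
qed

section \<open>Frequency-localized pieces of a symbol\<close>

lemma line_bdd_const: "l > 0 \<Longrightarrow> line_bdd N i l (norm c) S (\<lambda>x. c)"
proof (cases N)
  case (Suc N')
  assume "l > 0"
  have "line_bdd N' i l (norm c / l) S (\<lambda>x. 0)"
    using \<open>l > 0\<close> by (intro line_bdd_mono[OF line_bdd_zero]) auto
  then show ?thesis unfolding Suc by (intro line_bdd_SucI) auto
qed auto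

lemma line_bdd_inner:
  fixes w :: "real^'n::finite"
  assumes "l > 0" "\<And>\<xi>. \<xi> \<in> S \<Longrightarrow> \<bar>\<xi> \<bullet> w\<bar> \<le> B" "\<bar>w $ i\<bar> \<le> B / l"
  shows "line_bdd N i l B S (\<lambda>\<xi>. of_real (\<xi> \<bullet> w))"
proof (cases N)
  case (Suc N')
  have "line_bdd N' i l (B / l) S (\<lambda>\<xi>. of_real (w $ i))"
    by (rule line_bdd_mono[OF line_bdd_const]) (use assms in auto)
  moreover have "((\<lambda>t. complex_of_real ((\<xi> + t *\<^sub>R axis i 1) \<bullet> w)) has_vector_derivative of_real (w $ i)) (at 0)" for \<xi>
    by (rule has_vector_derivative_of_real)
       (auto simp: inner_add_left inner_axis' intro!: derivative_eq_intros)
  ultimately show ?thesis unfolding Suc using assms by (intro line_bdd_SucI) auto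
qed (use assms in auto)

text \<open>One class for both kinds of cutoff. The inner radius is 6 * 9/100 - 1/2 = 1/25: a tile
  cutoff equals 1 up to distance 54/100 from the centre of its tile, and the base point is at
  distance at most 1/2 from it (in units of the side). The radius 2 exceeds 6/10 + 1/2 and is
  otherwise arbitrary.\<close>

definition cutoff :: "real \<Rightarrow> (real^'n::finite \<Rightarrow> complex) \<Rightarrow> bool" where
  "cutoff X \<theta> \<longleftrightarrow> X \<ge> 0 \<and> continuous_on UNIV \<theta> \<and> (\<forall>i. line_bdd (CARD('n) + 2) i 1 X UNIV \<theta>) \<and>
     (\<forall>\<xi>. infnorm \<xi> \<le> 1 / 25 \<longrightarrow> \<theta> \<xi> = 0) \<and> (\<forall>\<xi>. infnorm \<xi> > 2 \<longrightarrow> \<theta> \<xi> = 0)"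

lemma cutoff_scaled:
  fixes \<theta> :: "real^'n::finite \<Rightarrow> complex"
  assumes "cutoff X \<theta>" "l > 0"
  shows "line_bdd (CARD('n) + 2) i l X UNIV (\<lambda>\<xi>. \<theta> ((1 / l) *\<^sub>R \<xi>))"
    and "infnorm \<xi> \<le> l / 25 \<Longrightarrow> \<theta> ((1 / l) *\<^sub>R \<xi>) = 0"
    and "infnorm \<xi> > 2 * l \<Longrightarrow> \<theta> ((1 / l) *\<^sub>R \<xi>) = 0"
    and "continuous_on S (\<lambda>\<xi>. \<theta> ((1 / l) *\<^sub>R \<xi>))"
proof -
  have "line_bdd (CARD('n) + 2) i (1 / (1 / l)) X UNIV (\<lambda>\<xi>. \<theta> ((1 / l) *\<^sub>R \<xi> + 0))"
    by (rule line_bdd_affine) (use assms in \<open>auto simp: cutoff_def\<close>)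
  then show "line_bdd (CARD('n) + 2) i l X UNIV (\<lambda>\<xi>. \<theta> ((1 / l) *\<^sub>R \<xi>))" by simp
  show "infnorm \<xi> \<le> l / 25 \<Longrightarrow> \<theta> ((1 / l) *\<^sub>R \<xi>) = 0" "infnorm \<xi> > 2 * l \<Longrightarrow> \<theta> ((1 / l) *\<^sub>R \<xi>) = 0"
    using assms by (auto simp: cutoff_def infnorm_mul field_simps)
  have "continuous_on UNIV \<theta>" using assms by (simp add: cutoff_def)
  then show "continuous_on S (\<lambda>\<xi>. \<theta> ((1 / l) *\<^sub>R \<xi>))"
    by (rule continuous_on_compose2) (auto intro!: continuous_intros)
qed

text \<open>Extension by zero: the complement of the support contains open sets which overlap the
  annulus and together with it cover the space.\<close>

lemma line_bdd_from_annulus: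
  fixes g :: "real^'n::finite \<Rightarrow> complex"
  assumes "line_bdd N i l B (annulus l) g" "l > 0" "B \<ge> 0"
    and "\<And>\<xi>. infnorm \<xi> \<le> l / 25 \<or> infnorm \<xi> > 2 * l \<Longrightarrow> g \<xi> = 0"
  shows "line_bdd N i l B UNIV g"
proof -
  define T where "T = {\<xi>::real^'n. infnorm \<xi> < l / 25} \<union> {\<xi>. 2 * l < infnorm \<xi>}"
  have T: "open T" unfolding T_def
    by (intro open_Un open_Collect_less continuous_intros)
  have "line_bdd N i l B T (\<lambda>\<xi>. 0)" by (rule line_bdd_mono[OF line_bdd_zero]) (use assms in auto)
  then have "line_bdd N i l B T g"
    by (rule line_bdd_cong[OF T]) (use assms(4) in \<open>auto simp: T_def\<close>)
  from line_bdd_Un[OF open_annulus T assms(1) this]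
  have "line_bdd N i l B (annulus l \<union> T) g" .
  moreover have "annulus l \<union> T = UNIV" using \<open>l > 0\<close> by (auto simp: annulus_def T_def not_less)
  ultimately show ?thesis by simp
qed

lemma fd_funpow_has_vector_derivative:
  assumes "\<And>\<xi>. ((\<lambda>t. G t \<xi>) has_vector_derivative H \<xi>) (at t within S)"
  shows "((\<lambda>t. (fd v ^^ N) (G t) \<xi>) has_vector_derivative (fd v ^^ N) H \<xi>) (at t within S)"
proof (induction N arbitrary: \<xi>)
  case (Suc N)
  show ?case unfolding fd_funpow_Suc by (intro has_vector_derivative_diff Suc.IH)
qed (use assms in simp)

text \<open>Finite differences in frequency commute trivially with a derivative in a parameter. This spares
  commuting space and frequency derivatives of the symbol, whose bounds come in one order only.\<close>

lemma fd_bounded_increment: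
  fixes G :: "real \<Rightarrow> real^'n::finite \<Rightarrow> complex"
  assumes "\<And>t \<xi>. t \<in> {0..1} \<Longrightarrow> ((\<lambda>t. G t \<xi>) has_vector_derivative H t \<xi>) (at t within {0..1})"
    and "\<And>t. t \<in> {0..1} \<Longrightarrow> fd_bounded N l D (H t)"
  shows "fd_bounded N l D (\<lambda>\<xi>. G 1 \<xi> - G 0 \<xi>)"
proof -
  have mvt: "norm (f 1 - f 0) \<le> K"
    if "\<And>t. t \<in> {0..1::real} \<Longrightarrow> (f has_vector_derivative f' t) (at t within {0..1})"
      "\<And>t. t \<in> {0..1} \<Longrightarrow> norm (f' t) \<le> K" for f f' :: "real \<Rightarrow> complex" and K
  proof -
    have "norm (f 1 - f 0) \<le> K * norm (1 - 0 :: real)"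
    proof (rule differentiable_bound[of "{0..1}" f "\<lambda>t s. s *\<^sub>R f' t"])
      fix t :: real assume t: "t \<in> {0..1}"
      show "(f has_derivative (\<lambda>s. s *\<^sub>R f' t)) (at t within {0..1})"
        using that(1)[OF t] by (simp add: has_vector_derivative_def)
      show "onorm (\<lambda>s. s *\<^sub>R f' t) \<le> K"
      proof (rule onorm_le)
        fix s :: real
        show "norm (s *\<^sub>R f' t) \<le> K * norm s"
          using mult_left_mono[OF that(2)[OF t] abs_ge_zero[of s]] by (simp add: mult.commute)
      qed
    qed auto
    then show ?thesis by simp
  qed
  show ?thesis
    unfolding fd_bounded_def fd_funpow_diff
  proof (intro conjI allI)
    fix \<xi>
    show "norm (G 1 \<xi> - G 0 \<xi>) \<le> D"
      by (rule mvt[of "\<lambda>t. G t \<xi>" "\<lambda>t. H t \<xi>"]) (use assms in \<open>auto simp: fd_bounded_def\<close>)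
    fix i s
    show "norm ((fd (s *\<^sub>R axis i 1) ^^ N) (G 1) \<xi> - (fd (s *\<^sub>R axis i 1) ^^ N) (G 0) \<xi>) \<le> D * (\<bar>s\<bar> / l) ^ N"
      by (rule mvt[of "\<lambda>t. (fd (s *\<^sub>R axis i 1) ^^ N) (G t) \<xi>" "\<lambda>t. (fd (s *\<^sub>R axis i 1) ^^ N) (H t) \<xi>"])
         (use assms(2) in \<open>auto simp: fd_bounded_def intro!: fd_funpow_has_vector_derivative assms(1)\<close>)
  qed
qed

text \<open>The constant of \<open>oscillatory_integral_bound\<close> for n + 2 differences and
  support radius A = 2.\<close>

definition osc_const :: "'n::finite itself \<Rightarrow> real" where
  "osc_const _ = 2 ^ (CARD('n) + 2) * (2 * (2 + real (CARD('n) + 2))) ^ CARD('n)"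

text \<open>The outer two factors 2^N come from multiplying by the cutoff and by the character,
  whose own bound is (2 pi)^N. Inside, the first term is the spatial gradient, n products with
  coordinates of the displacement; the second is the derivative 2 pi i (\<xi> . d) of the phase,
  with |\<xi> . d| \<le> 3 n r l.\<close>

definition incr_const :: "'n::finite itself \<Rightarrow> real" where
  "incr_const _ = (let N = CARD('n) + 2 in
     2 ^ N * (2 ^ N * (CARD('n) * 2 ^ N + 2 ^ N * (2 * pi * (2 ^ N * (3 * CARD('n))))) * (2 * pi) ^ N))"

context symbol
begin

text \<open>The kernel of the part of a(x, D) at frequencies of size about l, as a function of the
  difference of positions.\<close>

definition piece :: "(real^'n \<Rightarrow> complex) \<Rightarrow> real \<Rightarrow> real^'n \<Rightarrow> real^'n \<Rightarrow> complex" where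
  "piece \<theta> l x z = (LINT \<xi>|lborel. a x \<xi> * \<theta> ((1 / l) *\<^sub>R \<xi>) * e2pi (\<xi> \<bullet> z))"

lemma line_bdd_localized:
  assumes "cutoff X \<theta>" "l > 0"
  shows "line_bdd (CARD('n) + 2) i l (2 ^ (CARD('n) + 2) * (M * X)) UNIV (\<lambda>\<xi>. a x \<xi> * \<theta> ((1 / l) *\<^sub>R \<xi>))"
proof (rule line_bdd_from_annulus)
  have X: "X \<ge> 0" using assms by (simp add: cutoff_def)
  show "line_bdd (CARD('n) + 2) i l (2 ^ (CARD('n) + 2) * (M * X)) (annulus l) (\<lambda>\<xi>. a x \<xi> * \<theta> ((1 / l) *\<^sub>R \<xi>))"
    by (intro line_bdd_mult bdd line_bdd_mono[OF cutoff_scaled(1)[OF assms]]) (use assms X M_nonneg in auto)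
  show "0 \<le> 2 ^ (CARD('n) + 2) * (M * X)" using X M_nonneg by simp
qed (use cutoff_scaled(2,3)[OF assms] assms in auto)

text \<open>The possible discontinuity of a(x, .) at 0 is invisible because the cutoff vanishes near
  0.\<close>

lemma continuous_localized:
  assumes "cutoff X \<theta>" "l > 0"
  shows "continuous_on UNIV (\<lambda>\<xi>. a x \<xi> * \<theta> ((1 / l) *\<^sub>R \<xi>))"
proof -
  have 1: "continuous_on (- {0}) (\<lambda>\<xi>. a x \<xi> * \<theta> ((1 / l) *\<^sub>R \<xi>))"
    by (intro continuous_on_mult cont cutoff_scaled(4)[OF assms])
  have "continuous_on {\<xi>::real^'n. infnorm \<xi> < l / 25} (\<lambda>\<xi>. 0 :: complex)" by simp
  then have 2: "continuous_on {\<xi>. infnorm \<xi> < l / 25} (\<lambda>\<xi>. a x \<xi> * \<theta> ((1 / l) *\<^sub>R \<xi>))"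
    by (rule continuous_on_eq) (use cutoff_scaled(2)[OF assms] in auto)
  have "continuous_on (- {0} \<union> {\<xi>. infnorm \<xi> < l / 25}) (\<lambda>\<xi>. a x \<xi> * \<theta> ((1 / l) *\<^sub>R \<xi>))"
    by (rule continuous_on_open_Un[OF _ _ 1 2]) (auto intro!: open_Collect_less continuous_intros)
  moreover have "- {0} \<union> {\<xi>::real^'n. infnorm \<xi> < l / 25} = UNIV" using assms by (auto simp: infnorm_0)
  ultimately show ?thesis by simp
qed

lemma localized_support:
  assumes "cutoff X \<theta>" "l > 0" "\<xi> \<notin> cube 0 (2 * l)"
  shows "a x \<xi> * \<theta> ((1 / l) *\<^sub>R \<xi>) = 0"
  using cutoff_scaled(3)[OF assms(1,2)] assms(3) by (auto simp: mem_cube infnorm_neg)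

lemma localized_integrable:
  assumes "cutoff X \<theta>" "l > 0"
  shows "integrable lborel (\<lambda>\<xi>. a x \<xi> * \<theta> ((1 / l) *\<^sub>R \<xi>))"
    and "(\<lambda>\<xi>. a x \<xi> * \<theta> ((1 / l) *\<^sub>R \<xi>)) \<in> borel_measurable borel"
    and "norm (a x \<xi> * \<theta> ((1 / l) *\<^sub>R \<xi>)) \<le> 2 ^ (CARD('n) + 2) * (M * X)"
proof -
  show m: "(\<lambda>\<xi>. a x \<xi> * \<theta> ((1 / l) *\<^sub>R \<xi>)) \<in> borel_measurable borel"
    by (rule borel_measurable_continuous_onI[OF continuous_localized[OF assms]])
  show b: "norm (a x \<xi> * \<theta> ((1 / l) *\<^sub>R \<xi>)) \<le> 2 ^ (CARD('n) + 2) * (M * X)" for \<xi>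
    using line_bdd_bound[OF line_bdd_localized[OF assms]] by simp
  show "integrable lborel (\<lambda>\<xi>. a x \<xi> * \<theta> ((1 / l) *\<^sub>R \<xi>))"
    by (rule integrable_bounded_cube(1)[OF m _ b localized_support[OF assms]]) (use assms in auto)
qed

lemma piece_bound:
  assumes "cutoff X \<theta>" "l > 0"
  shows "norm (piece \<theta> l x z) \<le>
    osc_const TYPE('n) * (2 ^ (CARD('n) + 2) * (M * X)) * l ^ CARD('n) / (1 + l * infnorm z) ^ (CARD('n) + 2)"
  unfolding piece_def osc_const_def
  by (rule oscillatory_integral_bound[OF _ _ _ line_bdd_imp_fd_bounded localized_support[OF assms]])
     (use assms line_bdd_localized[OF assms] localized_integrable(2)[OF assms] in auto)

text \<open>Both kernels are written as integrals against the same character e(\<xi> . (z - w)),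
  with the remaining phase e(\<xi> . (y - z)) put into the amplitude. Along the segment from z to y
  the amplitude changes at a rate of order r l, since a spatial derivative and a factor \<xi> both
  cost l. The condition r l \<le> 1 keeps the extra phase slowly varying at scale l.\<close>

lemma piece_increment_bound:
  assumes \<theta>: "cutoff X \<theta>" and l: "l > 0" and r: "infnorm (y - z) \<le> r" "r * l \<le> 1"
  shows "norm (piece \<theta> l y (y - w) - piece \<theta> l z (z - w)) \<le>
    osc_const TYPE('n) * (incr_const TYPE('n) * (M * X) * (r * l)) * l ^ CARD('n) /
      (1 + l * infnorm (z - w)) ^ (CARD('n) + 2)"
proof -
  define N where "N = CARD('n) + 2"
  define d where "d = y - z"
  define cl where "cl \<xi> = \<theta> ((1 / l) *\<^sub>R \<xi>)" for \<xi>
  \<comment> \<open>\<open>G\<close> interpolates between the two amplitudes; \<open>H\<close> is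
    its derivative in t, and \<open>S\<close> collects the spatial gradient along \<open>d\<close>
    and the derivative of the phase.\<close>
  define G where "G t \<xi> = a (z + t *\<^sub>R d) \<xi> * e2pi (\<xi> \<bullet> (t *\<^sub>R d)) * cl \<xi>" for t \<xi>
  define S where "S t \<xi> = (\<Sum>j\<in>UNIV. of_real (d $ j) * a' j (z + t *\<^sub>R d) \<xi>) +
      (2 * pi * \<i>) * (a (z + t *\<^sub>R d) \<xi> * of_real (\<xi> \<bullet> d))" for t \<xi>
  define H where "H t \<xi> = (S t \<xi> * e2pi (\<xi> \<bullet> (t *\<^sub>R d))) * cl \<xi>" for t \<xi>
  define D where "D = incr_const TYPE('n) * (M * X) * (r * l)"
  have X: "X \<ge> 0" using \<theta> by (simp add: cutoff_def)
  have r0: "r \<ge> 0" using r(1) infnorm_pos_le order.trans by blast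
  have rl: "r \<le> 1 / l" using r(2) l by (simp add: field_simps)
  have di: "\<bar>d $ i\<bar> \<le> r" for i using component_le_infnorm_cart[of d i] r(1) by (simp add: d_def)
  note cl = cutoff_scaled[OF \<theta> l, folded cl_def]
  have "fd_bounded N l D (\<lambda>\<xi>. G 1 \<xi> - G 0 \<xi>)"
  proof (rule fd_bounded_increment)
    fix t :: real and \<xi> assume "t \<in> {0..1}"
    show "((\<lambda>t. G t \<xi>) has_vector_derivative H t \<xi>) (at t within {0..1})"
    \<comment> \<open>No differentiability of a in space is available at \<xi> = 0, but there the
      cutoff is 0.\<close>
    proof (cases "\<xi> = 0")
      case True
      then have "cl \<xi> = 0" using cl(2)[of \<xi>] l by (simp add: infnorm_0)
      then show ?thesis by (simp add: G_def H_def)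
    next
      case False
      have A: "((\<lambda>t. a (z + t *\<^sub>R d) \<xi>) has_vector_derivative
        (\<Sum>j\<in>UNIV. of_real (d $ j) * a' j (z + t *\<^sub>R d) \<xi>)) (at t within {0..1})"
        using has_vector_derivative_at_within[OF deriv[OF False, of z d t]] by (simp add: scaleR_conv_of_real)
      have E: "((\<lambda>t. e2pi (\<xi> \<bullet> (t *\<^sub>R d))) has_vector_derivative
        (2 * pi * \<i>) * of_real (\<xi> \<bullet> d) * e2pi (\<xi> \<bullet> (t *\<^sub>R d))) (at t within {0..1})"
        unfolding inner_scaleR_right
        using e2pi_has_vector_derivative[of 0 "\<xi> \<bullet> d" t "{0..1}"]
        by (simp add: scaleR_conv_of_real mult_ac)
      have "((\<lambda>t. a (z + t *\<^sub>R d) \<xi> * e2pi (\<xi> \<bullet> (t *\<^sub>R d)) * cl \<xi>) has_vector_derivative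
         (a (z + t *\<^sub>R d) \<xi> * ((2 * pi * \<i>) * of_real (\<xi> \<bullet> d) * e2pi (\<xi> \<bullet> (t *\<^sub>R d))) +
          (\<Sum>j\<in>UNIV. of_real (d $ j) * a' j (z + t *\<^sub>R d) \<xi>) * e2pi (\<xi> \<bullet> (t *\<^sub>R d))) * cl \<xi>) (at t within {0..1})"
        by (intro has_vector_derivative_mult_left has_vector_derivative_mult A E)
      then show ?thesis unfolding G_def H_def S_def by (simp add: algebra_simps)
    qed
  next
    fix t :: real assume t: "t \<in> {0..1}"
    show "fd_bounded N l D (H t)"
    proof (rule line_bdd_imp_fd_bounded[OF l])
      fix i
      have a1: "line_bdd N i l (\<Sum>j\<in>(UNIV::'n set). 2 ^ N * (r * (M * l))) (annulus l)
        (\<lambda>\<xi>. \<Sum>j\<in>UNIV. of_real (d $ j) * a' j (z + t *\<^sub>R d) \<xi>)"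
      proof (rule line_bdd_sum)
        fix j :: 'n
        have "line_bdd N i l r (annulus l) (\<lambda>\<xi>. of_real (d $ j))"
          by (rule line_bdd_mono[OF line_bdd_const]) (use l di in auto)
        then show "line_bdd N i l (2 ^ N * (r * (M * l))) (annulus l) (\<lambda>\<xi>. of_real (d $ j) * a' j (z + t *\<^sub>R d) \<xi>)"
          by (rule line_bdd_mult) (use bdd'[OF l] l r0 M_nonneg in \<open>auto simp: N_def\<close>)
      qed auto
      have inn: "line_bdd N i l (3 * CARD('n) * (r * l)) (annulus l) (\<lambda>\<xi>. of_real (\<xi> \<bullet> d))"
      proof (rule line_bdd_inner[OF l])
        fix \<xi> :: "real^'n" assume "\<xi> \<in> annulus l"
        then have "infnorm \<xi> \<le> 3 * l" by (simp add: annulus_def)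
        have "\<bar>\<xi> \<bullet> d\<bar> \<le> CARD('n) * infnorm \<xi> * infnorm d" by (rule abs_inner_le_infnorm)
        also have "\<dots> \<le> CARD('n) * (3 * l) * r"
          using \<open>infnorm \<xi> \<le> 3 * l\<close> r(1) l by (intro mult_mono) (auto simp: d_def infnorm_pos_le)
        finally show "\<bar>\<xi> \<bullet> d\<bar> \<le> 3 * CARD('n) * (r * l)" by (simp add: mult_ac)
      next
        have "1 \<le> real CARD('n)" by (simp add: Suc_le_eq)
        then have "1 \<le> 3 * real CARD('n)" by linarith
        from mult_right_mono[OF this r0] have "1 * r \<le> (3 * CARD('n)) * r" by simp
        then show "\<bar>d $ i\<bar> \<le> 3 * CARD('n) * (r * l) / l" using di[of i] l by simp
      qed
      have "line_bdd N i l (2 ^ N * (M * (3 * CARD('n) * (r * l)))) (annulus l)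
         (\<lambda>\<xi>. a (z + t *\<^sub>R d) \<xi> * of_real (\<xi> \<bullet> d))"
        by (rule line_bdd_mult[OF _ inn]) (use bdd[OF l] l r0 M_nonneg in \<open>auto simp: N_def\<close>)
      from line_bdd_mult[OF line_bdd_const[of l N i "2 * pi * \<i>" "annulus l", OF l] this]
      have "line_bdd N i l (2 ^ N * (2 * pi * (2 ^ N * (M * (3 * CARD('n) * (r * l)))))) (annulus l)
         (\<lambda>\<xi>. (2 * pi * \<i>) * (a (z + t *\<^sub>R d) \<xi> * of_real (\<xi> \<bullet> d)))"
        using l r0 M_nonneg by (simp add: norm_mult)
      from line_bdd_add[OF a1 this] have S: "line_bdd N i l
         (CARD('n) * (2 ^ N * (r * (M * l))) + 2 ^ N * (2 * pi * (2 ^ N * (M * (3 * CARD('n) * (r * l)))))) (annulus l) (S t)"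
        unfolding S_def by simp
      have clN: "line_bdd N i l X (annulus l) cl"
        unfolding N_def by (rule line_bdd_mono[OF cl(1)]) (use l in auto)
      \<comment> \<open>This is where r l \<le> 1 enters: the partial displacement is at most 1/l,
        so the character has bounds at scale l.\<close>
      have td: "\<bar>(t *\<^sub>R d) $ i\<bar> \<le> 1 / l"
      proof -
        have "\<bar>t\<bar> * \<bar>d $ i\<bar> \<le> 1 * r" using t di by (intro mult_mono) auto
        then show ?thesis using rl by (simp add: abs_mult)
      qed
      have "line_bdd N i l (2 ^ N * (2 ^ N *
         ((CARD('n) * (2 ^ N * (r * (M * l))) + 2 ^ N * (2 * pi * (2 ^ N * (M * (3 * CARD('n) * (r * l)))))) * (2 * pi) ^ N) * X))
         (annulus l) (H t)"
        unfolding H_def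
        by (intro line_bdd_mult[OF line_bdd_mult[OF S line_bdd_e2pi[OF l td]] clN])
           (use l r0 M_nonneg X in auto)
      moreover have "2 ^ N * (2 ^ N *
         ((CARD('n) * (2 ^ N * (r * (M * l))) + 2 ^ N * (2 * pi * (2 ^ N * (M * (3 * CARD('n) * (r * l)))))) * (2 * pi) ^ N) * X) = D"
        unfolding D_def incr_const_def Let_def N_def[symmetric] by (simp add: algebra_simps)
      ultimately have HD: "line_bdd N i l D (annulus l) (H t)" by simp
      have "D \<ge> 0" using l r0 M_nonneg X by (simp add: D_def incr_const_def Let_def)
      then show "line_bdd N i l D UNIV (H t)"
        by (intro line_bdd_from_annulus[OF HD l]) (use cl(2,3) in \<open>auto simp: H_def\<close>)
    qed
  qed
  moreover define g where "g \<xi> = a y \<xi> * cl \<xi> * e2pi (\<xi> \<bullet> d) - a z \<xi> * cl \<xi>" for \<xi>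
  moreover have "(\<lambda>\<xi>. G 1 \<xi> - G 0 \<xi>) = g" by (simp add: fun_eq_iff G_def g_def d_def algebra_simps)
  ultimately have fdb: "fd_bounded N l D g" by simp
  note int = localized_integrable[OF \<theta> l, folded cl_def]
  have [measurable]: "(\<lambda>\<xi>. a x \<xi> * cl \<xi>) \<in> borel_measurable borel" for x by (rule int(2))
  have gm: "g \<in> borel_measurable borel" unfolding g_def by measurable
  have bd: "norm (LINT \<xi>|lborel. g \<xi> * e2pi (\<xi> \<bullet> (z - w))) \<le>
      osc_const TYPE('n) * D * l ^ CARD('n) / (1 + l * infnorm (z - w)) ^ N"
    unfolding N_def osc_const_def
    by (rule oscillatory_integral_bound[OF gm _ l fdb[unfolded N_def], of 2 0])
       (use cl(3) in \<open>auto simp: g_def mem_cube infnorm_neg\<close>)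
  have "piece \<theta> l y (y - w) - piece \<theta> l z (z - w) =
      (LINT \<xi>|lborel. a y \<xi> * cl \<xi> * e2pi (\<xi> \<bullet> (y - w)) - a z \<xi> * cl \<xi> * e2pi (\<xi> \<bullet> (z - w)))"
    unfolding piece_def cl_def[symmetric]
    by (subst Bochner_Integration.integral_diff) (auto intro!: integrable_times_e2pi int(1))
  also have "\<dots> = (LINT \<xi>|lborel. g \<xi> * e2pi (\<xi> \<bullet> (z - w)))"
    by (intro Bochner_Integration.integral_cong)
       (auto simp: g_def d_def left_diff_distrib e2pi_add[symmetric] mult.assoc inner_diff_right)
  finally show ?thesis using bd by (simp add: D_def N_def)
qed

lemma piece_measurable:
  assumes "cutoff X \<theta>" "l > 0"
  shows "piece \<theta> l x \<in> borel_measurable borel"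
proof -
  have [measurable]: "(\<lambda>\<xi>. a x \<xi> * \<theta> ((1 / l) *\<^sub>R \<xi>)) \<in> borel_measurable borel"
    by (rule localized_integrable(2)[OF assms])
  have "(\<lambda>z. LINT \<xi>|lborel. (a x \<xi> * \<theta> ((1 / l) *\<^sub>R \<xi>)) * e2pi (\<xi> \<bullet> z)) \<in> borel_measurable borel"
    by measurable
  then show ?thesis by (simp add: piece_def[abs_def])
qed

end

section \<open>Bump weights and the maximal function\<close>

text \<open>The dilation l^n W(l x) of W(x) = (1 + |x|)^-(n+1), so the L^1 norm does not depend on
  l.\<close>

definition weight :: "real \<Rightarrow> real^'n::finite \<Rightarrow> real" where
  "weight l x = l ^ CARD('n) / (1 + l * infnorm x) ^ (CARD('n) + 1)"

lemma weight_nonneg: "l \<ge> 0 \<Longrightarrow> weight l x \<ge> 0"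
  by (simp add: weight_def infnorm_pos_le)

lemma weight_measurable [measurable]: "weight l \<in> borel_measurable (borel :: (real^'n::finite) measure)"
  unfolding weight_def[abs_def] by measurable

text \<open>Superposition of normalized cube indicators with geometric coefficients. At a given x
  one term of the series is already large enough.\<close>

lemma weight_dyadic_le:
  fixes x :: "real^'n::finite"
  assumes "l > 0"
  shows "ennreal (weight l x) \<le>
    (\<Sum>k. ennreal (2 ^ (CARD('n) + 1) * (1 / 2) ^ k * (1 / (2 ^ k / l) ^ CARD('n))) * indicator {x. infnorm x \<le> 2 ^ k / l} x)"
proof -
  let ?n = "CARD('n)"
  define h where "h k = ennreal (2 ^ (?n + 1) * (1 / 2) ^ k * (1 / (2 ^ k / l) ^ ?n)) * indicator {x. infnorm x \<le> 2 ^ k / l} x" for k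
  define t where "t = l * infnorm x"
  have t: "t \<ge> 0" using assms by (simp add: t_def infnorm_pos_le)
  have ex: "\<exists>k. t \<le> 2 ^ k" using real_arch_pow[of 2 t] by (auto intro: less_imp_le)
  \<comment> \<open>The least k with l |x| \<le> 2^k: x lies in the k-th cube, while minimality
    gives 2^k \<le> 2 (1 + l |x|).\<close>
  define k where "k = (LEAST k. t \<le> 2 ^ k)"
  have k: "t \<le> 2 ^ k" unfolding k_def using ex by (rule LeastI_ex)
  have "2 ^ k / 2 \<le> 1 + t"
  proof (cases k)
    case (Suc j)
    then have "\<not> t \<le> 2 ^ j" using not_less_Least[of j "\<lambda>k. t \<le> 2 ^ k"] by (simp add: k_def)
    then show ?thesis using t Suc by simp
  qed (use t in simp)
  then have "(2 ^ k / 2) ^ (?n + 1) \<le> (1 + t) ^ (?n + 1)" by (intro power_mono) auto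
  then have "1 / (1 + t) ^ (?n + 1) \<le> 1 / (2 ^ k / 2) ^ (?n + 1)"
    using t by (intro divide_left_mono mult_pos_pos zero_less_power) auto
  also have "\<dots> = 2 ^ (?n + 1) * (1 / 2) ^ k * (1 / (2 ^ k) ^ ?n)"
    by (simp add: power_divide field_simps)
  finally have "l ^ ?n * (1 / (1 + t) ^ (?n + 1)) \<le> l ^ ?n * (2 ^ (?n + 1) * (1 / 2) ^ k * (1 / (2 ^ k) ^ ?n))"
    using assms by (intro mult_left_mono) auto
  then have "weight l x \<le> 2 ^ (?n + 1) * (1 / 2) ^ k * (1 / (2 ^ k / l) ^ ?n)"
    using assms by (simp add: weight_def t_def power_divide field_simps)
  moreover have "infnorm x \<le> 2 ^ k / l" using k assms by (simp add: t_def field_simps)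
  ultimately have "ennreal (weight l x) \<le> h k" by (simp add: h_def ennreal_leI)
  also have "\<dots> \<le> (\<Sum>k. h k)"
    using sum_le_suminf[of h "{k}"] by (simp add: summableI)
  finally show ?thesis unfolding h_def .
qed

text \<open>The cubes in the superposition have radii 2^k / l \<ge> b, so each average is admissible
  in the truncated maximal function; the coefficients sum to 2^(n+2).\<close>

lemma weight_maximal:
  fixes f :: "real^'n::finite \<Rightarrow> complex"
  assumes [measurable]: "f \<in> borel_measurable borel" and l: "l > 0" and b: "b > 0" "l * b \<le> 1"
  shows "(\<integral>\<^sup>+w. ennreal (weight l (z - w)) * ennreal (norm (f w)) \<partial>lborel) \<le>
    ennreal (2 ^ (CARD('n) + 2)) * maximal_ge b f z"
proof -
  let ?n = "CARD('n)"
  define c where "c k = 2 ^ (?n + 1) * (1 / 2 :: real) ^ k" for k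
  have c0: "c k \<ge> 0" for k by (simp add: c_def)
  define r where "r k = 2 ^ k / l" for k
  have r: "b \<le> r k" "r k > 0" for k
  proof -
    have "b \<le> 1 / l" using b l by (simp add: field_simps)
    also have "\<dots> \<le> r k" using l by (simp add: r_def divide_right_mono)
    finally show "b \<le> r k" .
    then show "r k > 0" using b by linarith
  qed
  let ?h = "\<lambda>k w. ennreal (c k * (1 / r k ^ ?n)) * (ennreal (norm (f w)) * indicator (cube z (r k)) w)"
  have "ennreal (weight l (z - w)) * ennreal (norm (f w)) \<le> (\<Sum>k. ?h k w)" for w
  proof -
    have "ennreal (weight l (z - w)) * ennreal (norm (f w)) \<le>
        (\<Sum>k. ennreal (c k * (1 / r k ^ ?n)) * indicator {x. infnorm x \<le> r k} (z - w)) * ennreal (norm (f w))"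
      unfolding c_def r_def using weight_dyadic_le[OF l] by (rule mult_right_mono) simp
    also have "\<dots> = (\<Sum>k. ?h k w)"
      unfolding ennreal_suminf_multc[symmetric]
      by (intro arg_cong[where f=suminf] ext) (auto simp: mem_cube indicator_def)
    finally show ?thesis .
  qed
  then have "(\<integral>\<^sup>+w. ennreal (weight l (z - w)) * ennreal (norm (f w)) \<partial>lborel) \<le> (\<integral>\<^sup>+w. (\<Sum>k. ?h k w) \<partial>lborel)"
    by (intro nn_integral_mono)
  also have "\<dots> = (\<Sum>k. \<integral>\<^sup>+w. ?h k w \<partial>lborel)"
    by (rule nn_integral_suminf) measurable
  also have "\<dots> \<le> (\<Sum>k. ennreal (c k) * maximal_ge b f z)"
  proof (rule suminf_le)
    fix k
    have "(\<integral>\<^sup>+w. ?h k w \<partial>lborel) = ennreal (c k) * (ennreal (1 / r k ^ ?n) * (\<integral>\<^sup>+w\<in>cube z (r k). ennreal (norm (f w)) \<partial>lebesgue))"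
      using r(2)[of k] c0[of k]
      by (simp add: nn_integral_cmult nn_integral_completion ennreal_mult mult.assoc del: times_divide_eq_right)
    also have "\<dots> \<le> ennreal (c k) * maximal_ge b f z"
      unfolding maximal_ge_def by (intro mult_left_mono SUP_upper2[of "r k"]) (use r in auto)
    finally show "(\<integral>\<^sup>+w. ?h k w \<partial>lborel) \<le> ennreal (c k) * maximal_ge b f z" .
  qed (auto intro: summableI)
  also have "\<dots> = (\<Sum>k. ennreal (c k)) * maximal_ge b f z"
    by (rule ennreal_suminf_multc)
  also have "(\<Sum>k. ennreal (c k)) = ennreal (2 ^ (?n + 2))"
  proof -
    have "(\<lambda>k. 2 ^ (?n + 1) * (1 / 2 :: real) ^ k) sums (2 ^ (?n + 1) * (1 / (1 - 1 / 2)))"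
      by (intro sums_mult geometric_sums) auto
    then have "(\<Sum>k. ennreal (c k)) = ennreal (2 ^ (?n + 1) * (1 / (1 - 1 / 2)))"
      unfolding c_def by (intro suminf_ennreal_eq) auto
    then show ?thesis by simp
  qed
  finally show ?thesis .
qed

lemma maximal_ge_one: "b > 0 \<Longrightarrow> maximal_ge b (\<lambda>_. 1) (z::real^'n::finite) \<le> ennreal (2 ^ CARD('n))"
  unfolding maximal_ge_def
proof (rule SUP_least)
  fix r assume "b > 0" "r \<in> {b..}"
  then have r: "r > 0" by auto
  then have "ennreal (1 / r ^ CARD('n)) * emeasure lborel (cube z r) = ennreal (2 ^ CARD('n))"
    by (simp add: emeasure_cube ennreal_mult[symmetric] power_mult_distrib)
  then show "ennreal (1 / r ^ CARD('n)) * (\<integral>\<^sup>+y\<in>cube z r. ennreal (norm (1::complex)) \<partial>lebesgue) \<le> ennreal (2 ^ CARD('n))"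
    by (simp add: nn_integral_completion)
qed

text \<open>The maximal estimate for the constant function 1 bounds the L^1 norm of the weight,
  uniformly in l.\<close>

lemma weight_nn_integral:
  fixes z :: "real^'n::finite"
  assumes "l > 0"
  shows "(\<integral>\<^sup>+w. ennreal (weight l (z - w)) \<partial>lborel) \<le> ennreal (2 ^ (2 * CARD('n) + 2))"
proof -
  have "(\<integral>\<^sup>+w. ennreal (weight l (z - w)) * ennreal (norm (1::complex)) \<partial>lborel) \<le>
    ennreal (2 ^ (CARD('n) + 2)) * maximal_ge (1 / l) (\<lambda>_. 1) z"
    by (rule weight_maximal) (use assms in auto)
  also have "\<dots> \<le> ennreal (2 ^ (CARD('n) + 2)) * ennreal (2 ^ CARD('n))"
    by (intro mult_left_mono maximal_ge_one) (use assms in auto)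
  also have "\<dots> = ennreal (2 ^ (CARD('n) + 2) * 2 ^ CARD('n))"
    by (rule ennreal_mult[symmetric]) auto
  also have "2 ^ (CARD('n) + 2) * 2 ^ CARD('n) = (2::real) ^ (2 * CARD('n) + 2)"
    unfolding power_add[symmetric] by (rule arg_cong[where f="power 2"]) simp
  finally show ?thesis by (simp only: norm_one ennreal_1 mult_1_right)
qed

section \<open>Summation over dyadic scales\<close>

text \<open>Two geometric series, one on each side of \<nu>.\<close>

lemma sum_half_powers_le:
  fixes F :: "int set"
  assumes "finite F"
  shows "(\<Sum>j\<in>F. (1 / 2 :: real) ^ nat \<bar>j - \<nu>\<bar>) \<le> 4"
proof -
  have half: "(\<Sum>k\<in>G. (1 / 2 :: real) ^ k) \<le> 2" if "finite G" for G :: "nat set"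
    using sum_le_suminf[of "\<lambda>k. (1 / 2 :: real) ^ k" G] that suminf_geometric[of "1 / 2 :: real"]
    by (simp add: summable_geometric)
  have part: "(\<Sum>j\<in>G. (1 / 2 :: real) ^ nat \<bar>j - \<nu>\<bar>) \<le> 2"
    if "finite G" "inj_on (\<lambda>j. nat \<bar>j - \<nu>\<bar>) G" for G
    using half[of "(\<lambda>j. nat \<bar>j - \<nu>\<bar>) ` G"] that by (simp add: sum.reindex)
  have "(\<Sum>j\<in>F. (1 / 2 :: real) ^ nat \<bar>j - \<nu>\<bar>) =
      (\<Sum>j\<in>F \<inter> {\<nu>..}. (1 / 2) ^ nat \<bar>j - \<nu>\<bar>) + (\<Sum>j\<in>F - {\<nu>..}. (1 / 2) ^ nat \<bar>j - \<nu>\<bar>)"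
    using assms by (rule sum.Int_Diff)
  also have "\<dots> \<le> 2 + 2"
    by (intro add_mono part) (use assms in \<open>auto simp: inj_on_def\<close>)
  finally show ?thesis by simp
qed

lemma half_powers_summation:
  fixes K :: "int \<Rightarrow> complex"
  assumes "B \<ge> 0" and K: "\<And>j. j \<in> A \<Longrightarrow> norm (K j) \<le> B * (1 / 2) ^ nat \<bar>j - \<nu>\<bar>"
  shows "(\<lambda>j. norm (K j)) summable_on A" and "norm (infsum K A) \<le> 4 * B"
proof -
  have fin: "(\<Sum>j\<in>F. norm (K j)) \<le> 4 * B" if "finite F" "F \<subseteq> A" for F
  proof -
    have "(\<Sum>j\<in>F. norm (K j)) \<le> (\<Sum>j\<in>F. B * (1 / 2) ^ nat \<bar>j - \<nu>\<bar>)"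
      by (intro sum_mono K) (use that in auto)
    also have "\<dots> = B * (\<Sum>j\<in>F. (1 / 2) ^ nat \<bar>j - \<nu>\<bar>)" by (simp add: sum_distrib_left)
    also have "\<dots> \<le> B * 4" using assms(1) sum_half_powers_le[OF that(1)] by (intro mult_left_mono) auto
    finally show ?thesis by simp
  qed
  show s: "(\<lambda>j. norm (K j)) summable_on A"
    by (rule nonneg_bdd_above_summable_on) (auto intro!: bdd_aboveI[of _ "4 * B"] fin)
  have "norm (infsum K A) \<le> infsum (\<lambda>j. norm (K j)) A" by (rule norm_infsum_bound[OF s])
  also have "\<dots> \<le> 4 * B" by (rule infsum_le_finite_sums[OF s fin])
  finally show "norm (infsum K A) \<le> 4 * B" .
qed

text \<open>The profile of the bound for the piece at frequency 2^j. It decays by one power more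
  than \<open>weight\<close>; that power pays for the modulation factor 2^j |x|.\<close>

definition dyadic_weight :: "int \<Rightarrow> real^'n::finite \<Rightarrow> real" where
  "dyadic_weight j x = (2 powi j) ^ CARD('n) / (1 + 2 powi j * infnorm x) ^ (CARD('n) + 2)"

lemma two_powi_le: "j \<le> \<nu> \<Longrightarrow> (2::real) powi j / 2 powi \<nu> = (1 / 2) ^ nat \<bar>j - \<nu>\<bar>"
proof -
  assume "j \<le> \<nu>"
  then have "(2::real) powi j / 2 powi \<nu> = 2 powi (- int (nat \<bar>j - \<nu>\<bar>))"
    by (simp add: power_int_diff[symmetric])
  then show ?thesis unfolding power_int_minus power_int_of_nat by (simp add: power_one_over inverse_eq_divide)
qed

text \<open>Frequencies too low for x are small by their height 2^(jn), frequencies too high by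
  their decay. In both cases one factor 2^-|j - \<nu>| is kept and the rest is comparable to the
  weight at scale 2^\<nu>.\<close>

lemma dyadic_weight_off_scale:
  fixes x :: "real^'n::finite"
  assumes "j \<le> \<nu> \<and> 2 powi \<nu> * infnorm x \<le> 1 \<or> \<nu> \<le> j \<and> 2 powi \<nu> * infnorm x \<ge> 1"
  shows "dyadic_weight j x \<le> 2 ^ (CARD('n) + 1) * weight (2 powi \<nu>) x * (1 / 2) ^ nat \<bar>j - \<nu>\<bar>"
proof -
  let ?n = "CARD('n)"
  define p where "p = (2::real) powi j"
  define q where "q = (2::real) powi \<nu>"
  define t where "t = infnorm x"
  have pq: "p > 0" "q > 0" and t: "t \<ge> 0" by (simp_all add: p_def q_def t_def infnorm_pos_le)
  from assms consider (low) "j \<le> \<nu>" "q * t \<le> 1" | (high) "\<nu> \<le> j" "q * t \<ge> 1"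
    by (auto simp: q_def t_def)
  then show ?thesis
  proof cases
    case low
    have e: "p / q = (1 / 2) ^ nat \<bar>j - \<nu>\<bar>" using two_powi_le[OF low(1)] by (simp add: p_def q_def)
    have "p / q \<le> 1" unfolding e by (intro power_le_one) auto
    \<comment> \<open>The dimension is at least 1, so one factor p / q can be retained.\<close>
    have "(p / q) ^ ?n \<le> (p / q) ^ 1"
      using pq \<open>p / q \<le> 1\<close> by (intro power_decreasing) (auto simp: Suc_le_eq)
    then have 1: "p ^ ?n \<le> (p / q) * q ^ ?n" using pq by (simp add: power_divide field_simps)
    have "dyadic_weight j x \<le> p ^ ?n"
    proof -
      have "1 \<le> (1 + p * t) ^ (?n + 2)" using pq t by (intro one_le_power) simp
      then have "p ^ ?n / (1 + p * t) ^ (?n + 2) \<le> p ^ ?n / 1" using pq by (intro divide_left_mono) auto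
      then show ?thesis unfolding dyadic_weight_def p_def[symmetric] t_def[symmetric] by simp
    qed
    also note 1
    also have "(p / q) * q ^ ?n \<le> (p / q) * (2 ^ (?n + 1) * weight q x)"
    proof (intro mult_left_mono)
      have "(1 + q * t) ^ (?n + 1) \<le> 2 ^ (?n + 1)" using low t pq by (intro power_mono) auto
      then have "q ^ ?n * (1 + q * t) ^ (?n + 1) \<le> q ^ ?n * 2 ^ (?n + 1)" using pq by (intro mult_left_mono) auto
      moreover have "(1 + q * t) ^ (?n + 1) > 0" using pq t by (intro zero_less_power) (simp add: add_pos_nonneg)
      ultimately show "q ^ ?n \<le> 2 ^ (?n + 1) * weight q x"
        unfolding weight_def t_def[symmetric] by (simp add: pos_le_divide_eq mult.commute)
    qed (use pq in auto)
    finally show ?thesis unfolding e by (simp add: q_def mult_ac)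
  next
    case high
    have e: "q / p = (1 / 2) ^ nat \<bar>j - \<nu>\<bar>" using two_powi_le[OF high(1)] by (simp add: p_def q_def abs_minus_commute)
    have "q / p \<le> 1" unfolding e by (intro power_le_one) auto
    have t0: "t > 0" using high t pq by (cases "t = 0") auto
    have "dyadic_weight j x \<le> p ^ ?n / (p * t) ^ (?n + 2)"
      unfolding dyadic_weight_def p_def[symmetric] t_def[symmetric] using pq t0
      by (intro divide_left_mono power_mono mult_pos_pos zero_less_power) (auto simp: add_pos_nonneg)
    also have "\<dots> = (q / p) * (q / p) * (1 / (q * t)) * (q ^ ?n / (q * t) ^ (?n + 1))"
      using pq t0 by (simp add: power_mult_distrib field_simps)
    also have "\<dots> \<le> (q / p) * 1 * 1 * (q ^ ?n / (q * t) ^ (?n + 1))"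
      using pq t0 high \<open>q / p \<le> 1\<close> by (intro mult_right_mono mult_mono) auto
    also have "\<dots> \<le> (q / p) * 1 * 1 * (2 ^ (?n + 1) * weight q x)"
    proof (rule mult_left_mono)
      have "(1 + q * t) ^ (?n + 1) \<le> (2 * (q * t)) ^ (?n + 1)" using high t pq by (intro power_mono) auto
      then have "q ^ ?n / (2 * (q * t)) ^ (?n + 1) \<le> weight q x"
        unfolding weight_def t_def[symmetric] using pq t0
        by (intro divide_left_mono mult_pos_pos zero_less_power) (auto simp: add_pos_nonneg)
      note * = this
      show "q ^ ?n / (q * t) ^ (?n + 1) \<le> 2 ^ (?n + 1) * weight q x"
      proof -
        define A where "A = q ^ ?n / (q * t) ^ (?n + 1)"
        have "q ^ ?n / (2 * (q * t)) ^ (?n + 1) = A / 2 ^ (?n + 1)"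
          unfolding A_def power_mult_distrib[of 2] by (simp only: divide_divide_eq_left mult.commute)
        with * have "A \<le> 2 ^ (?n + 1) * weight q x" by (simp add: pos_divide_le_eq mult.commute)
        then show ?thesis by (simp only: A_def)
      qed
    qed (use pq in auto)
    finally show ?thesis unfolding e by (simp add: q_def mult_ac)
  qed
qed

section \<open>The Fourier transform on \<open>L\<^sup>2\<close>\<close>

definition ft :: "(real^'n::finite \<Rightarrow> complex) \<Rightarrow> real^'n \<Rightarrow> complex" where
  "ft h \<xi> = (LINT x|lborel. h x * e2pi (- (\<xi> \<bullet> x)))"

abbreviation sq_int :: "'a measure \<Rightarrow> ('a \<Rightarrow> complex) \<Rightarrow> ennreal" where
  "sq_int M h \<equiv> (\<integral>\<^sup>+x. ennreal ((norm (h x))\<^sup>2) \<partial>M)"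

lemma mult_le_sum_squares: "x \<ge> 0 \<Longrightarrow> y \<ge> 0 \<Longrightarrow> x * y \<le> x\<^sup>2 + y\<^sup>2" for x y :: real
  using sum_squares_bound[of x y] mult_nonneg_nonneg[of x y] by linarith

lemma fourier_integral_eq_ft:
  fixes h :: "real^'n::finite \<Rightarrow> complex"
  assumes [measurable]: "h \<in> borel_measurable borel"
  shows "fourier_integral h = ft h"
proof
  fix \<xi> :: "real^'n"
  have eq: "(\<lambda>x. h x * cis (- 2 * pi * (x \<bullet> \<xi>))) = (\<lambda>x. h x * e2pi (- (\<xi> \<bullet> x)))"
    by (simp add: e2pi_def inner_commute fun_eq_iff)
  have "(\<lambda>x. h x * e2pi (- (\<xi> \<bullet> x))) \<in> borel_measurable lborel" by measurable
  then show "fourier_integral h \<xi> = ft h \<xi>"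
    unfolding fourier_integral_def ft_def eq by (rule integral_completion)
qed

lemma ft_measurable [measurable]:
  assumes [measurable]: "h \<in> borel_measurable borel"
  shows "ft h \<in> borel_measurable borel"
  unfolding ft_def[abs_def] by measurable

lemma norm_ft_le:
  assumes "integrable lborel h"
  shows "norm (ft h \<xi>) \<le> (LINT x|lborel. norm (h x))"
  unfolding ft_def by (rule order.trans[OF integral_norm_bound]) (simp add: norm_mult)

lemma ft_diff:
  assumes "integrable lborel f" "integrable lborel g"
  shows "ft (\<lambda>x. f x - g x) \<xi> = ft f \<xi> - ft g \<xi>"
proof -
  have *: "integrable lborel (\<lambda>x. h x * e2pi (- (\<xi> \<bullet> x)))" if "integrable lborel h" for h
    using integrable_times_e2pi[OF that, of "- \<xi>"] by (simp add: inner_commute)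
  show ?thesis unfolding ft_def left_diff_distrib
    by (rule Bochner_Integration.integral_diff[OF *[OF assms(1)] *[OF assms(2)]])
qed

text \<open>The phase factor is unimodular, so joint integrability is that of the product of m and
  h.\<close>

lemma Fubini_phase:
  fixes m h :: "real^'n::finite \<Rightarrow> complex"
  assumes m: "integrable lborel m" and h: "integrable lborel h"
    and [measurable]: "(\<lambda>(\<xi>, w). \<phi> \<xi> w) \<in> borel_measurable (borel \<Otimes>\<^sub>M borel)"
  shows "(LINT \<xi>|lborel. m \<xi> * (LINT w|lborel. h w * e2pi (\<phi> \<xi> w))) =
    (LINT w|lborel. h w * (LINT \<xi>|lborel. m \<xi> * e2pi (\<phi> \<xi> w)))"
proof -
  have [measurable]: "m \<in> borel_measurable borel" "h \<in> borel_measurable borel" using m h by auto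
  have "integrable (lborel \<Otimes>\<^sub>M lborel) (\<lambda>(\<xi>, w). m \<xi> * h w * e2pi (\<phi> \<xi> w))"
  proof (rule lborel_pair.Fubini_integrable)
    show "(\<lambda>(\<xi>, w). m \<xi> * h w * e2pi (\<phi> \<xi> w)) \<in> borel_measurable (lborel \<Otimes>\<^sub>M lborel)" by measurable
    show "integrable lborel (\<lambda>\<xi>. LINT w|lborel. norm (case (\<xi>, w) of (\<xi>, w) \<Rightarrow> m \<xi> * h w * e2pi (\<phi> \<xi> w)))"
      using m by (simp add: norm_mult)
    show "AE \<xi> in lborel. integrable lborel (\<lambda>w. case (\<xi>, w) of (\<xi>, w) \<Rightarrow> m \<xi> * h w * e2pi (\<phi> \<xi> w))"
    proof (rule AE_I2)
      fix \<xi>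
      have "integrable lborel (\<lambda>w. m \<xi> * h w)" using h by simp
      then show "integrable lborel (\<lambda>w. case (\<xi>, w) of (\<xi>, w) \<Rightarrow> m \<xi> * h w * e2pi (\<phi> \<xi> w))"
        by (rule Bochner_Integration.integrable_bound) (auto simp: norm_mult)
    qed
  qed
  from lborel_pair.Fubini_integral[OF this]
  have "(LINT w|lborel. LINT \<xi>|lborel. m \<xi> * h w * e2pi (\<phi> \<xi> w)) = (LINT \<xi>|lborel. LINT w|lborel. m \<xi> * h w * e2pi (\<phi> \<xi> w))" .
  moreover have "(LINT w|lborel. m \<xi> * h w * e2pi (\<phi> \<xi> w)) = m \<xi> * (LINT w|lborel. h w * e2pi (\<phi> \<xi> w))" for \<xi>
    unfolding mult.assoc by (rule integral_mult_right_zero)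
  moreover have "(LINT \<xi>|lborel. m \<xi> * h w * e2pi (\<phi> \<xi> w)) = h w * (LINT \<xi>|lborel. m \<xi> * e2pi (\<phi> \<xi> w))" for w
    unfolding mult.commute[of _ "h w"] mult.assoc by (rule integral_mult_right_zero)
  ultimately show ?thesis by simp
qed

lemma multiplier_formula_L1:
  fixes m h :: "real^'n::finite \<Rightarrow> complex"
  assumes "integrable lborel m" "integrable lborel h"
  shows "(LINT \<xi>|lborel. m \<xi> * e2pi (y \<bullet> \<xi>) * ft h \<xi>) =
    (LINT w|lborel. (LINT \<xi>|lborel. m \<xi> * e2pi (\<xi> \<bullet> (y - w))) * h w)"
proof -
  have "(LINT \<xi>|lborel. (m \<xi> * e2pi (\<xi> \<bullet> y)) * (LINT w|lborel. h w * e2pi (- (\<xi> \<bullet> w)))) =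
    (LINT w|lborel. h w * (LINT \<xi>|lborel. (m \<xi> * e2pi (\<xi> \<bullet> y)) * e2pi (- (\<xi> \<bullet> w))))"
    by (rule Fubini_phase[OF integrable_times_e2pi[OF assms(1)] assms(2)]) measurable
  then show ?thesis
    by (simp add: ft_def inner_commute[of y] mult.assoc mult.commute[of "h _"] inner_diff_right e2pi_add[symmetric])
qed

text \<open>Schur test for a symmetric kernel of bounded L^1 norm: |h(y)| |h(w)| \<le> |h(y)|^2 +
  |h(w)|^2, and in each term the free variable is integrated out.\<close>

lemma weight_convolution_L2:
  fixes h :: "real^'n::finite \<Rightarrow> complex"
  assumes [measurable]: "h \<in> borel_measurable borel" and "l > 0"
  shows "(\<integral>\<^sup>+y. ennreal (norm (h y)) * (\<integral>\<^sup>+w. ennreal (weight l (y - w)) * ennreal (norm (h w)) \<partial>lborel) \<partial>lborel) \<le>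
    ennreal (2 ^ (2 * CARD('n) + 3)) * sq_int lborel h"
proof -
  let ?C = "2 ^ (2 * CARD('n) + 2) :: real"
  have sym: "weight l (y - w) = weight l (w - y)" for y w :: "real^'n"
    using infnorm_neg[of "y - w"] by (simp add: weight_def)
  have pw: "ennreal (norm (h y)) * (ennreal (weight l (y - w)) * ennreal (norm (h w))) \<le>
      ennreal (weight l (y - w)) * ennreal ((norm (h y))\<^sup>2) + ennreal (weight l (y - w)) * ennreal ((norm (h w))\<^sup>2)" for y w
  proof -
    have "norm (h y) * norm (h w) \<le> (norm (h y))\<^sup>2 + (norm (h w))\<^sup>2"
      by (rule mult_le_sum_squares) auto
    then have "weight l (y - w) * (norm (h y) * norm (h w)) \<le> weight l (y - w) * ((norm (h y))\<^sup>2 + (norm (h w))\<^sup>2)"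
      using \<open>l > 0\<close> by (intro mult_left_mono) (auto simp: weight_nonneg)
    then have "ennreal (norm (h y) * (weight l (y - w) * norm (h w))) \<le>
        ennreal (weight l (y - w) * (norm (h y))\<^sup>2 + weight l (y - w) * (norm (h w))\<^sup>2)"
      by (intro ennreal_leI) (simp add: algebra_simps)
    then show ?thesis using \<open>l > 0\<close> by (simp add: ennreal_mult weight_nonneg ennreal_plus)
  qed
  have half: "(\<integral>\<^sup>+y. \<integral>\<^sup>+w. ennreal (weight l (y - w)) * ennreal ((norm (h y))\<^sup>2) \<partial>lborel \<partial>lborel) \<le> ennreal ?C * sq_int lborel h"
  proof -
    have "(\<integral>\<^sup>+w. ennreal (weight l (y - w)) * ennreal ((norm (h y))\<^sup>2) \<partial>lborel) \<le> ennreal ?C * ennreal ((norm (h y))\<^sup>2)" for y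
      using mult_right_mono[OF weight_nn_integral[OF \<open>l > 0\<close>, of y], of "ennreal ((norm (h y))\<^sup>2)"]
      by (simp add: nn_integral_multc)
    then have "(\<integral>\<^sup>+y. \<integral>\<^sup>+w. ennreal (weight l (y - w)) * ennreal ((norm (h y))\<^sup>2) \<partial>lborel \<partial>lborel) \<le>
        (\<integral>\<^sup>+y. ennreal ?C * ennreal ((norm (h y))\<^sup>2) \<partial>lborel)"
      by (intro nn_integral_mono)
    then show ?thesis by (simp add: nn_integral_cmult)
  qed
  have "(\<integral>\<^sup>+y. ennreal (norm (h y)) * (\<integral>\<^sup>+w. ennreal (weight l (y - w)) * ennreal (norm (h w)) \<partial>lborel) \<partial>lborel) =
      (\<integral>\<^sup>+y. \<integral>\<^sup>+w. ennreal (norm (h y)) * (ennreal (weight l (y - w)) * ennreal (norm (h w))) \<partial>lborel \<partial>lborel)"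
    by (intro nn_integral_cong nn_integral_cmult[symmetric]) measurable
  also have "\<dots> \<le> (\<integral>\<^sup>+y. \<integral>\<^sup>+w. ennreal (weight l (y - w)) * ennreal ((norm (h y))\<^sup>2) +
      ennreal (weight l (y - w)) * ennreal ((norm (h w))\<^sup>2) \<partial>lborel \<partial>lborel)"
    by (intro nn_integral_mono pw)
  also have "\<dots> = (\<integral>\<^sup>+y. \<integral>\<^sup>+w. ennreal (weight l (y - w)) * ennreal ((norm (h y))\<^sup>2) \<partial>lborel \<partial>lborel) +
      (\<integral>\<^sup>+y. \<integral>\<^sup>+w. ennreal (weight l (y - w)) * ennreal ((norm (h w))\<^sup>2) \<partial>lborel \<partial>lborel)"
    by (subst nn_integral_add[symmetric], measurable) (intro nn_integral_cong nn_integral_add, measurable)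
  also have "(\<integral>\<^sup>+y. \<integral>\<^sup>+w. ennreal (weight l (y - w)) * ennreal ((norm (h w))\<^sup>2) \<partial>lborel \<partial>lborel) =
      (\<integral>\<^sup>+w. \<integral>\<^sup>+y. ennreal (weight l (y - w)) * ennreal ((norm (h w))\<^sup>2) \<partial>lborel \<partial>lborel)"
    by (rule lborel_pair.Fubini') measurable
  also have "\<dots> = (\<integral>\<^sup>+y. \<integral>\<^sup>+w. ennreal (weight l (y - w)) * ennreal ((norm (h y))\<^sup>2) \<partial>lborel \<partial>lborel)"
    by (simp add: sym)
  also have "(\<integral>\<^sup>+y. \<integral>\<^sup>+w. ennreal (weight l (y - w)) * ennreal ((norm (h y))\<^sup>2) \<partial>lborel \<partial>lborel) +
      (\<integral>\<^sup>+y. \<integral>\<^sup>+w. ennreal (weight l (y - w)) * ennreal ((norm (h y))\<^sup>2) \<partial>lborel \<partial>lborel) \<le>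
      ennreal ?C * sq_int lborel h + ennreal ?C * sq_int lborel h"
    by (intro add_mono half)
  also have "\<dots> = (ennreal ?C + ennreal ?C) * sq_int lborel h" by (simp add: distrib_right)
  also have "ennreal ?C + ennreal ?C = ennreal (?C + ?C)" by (rule ennreal_plus[symmetric]) auto
  also have "?C + ?C = 2 ^ (2 * CARD('n) + 3)" by (simp add: power_add)
  finally show ?thesis .
qed

text \<open>Holds unconditionally, because a non-integrable function has integral 0.\<close>

lemma norm_integral_le_nn_integral:
  fixes f :: "'a \<Rightarrow> 'b::{banach, second_countable_topology}"
  shows "ennreal (norm (integral\<^sup>L M f)) \<le> (\<integral>\<^sup>+x. ennreal (norm (f x)) \<partial>M)"
proof (cases "integrable M f")
  case True
  then show ?thesis by (rule integral_norm_bound_ennreal)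
qed (simp add: not_integrable_integral_eq)

lemma integrable_L2_mult:
  fixes f g :: "'a \<Rightarrow> complex"
  assumes [measurable]: "f \<in> borel_measurable M" "g \<in> borel_measurable M"
    and "sq_int M f < \<infinity>" "sq_int M g < \<infinity>"
  shows "integrable M (\<lambda>x. f x * g x)"
proof (rule integrableI_bounded)
  have "(\<integral>\<^sup>+x. ennreal (norm (f x * g x)) \<partial>M) \<le> (\<integral>\<^sup>+x. ennreal ((norm (f x))\<^sup>2) + ennreal ((norm (g x))\<^sup>2) \<partial>M)"
  proof (rule nn_integral_mono)
    fix x
    have "norm (f x * g x) \<le> (norm (f x))\<^sup>2 + (norm (g x))\<^sup>2"
      unfolding norm_mult by (rule mult_le_sum_squares) auto
    then show "ennreal (norm (f x * g x)) \<le> ennreal ((norm (f x))\<^sup>2) + ennreal ((norm (g x))\<^sup>2)"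
      by (simp flip: ennreal_plus add: ennreal_leI)
  qed
  also have "\<dots> = sq_int M f + sq_int M g" by (rule nn_integral_add) measurable
  also have "\<dots> < \<infinity>" using assms by simp
  finally show "(\<integral>\<^sup>+x. ennreal (norm (f x * g x)) \<partial>M) < \<infinity>" .
qed measurable

text \<open>Riesz-Fischer: a rapidly convergent subsequence converges almost everywhere, and Fatou
  upgrades this to convergence of the whole sequence in square mean.\<close>

lemma L2_complete:
  fixes F :: "nat \<Rightarrow> 'a \<Rightarrow> complex"
  assumes [measurable]: "\<And>n. F n \<in> borel_measurable M"
    and cauchy: "\<And>e::ennreal. e > 0 \<Longrightarrow> \<exists>N. \<forall>m\<ge>N. \<forall>n\<ge>N. sq_int M (\<lambda>x. F m x - F n x) \<le> e"
  shows "\<exists>g\<in>borel_measurable M. (\<lambda>n. sq_int M (\<lambda>x. F n x - g x)) \<longlonglongrightarrow> 0"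
proof -
  \<comment> \<open>Squared distances 4^-k leave room for a weight 2^k in the sum of the squared
    increments; finiteness of that sum at a point forces the increments there to decay like
    2^(-k/2).\<close>
  have "\<exists>N. \<forall>k. \<forall>m\<ge>N k. \<forall>n\<ge>N k. sq_int M (\<lambda>x. F m x - F n x) \<le> ennreal ((1 / 4) ^ k)"
    by (intro choice allI cauchy) simp
  then obtain N where N: "\<And>k m n. m \<ge> N k \<Longrightarrow> n \<ge> N k \<Longrightarrow> sq_int M (\<lambda>x. F m x - F n x) \<le> ennreal ((1 / 4) ^ k)"
    by blast
  \<comment> \<open>Monotone, beyond every N k, and at least k thanks to the summand 1, so
    \<open>r\<close> tends to infinity.\<close>
  define r where "r k = (\<Sum>i\<le>k. N i + 1)" for k
  have rN: "r k \<ge> N k" for k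
    using member_le_sum[of k "{..k}" "\<lambda>i. N i + 1"] by (simp add: r_def)
  have rS: "r (Suc k) \<ge> r k" for k by (simp add: r_def)
  have rk: "r k \<ge> k" for k by (induction k) (auto simp: r_def)
  define d where "d k x = F (r (Suc k)) x - F (r k) x" for k x
  have [measurable]: "d k \<in> borel_measurable M" for k unfolding d_def[abs_def] by measurable
  have d: "sq_int M (d k) \<le> ennreal ((1 / 4) ^ k)" for k
    unfolding d_def by (rule N) (use rN[of k] rS[of k] in auto)
  have "(\<integral>\<^sup>+x. (\<Sum>k. ennreal (2 ^ k) * ennreal ((norm (d k x))\<^sup>2)) \<partial>M) = (\<Sum>k. ennreal (2 ^ k) * sq_int M (d k))"
    by (subst nn_integral_suminf) (auto simp: nn_integral_cmult)
  also have "\<dots> \<le> (\<Sum>k. ennreal ((1 / 2) ^ k))"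
  proof (rule suminf_le)
    fix k
    have "ennreal (2 ^ k) * sq_int M (d k) \<le> ennreal (2 ^ k) * ennreal ((1 / 4) ^ k)"
      by (rule mult_left_mono[OF d]) simp
    also have "\<dots> = ennreal ((1 / 2) ^ k)"
      by (subst ennreal_mult[symmetric]) (auto simp flip: power_mult_distrib)
    finally show "ennreal (2 ^ k) * sq_int M (d k) \<le> ennreal ((1 / 2) ^ k)" .
  qed (auto intro: summableI)
  also have "\<dots> = ennreal (1 / (1 - 1 / 2))"
    by (rule suminf_ennreal_eq) (use geometric_sums[of "1 / 2 :: real"] in auto)
  finally have fin: "(\<integral>\<^sup>+x. (\<Sum>k. ennreal (2 ^ k) * ennreal ((norm (d k x))\<^sup>2)) \<partial>M) \<noteq> \<infinity>"
    by (auto simp: top_unique)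
  have "AE x in M. (\<Sum>k. ennreal (2 ^ k) * ennreal ((norm (d k x))\<^sup>2)) \<noteq> \<infinity>"
    by (rule nn_integral_PInf_AE[OF _ fin]) measurable
  then have conv: "AE x in M. convergent (\<lambda>k. F (r k) x)"
  proof eventually_elim
    case (elim x)
    let ?s = "\<lambda>k. ennreal (2 ^ k) * ennreal ((norm (d k x))\<^sup>2)"
    obtain S where S: "suminf ?s = ennreal S" "S \<ge> 0"
      using elim by (cases "suminf ?s") auto
    have bound: "norm (d k x) \<le> sqrt S * (sqrt (1 / 2)) ^ k" for k
    proof -
      have "?s k \<le> suminf ?s" using sum_le_suminf[of ?s "{k}"] by (simp add: summableI)
      then have "2 ^ k * (norm (d k x))\<^sup>2 \<le> S" using S by (simp flip: ennreal_mult)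
      then have "(norm (d k x))\<^sup>2 \<le> S * (1 / 2) ^ k" by (simp add: power_one_over field_simps)
      then have "sqrt ((norm (d k x))\<^sup>2) \<le> sqrt (S * (1 / 2) ^ k)" by (rule real_sqrt_le_mono)
      then show ?thesis by (simp add: real_sqrt_mult real_sqrt_power)
    qed
    have "summable (\<lambda>k. d k x)"
    proof (rule summable_comparison_test'[OF _ bound])
      show "summable (\<lambda>k. sqrt S * sqrt (1 / 2) ^ k)"
        by (intro summable_mult summable_geometric) simp
    qed
    then have "convergent (\<lambda>n. F (r 0) x + (\<Sum>k<n. d k x))"
      by (intro convergent_add convergent_const) (simp add: summable_iff_convergent)
    moreover have "F (r 0) x + (\<Sum>k<n. d k x) = F (r n) x" for n
      unfolding d_def by (subst sum_lessThan_telescope[of "\<lambda>k. F (r k) x"]) simp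
    ultimately show ?case by simp
  qed
  define g where "g x = lim (\<lambda>k. F (r k) x)" for x
  have [measurable]: "g \<in> borel_measurable M" unfolding g_def[abs_def] by measurable
  \<comment> \<open>Fatou along the subsequence: a Cauchy bound between F n and the later F (r k)
    survives in the limit.\<close>
  have main: "sq_int M (\<lambda>x. F n x - g x) \<le> e"
    if N0: "\<And>m n. m \<ge> N0 \<Longrightarrow> n \<ge> N0 \<Longrightarrow> sq_int M (\<lambda>x. F m x - F n x) \<le> e" and "n \<ge> N0" for n N0 e
  proof -
    have "sq_int M (\<lambda>x. F n x - g x) = (\<integral>\<^sup>+x. liminf (\<lambda>k. ennreal ((norm (F n x - F (r k) x))\<^sup>2)) \<partial>M)"
    proof (rule nn_integral_cong_AE, use conv in eventually_elim)
      case (elim x)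
      then have "(\<lambda>k. F (r k) x) \<longlonglongrightarrow> g x" by (simp add: g_def convergent_LIMSEQ_iff)
      then have "(\<lambda>k. ennreal ((norm (F n x - F (r k) x))\<^sup>2)) \<longlonglongrightarrow> ennreal ((norm (F n x - g x))\<^sup>2)"
        by (intro tendsto_intros)
      then show ?case by (rule lim_imp_Liminf[OF sequentially_bot, symmetric])
    qed
    also have "\<dots> \<le> liminf (\<lambda>k. sq_int M (\<lambda>x. F n x - F (r k) x))"
      by (rule nn_integral_liminf) measurable
    also have "\<dots> \<le> limsup (\<lambda>k. sq_int M (\<lambda>x. F n x - F (r k) x))"
      by (rule Liminf_le_Limsup) simp
    also have "\<dots> \<le> e"
    proof (rule Limsup_bounded)
      show "\<forall>\<^sub>F k in sequentially. sq_int M (\<lambda>x. F n x - F (r k) x) \<le> e"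
        using eventually_ge_at_top[of N0]
      proof eventually_elim
        case (elim k)
        then show ?case using N0[OF \<open>n \<ge> N0\<close>, of "r k"] rk[of k] by simp
      qed
    qed
    finally show ?thesis .
  qed
  have "(\<lambda>n. sq_int M (\<lambda>x. F n x - g x)) \<longlonglongrightarrow> 0"
  proof (rule order_tendstoI)
    fix a :: ennreal assume "0 < a"
    then obtain e where e: "0 < e" "e < a" using dense by blast
    from cauchy[OF e(1)] obtain N0 where "\<And>m n. m \<ge> N0 \<Longrightarrow> n \<ge> N0 \<Longrightarrow> sq_int M (\<lambda>x. F m x - F n x) \<le> e" by blast
    from main[OF this] e(2) show "\<forall>\<^sub>F n in sequentially. sq_int M (\<lambda>x. F n x - g x) < a"
      unfolding eventually_sequentially by (meson le_less_trans)
  qed simp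
  then show ?thesis by (intro bexI[of _ g]) auto
qed

lemma sq_int_triangle:
  fixes f g :: "'a \<Rightarrow> complex"
  assumes [measurable]: "f \<in> borel_measurable M" "g \<in> borel_measurable M"
  shows "sq_int M g \<le> 2 * sq_int M f + 2 * sq_int M (\<lambda>x. f x - g x)"
proof -
  have "sq_int M g \<le> (\<integral>\<^sup>+x. 2 * ennreal ((norm (f x))\<^sup>2) + 2 * ennreal ((norm (f x - g x))\<^sup>2) \<partial>M)"
  proof (rule nn_integral_mono)
    fix x
    have "norm (g x) \<le> norm (f x) + norm (f x - g x)"
      using norm_triangle_sub[of "g x" "f x"] by (simp add: norm_minus_commute)
    then have "(norm (g x))\<^sup>2 \<le> (norm (f x) + norm (f x - g x))\<^sup>2" by (intro power_mono) auto
    also have "\<dots> \<le> 2 * (norm (f x))\<^sup>2 + 2 * (norm (f x - g x))\<^sup>2"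
      using zero_le_power2[of "norm (f x) - norm (f x - g x)"] by (simp add: power2_sum power2_diff)
    finally have "ennreal ((norm (g x))\<^sup>2) \<le> ennreal (2 * (norm (f x))\<^sup>2 + 2 * (norm (f x - g x))\<^sup>2)"
      by (rule ennreal_leI)
    then show "ennreal ((norm (g x))\<^sup>2) \<le> 2 * ennreal ((norm (f x))\<^sup>2) + 2 * ennreal ((norm (f x - g x))\<^sup>2)"
      by (simp add: ennreal_mult ennreal_plus)
  qed
  also have "\<dots> = 2 * sq_int M f + 2 * sq_int M (\<lambda>x. f x - g x)"
    by (subst nn_integral_add) (auto simp: nn_integral_cmult)
  finally show ?thesis .
qed

lemma tail_tendsto_0:
  fixes f :: "real^'n::finite \<Rightarrow> complex"
  assumes [measurable]: "f \<in> borel_measurable borel" and fin: "sq_int lborel f < \<infinity>"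
  shows "(\<lambda>N::nat. sq_int lborel (\<lambda>x. indicator (- cube 0 (real N)) x *\<^sub>R f x)) \<longlonglongrightarrow> 0"
proof -
  have "(\<lambda>N::nat. sq_int lborel (\<lambda>x. indicator (- cube 0 (real N)) x *\<^sub>R f x)) \<longlonglongrightarrow> (\<integral>\<^sup>+(x::real^'n). 0 \<partial>lborel)"
  proof (rule nn_integral_dominated_convergence[where w="\<lambda>x. ennreal ((norm (f x))\<^sup>2)"])
    show "AE x in lborel. (\<lambda>N::nat. ennreal ((norm (indicator (- cube 0 (real N)) x *\<^sub>R f x))\<^sup>2)) \<longlonglongrightarrow> 0"
    proof (rule AE_I2)
      fix x :: "real^'n"
      obtain N0 :: nat where N0: "infnorm x \<le> real N0" using real_arch_simple by blast
      have "\<forall>\<^sub>F N in sequentially. ennreal ((norm (indicator (- cube 0 (real N)) x *\<^sub>R f x))\<^sup>2) = 0"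
        using eventually_ge_at_top[of N0]
      proof eventually_elim
        case (elim N)
        then have "x \<in> cube 0 (real N)" using N0 by (simp add: mem_cube infnorm_neg)
        then show ?case by simp
      qed
      then show "(\<lambda>N::nat. ennreal ((norm (indicator (- cube 0 (real N)) x *\<^sub>R f x))\<^sup>2)) \<longlonglongrightarrow> 0"
        by (rule tendsto_eventually)
    qed
  qed (use fin in \<open>auto simp: indicator_def\<close>)
  then show ?thesis by simp
qed

lemma truncation_integrable:
  fixes f :: "real^'n::finite \<Rightarrow> complex"
  assumes [measurable]: "f \<in> borel_measurable borel" and fin: "sq_int lborel f < \<infinity>"
  shows "integrable lborel (\<lambda>x. indicator (cube 0 (real N)) x *\<^sub>R f x)"
proof -
  have "integrable lborel (\<lambda>x. of_real (indicator (cube 0 (real N)) x) * f x)"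
  proof (rule integrable_L2_mult)
    have "sq_int lborel (\<lambda>x::real^'n. of_real (indicator (cube 0 (real N)) x)) = (\<integral>\<^sup>+(x::real^'n). indicator (cube 0 (real N)) x \<partial>lborel)"
      by (intro nn_integral_cong) (auto simp: indicator_def)
    then show "sq_int lborel (\<lambda>x::real^'n. of_real (indicator (cube 0 (real N)) x)) < \<infinity>"
      by (simp add: emeasure_cube)
  qed (use fin in auto)
  then show ?thesis by (simp add: scaleR_conv_of_real)
qed

section \<open>The L^2 bound and the Fourier transform of square integrable functions\<close>

context bump
begin

definition bessel_const :: real where
  "bessel_const = osc_const TYPE('n) * P * 2 ^ (2 * CARD('n) + 3)"

lemma osc_const_nonneg: "osc_const TYPE('n) \<ge> 0"
  by (simp add: osc_const_def)

text \<open>Instead of the Gaussian, the bump itself serves as a summability kernel; only boundedness of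
  the Fourier transform on \<open>L\<^sup>2\<close> is needed, not its isometry.\<close>

lemma bessel_cutoff:
  fixes h :: "real^'n \<Rightarrow> complex"
  assumes [measurable]: "h \<in> borel_measurable borel" and h: "integrable lborel h" and "l > 0"
  shows "(\<integral>\<^sup>+\<xi>. ennreal (\<Phi> ((1 / l) *\<^sub>R \<xi>) * (norm (ft h \<xi>))\<^sup>2) \<partial>lborel) \<le> ennreal bessel_const * sq_int lborel h"
proof -
  define p where "p \<xi> = complex_of_real (\<Phi> ((1 / l) *\<^sub>R \<xi>))" for \<xi>
  have \<Phi>m [measurable]: "\<Phi> \<in> borel_measurable borel" by (rule borel_measurable_continuous_onI[OF \<Phi>_cont])
  have pm [measurable]: "p \<in> borel_measurable borel" unfolding p_def[abs_def] by measurable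
  \<comment> \<open>The actual support radius is l/10; the radius 2 l is chosen to match A = 2 in
    \<open>osc_const\<close>.\<close>
  have psupp: "p \<xi> = 0" if "\<xi> \<notin> cube 0 (2 * l)" for \<xi>
    using \<Phi>_0[of "(1 / l) *\<^sub>R \<xi>"] that \<open>l > 0\<close> by (auto simp: p_def mem_cube infnorm_neg infnorm_mul field_simps)
  have p1: "norm (p \<xi>) \<le> 1" for \<xi> using \<Phi>_nonneg \<Phi>_le_1 by (simp add: p_def)
  have pint: "integrable lborel p"
    by (rule integrable_bounded_cube(1)[OF pm _ p1 psupp]) (use \<open>l > 0\<close> in auto)
  have "line_bdd (CARD('n) + 2) i (1 / (1 / l)) P UNIV (\<lambda>\<xi>. of_real (\<Phi> ((1 / l) *\<^sub>R \<xi> + 0)))" for i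
    by (rule line_bdd_affine[OF _ _ \<Phi>_bdd]) (use \<open>l > 0\<close> in auto)
  then have "line_bdd (CARD('n) + 2) i l P UNIV p" for i by (simp add: p_def[abs_def])
  then have fdb: "fd_bounded (CARD('n) + 2) l P p" using \<open>l > 0\<close> by (intro line_bdd_imp_fd_bounded)
  define k where "k z = (LINT \<xi>|lborel. p \<xi> * e2pi (\<xi> \<bullet> z))" for z
  have k: "norm (k z) \<le> osc_const TYPE('n) * P * weight l z" for z
  proof -
    have "norm (k z) \<le> osc_const TYPE('n) * P * l ^ CARD('n) / (1 + l * infnorm z) ^ (CARD('n) + 2)"
      unfolding k_def osc_const_def
      by (rule oscillatory_integral_bound[OF pm _ \<open>l > 0\<close> fdb psupp]) auto
    also have "\<dots> \<le> osc_const TYPE('n) * P * l ^ CARD('n) / (1 + l * infnorm z) ^ (CARD('n) + 1)"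
    proof (rule divide_left_mono)
      show "(1 + l * infnorm z) ^ (CARD('n) + 1) \<le> (1 + l * infnorm z) ^ (CARD('n) + 2)"
        using \<open>l > 0\<close> infnorm_pos_le[of z] by (intro power_increasing) auto
      show "0 \<le> osc_const TYPE('n) * P * l ^ CARD('n)" using P_ge osc_const_nonneg \<open>l > 0\<close> by simp
      show "0 < (1 + l * infnorm z) ^ (CARD('n) + 2) * (1 + l * infnorm z) ^ (CARD('n) + 1)"
        using \<open>l > 0\<close> infnorm_pos_le[of z] by (intro mult_pos_pos zero_less_power) (auto intro: add_pos_nonneg)
    qed
    finally show ?thesis by (simp add: weight_def)
  qed
  define g where "g \<xi> = p \<xi> * ft h \<xi>" for \<xi>
  have gm [measurable]: "g \<in> borel_measurable borel" unfolding g_def[abs_def] by measurable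
  have Hb: "norm (ft h \<xi>) \<le> (LINT x|lborel. norm (h x))" for \<xi> by (rule norm_ft_le[OF h])
  have gb: "norm (g \<xi>) \<le> 1 * (LINT x|lborel. norm (h x))" for \<xi>
    unfolding g_def norm_mult by (intro mult_mono p1 Hb) auto
  have gint: "integrable lborel g"
    by (rule integrable_bounded_cube(1)[OF gm _ gb, of "2 * l" 0]) (use psupp \<open>l > 0\<close> in \<open>auto simp: g_def\<close>)
  \<comment> \<open>Fubini in place of Plancherel: the transform weighted by the bump is the pairing
    of h with its convolution by \<open>k\<close>, and \<open>k\<close> is dominated by an L^1
    dilate.\<close>
  have A: "(LINT \<xi>|lborel. g \<xi> * cnj (ft h \<xi>)) = (LINT y|lborel. cnj (h y) * (LINT w|lborel. k (y - w) * h w))"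
  proof -
    have "cnj (ft h \<xi>) = (LINT y|lborel. cnj (h y) * e2pi (\<xi> \<bullet> y))" for \<xi>
      unfolding ft_def by (subst Bochner_Integration.integral_cnj[symmetric]) simp
    then have "(LINT \<xi>|lborel. g \<xi> * cnj (ft h \<xi>)) = (LINT \<xi>|lborel. g \<xi> * (LINT y|lborel. cnj (h y) * e2pi (\<xi> \<bullet> y)))"
      by simp
    also have "\<dots> = (LINT y|lborel. cnj (h y) * (LINT \<xi>|lborel. g \<xi> * e2pi (\<xi> \<bullet> y)))"
      by (rule Fubini_phase[OF gint]) (use h in auto)
    also have "\<dots> = (LINT y|lborel. cnj (h y) * (LINT w|lborel. k (y - w) * h w))"
      unfolding k_def multiplier_formula_L1[OF pint h, symmetric]
      by (simp add: g_def mult_ac inner_commute)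
    finally show ?thesis .
  qed
  have gcnj: "g \<xi> * cnj (ft h \<xi>) = of_real (\<Phi> ((1 / l) *\<^sub>R \<xi>) * (norm (ft h \<xi>))\<^sup>2)" for \<xi>
    by (simp add: g_def p_def mult.assoc complex_norm_square[symmetric])
  have [measurable]: "cnj \<in> borel_measurable borel"
    by (intro borel_measurable_continuous_onI continuous_intros)
  have int: "integrable lborel (\<lambda>\<xi>. \<Phi> ((1 / l) *\<^sub>R \<xi>) * (norm (ft h \<xi>))\<^sup>2)"
  proof -
    have "norm (g \<xi> * cnj (ft h \<xi>)) \<le> (1 * (LINT x|lborel. norm (h x))) * (LINT x|lborel. norm (h x))" for \<xi>
      unfolding norm_mult using gb[of \<xi>] Hb[of \<xi>] by (intro mult_mono) auto
    then have "integrable lborel (\<lambda>\<xi>. g \<xi> * cnj (ft h \<xi>))"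
      by (rule integrable_bounded_cube(1)[rotated 2, where A="2 * l" and c=0])
         (use psupp \<open>l > 0\<close> in \<open>auto simp: g_def\<close>)
    then show ?thesis unfolding gcnj complex_of_real_integrable_eq .
  qed
  have "(\<integral>\<^sup>+\<xi>. ennreal (\<Phi> ((1 / l) *\<^sub>R \<xi>) * (norm (ft h \<xi>))\<^sup>2) \<partial>lborel) =
      ennreal (LINT \<xi>|lborel. \<Phi> ((1 / l) *\<^sub>R \<xi>) * (norm (ft h \<xi>))\<^sup>2)"
    by (rule nn_integral_eq_integral[OF int]) (simp add: \<Phi>_nonneg)
  \<comment> \<open>The integrand is real and nonnegative, so passing to the modulus loses
    nothing.\<close>
  also have "\<dots> \<le> ennreal (norm (LINT \<xi>|lborel. g \<xi> * cnj (ft h \<xi>)))"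
    unfolding gcnj integral_complex_of_real by (intro ennreal_leI) (simp add: abs_ge_self)
  also have "\<dots> \<le> (\<integral>\<^sup>+y. ennreal (norm (cnj (h y) * (LINT w|lborel. k (y - w) * h w))) \<partial>lborel)"
    unfolding A by (rule norm_integral_le_nn_integral)
  also have "\<dots> \<le> (\<integral>\<^sup>+y. ennreal (osc_const TYPE('n) * P) *
      (ennreal (norm (h y)) * (\<integral>\<^sup>+w. ennreal (weight l (y - w)) * ennreal (norm (h w)) \<partial>lborel)) \<partial>lborel)"
  proof (rule nn_integral_mono)
    fix y
    have "ennreal (norm (LINT w|lborel. k (y - w) * h w)) \<le> (\<integral>\<^sup>+w. ennreal (norm (k (y - w) * h w)) \<partial>lborel)"
      by (rule norm_integral_le_nn_integral)
    also have "\<dots> \<le> (\<integral>\<^sup>+w. ennreal (osc_const TYPE('n) * P) * (ennreal (weight l (y - w)) * ennreal (norm (h w))) \<partial>lborel)"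
    proof (rule nn_integral_mono)
      fix w
      have "norm (k (y - w) * h w) \<le> osc_const TYPE('n) * P * weight l (y - w) * norm (h w)"
        unfolding norm_mult by (intro mult_right_mono k) auto
      then have "ennreal (norm (k (y - w) * h w)) \<le> ennreal (osc_const TYPE('n) * P * weight l (y - w) * norm (h w))"
        by (rule ennreal_leI)
      then show "ennreal (norm (k (y - w) * h w)) \<le> ennreal (osc_const TYPE('n) * P) * (ennreal (weight l (y - w)) * ennreal (norm (h w)))"
        using osc_const_nonneg P_ge \<open>l > 0\<close> by (simp add: ennreal_mult weight_nonneg mult.assoc)
    qed
    also have "\<dots> = ennreal (osc_const TYPE('n) * P) * (\<integral>\<^sup>+w. ennreal (weight l (y - w)) * ennreal (norm (h w)) \<partial>lborel)"
      by (rule nn_integral_cmult) measurable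
    finally have "ennreal (norm (h y)) * ennreal (norm (LINT w|lborel. k (y - w) * h w)) \<le>
        ennreal (norm (h y)) * (ennreal (osc_const TYPE('n) * P) * (\<integral>\<^sup>+w. ennreal (weight l (y - w)) * ennreal (norm (h w)) \<partial>lborel))"
      by (rule mult_left_mono) simp
    then show "ennreal (norm (cnj (h y) * (LINT w|lborel. k (y - w) * h w))) \<le> ennreal (osc_const TYPE('n) * P) *
      (ennreal (norm (h y)) * (\<integral>\<^sup>+w. ennreal (weight l (y - w)) * ennreal (norm (h w)) \<partial>lborel))"
      by (simp add: norm_mult ennreal_mult mult_ac)
  qed
  also have "\<dots> = ennreal (osc_const TYPE('n) * P) * (\<integral>\<^sup>+y. ennreal (norm (h y)) *
      (\<integral>\<^sup>+w. ennreal (weight l (y - w)) * ennreal (norm (h w)) \<partial>lborel) \<partial>lborel)"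
    by (rule nn_integral_cmult) measurable
  also have "\<dots> \<le> ennreal (osc_const TYPE('n) * P) * (ennreal (2 ^ (2 * CARD('n) + 3)) * sq_int lborel h)"
    by (intro mult_left_mono weight_convolution_L2) (use \<open>l > 0\<close> in auto)
  also have "\<dots> = ennreal bessel_const * sq_int lborel h"
    using osc_const_nonneg P_ge by (simp add: bessel_const_def ennreal_mult mult.assoc)
  finally show ?thesis .
qed

text \<open>The constant in \<open>bessel_cutoff\<close> is independent of the dilation, so the
  cutoff can be removed by monotone convergence over cubes.\<close>

lemma bessel:
  fixes h :: "real^'n \<Rightarrow> complex"
  assumes [measurable]: "h \<in> borel_measurable borel" and h: "integrable lborel h"
  shows "sq_int lborel (ft h) \<le> ennreal bessel_const * sq_int lborel h"
proof -
  let ?u = "\<lambda>(N::nat) \<xi>. ennreal ((norm (ft h \<xi>))\<^sup>2) * indicator (cube 0 (real N)) \<xi>"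
  have inc: "incseq ?u"
    by (auto simp: incseq_def le_fun_def mem_cube indicator_def)
  have sup: "(SUP N. ?u N \<xi>) = ennreal ((norm (ft h \<xi>))\<^sup>2)" for \<xi>
  proof (rule antisym)
    show "(SUP N. ?u N \<xi>) \<le> ennreal ((norm (ft h \<xi>))\<^sup>2)"
      by (rule SUP_least) (auto simp: indicator_def)
    obtain N :: nat where "infnorm \<xi> \<le> real N" using real_arch_simple by blast
    then show "ennreal ((norm (ft h \<xi>))\<^sup>2) \<le> (SUP N. ?u N \<xi>)"
      by (intro SUP_upper2[of N]) (auto simp: mem_cube infnorm_neg indicator_def)
  qed
  have "sq_int lborel (ft h) = (\<integral>\<^sup>+\<xi>. (SUP N. ?u N \<xi>) \<partial>lborel)" by (simp only: sup)
  also have "\<dots> = (SUP N. \<integral>\<^sup>+\<xi>. ?u N \<xi> \<partial>lborel)"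
    by (rule nn_integral_monotone_convergence_SUP[OF inc]) measurable
  also have "\<dots> \<le> ennreal bessel_const * sq_int lborel h"
  proof (rule SUP_least)
    fix N :: nat
    \<comment> \<open>The plateau of the bump has radius 9/100; this dilation makes it cover the
      cube of radius N, and the summand 1 keeps l positive for N = 0.\<close>
    define l where "l = 100 / 9 * (real N + 1)"
    have "l > 0" by (simp add: l_def)
    have "(\<integral>\<^sup>+\<xi>. ?u N \<xi> \<partial>lborel) \<le> (\<integral>\<^sup>+\<xi>. ennreal (\<Phi> ((1 / l) *\<^sub>R \<xi>) * (norm (ft h \<xi>))\<^sup>2) \<partial>lborel)"
    proof (rule nn_integral_mono)
      fix \<xi>
      show "?u N \<xi> \<le> ennreal (\<Phi> ((1 / l) *\<^sub>R \<xi>) * (norm (ft h \<xi>))\<^sup>2)"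
      proof (cases "\<xi> \<in> cube 0 (real N)")
        case True
        then have "infnorm ((1 / l) *\<^sub>R \<xi>) \<le> 9 / 100"
          by (simp add: mem_cube infnorm_neg infnorm_mul l_def field_simps)
        then show ?thesis using True \<Phi>_1 by simp
      qed simp
    qed
    also have "\<dots> \<le> ennreal bessel_const * sq_int lborel h"
      by (rule bessel_cutoff) (use h \<open>l > 0\<close> in auto)
    finally show "(\<integral>\<^sup>+\<xi>. ?u N \<xi> \<partial>lborel) \<le> ennreal bessel_const * sq_int lborel h" .
  qed
  finally show ?thesis .
qed

text \<open>The difference of two truncations lives where f has little L^2 mass, so by
  \<open>bessel\<close> the transforms form a Cauchy sequence. The limit is the witness that the
  choice in \<open>fourier\<close> requires.\<close>

lemma plancherel_limit:
  fixes f :: "real^'n \<Rightarrow> complex"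
  assumes [measurable]: "f \<in> borel_measurable borel" and fin: "sq_int lborel f < \<infinity>"
  shows "\<exists>g\<in>borel_measurable borel. sq_int lborel g < \<infinity> \<and>
    (\<lambda>N::nat. sq_int lborel (\<lambda>\<xi>. ft (\<lambda>x. indicator (cube 0 (real N)) x *\<^sub>R f x) \<xi> - g \<xi>)) \<longlonglongrightarrow> 0"
proof -
  define fN where "fN N x = indicator (cube 0 (real N)) x *\<^sub>R f x" for N :: nat and x
  have [measurable]: "fN N \<in> borel_measurable borel" for N unfolding fN_def[abs_def] by measurable
  have int: "integrable lborel (fN N)" for N
    unfolding fN_def[abs_def] by (rule truncation_integrable[OF _ fin]) measurable
  define \<tau> where "\<tau> N = sq_int lborel (\<lambda>x. indicator (- cube 0 (real N)) x *\<^sub>R f x)" for N :: nat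
  have \<tau>: "\<tau> \<longlonglongrightarrow> 0" unfolding \<tau>_def[abs_def] by (rule tail_tendsto_0[OF _ fin]) measurable
  \<comment> \<open>Two truncations beyond radius N agree on the cube of radius N, hence differ by
    at most the tail.\<close>
  have diff: "sq_int lborel (\<lambda>\<xi>. ft (fN m) \<xi> - ft (fN n) \<xi>) \<le> ennreal bessel_const * \<tau> N" if "m \<ge> N" "n \<ge> N" for m n N
  proof -
    have "sq_int lborel (\<lambda>\<xi>. ft (fN m) \<xi> - ft (fN n) \<xi>) = sq_int lborel (ft (\<lambda>x. fN m x - fN n x))"
      by (simp add: ft_diff[OF int int])
    also have "\<dots> \<le> ennreal bessel_const * sq_int lborel (\<lambda>x. fN m x - fN n x)"
      by (rule bessel) (use int in auto)
    also have "\<dots> \<le> ennreal bessel_const * \<tau> N"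
      unfolding \<tau>_def
    proof (intro mult_left_mono nn_integral_mono ennreal_leI power_mono)
      fix x :: "real^'n"
      have "x \<in> cube 0 (real m)" "x \<in> cube 0 (real n)" if "x \<in> cube 0 (real N)"
        using that \<open>m \<ge> N\<close> \<open>n \<ge> N\<close> by (auto simp: mem_cube)
      then show "norm (fN m x - fN n x) \<le> norm (indicator (- cube 0 (real N)) x *\<^sub>R f x)"
        by (auto simp: fN_def indicator_def)
    qed auto
    finally show ?thesis .
  qed
  have "\<exists>g\<in>borel_measurable lborel. (\<lambda>N. sq_int lborel (\<lambda>\<xi>. ft (fN N) \<xi> - g \<xi>)) \<longlonglongrightarrow> 0"
  proof (rule L2_complete)
    fix e :: ennreal assume e: "e > 0"
    have "(\<lambda>N. ennreal bessel_const * \<tau> N) \<longlonglongrightarrow> ennreal bessel_const * 0"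
      by (rule ennreal_tendsto_cmult[OF _ \<tau>]) simp
    then have "\<forall>\<^sub>F N in sequentially. ennreal bessel_const * \<tau> N < e"
      using e by (intro order_tendstoD) auto
    then obtain N where N: "ennreal bessel_const * \<tau> N < e" by (auto simp: eventually_sequentially)
    show "\<exists>N. \<forall>m\<ge>N. \<forall>n\<ge>N. sq_int lborel (\<lambda>\<xi>. ft (fN m) \<xi> - ft (fN n) \<xi>) \<le> e"
      using diff N by (meson le_less_trans less_imp_le)
  qed measurable
  then obtain g where g: "g \<in> borel_measurable borel" "(\<lambda>N. sq_int lborel (\<lambda>\<xi>. ft (fN N) \<xi> - g \<xi>)) \<longlonglongrightarrow> 0"
    by auto
  note [measurable] = g(1)
  have "sq_int lborel g < \<infinity>"
  proof -
    have "\<forall>\<^sub>F N in sequentially. sq_int lborel (\<lambda>\<xi>. ft (fN N) \<xi> - g \<xi>) < 1"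
      using g(2) by (rule order_tendstoD) simp
    then obtain N where N: "sq_int lborel (\<lambda>\<xi>. ft (fN N) \<xi> - g \<xi>) < 1" by (auto simp: eventually_sequentially)
    have "sq_int lborel (fN N) \<le> sq_int lborel f"
      by (intro nn_integral_mono ennreal_leI power_mono) (auto simp: fN_def indicator_def)
    then have "sq_int lborel (fN N) < \<infinity>" using fin by (rule le_less_trans)
    then have "sq_int lborel (ft (fN N)) < \<infinity>"
      by (intro le_less_trans[OF bessel]) (auto simp: int ennreal_mult_less_top)
    have "sq_int lborel g \<le> 2 * sq_int lborel (ft (fN N)) + 2 * sq_int lborel (\<lambda>\<xi>. ft (fN N) \<xi> - g \<xi>)"
      by (rule sq_int_triangle) measurable
    also have "\<dots> < \<infinity>"
      using N \<open>sq_int lborel (ft (fN N)) < \<infinity>\<close> by (auto simp: ennreal_mult_less_top intro: less_trans[of _ 1])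
    finally show ?thesis .
  qed
  with g show ?thesis by (intro bexI[of _ g]) (auto simp: fN_def[abs_def])
qed

text \<open>Access to both branches of \<open>fourier\<close>. With a witness at hand the chosen
  function has the properties named in the choice, and in the second case these are all that is
  retained.\<close>

lemma fourier_cases:
  fixes f :: "real^'n \<Rightarrow> complex"
  assumes [measurable]: "f \<in> borel_measurable borel" and fin: "sq_int lborel f < \<infinity>"
  obtains (L1) "integrable lborel f" "fourier f = ft f"
  | (L2) "fourier f \<in> borel_measurable lebesgue" "sq_int lebesgue (fourier f) < \<infinity>"
      "(\<lambda>N::nat. sq_int lebesgue (\<lambda>\<xi>. ft (\<lambda>x. indicator (cube 0 (real N)) x *\<^sub>R f x) \<xi> - fourier f \<xi>)) \<longlonglongrightarrow> 0"
proof (cases "integrable lborel f")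
  case True
  then have "integrable lebesgue f" by (simp add: integrable_completion)
  then have "fourier f = ft f" by (simp add: fourier_def fourier_integral_eq_ft)
  with True show ?thesis by (rule L1)
next
  case False
  then have nint: "\<not> integrable lebesgue f" by (simp add: integrable_completion)
  let ?P = "\<lambda>g. in_L2 g \<and> (\<lambda>N::nat. sq_int lebesgue (\<lambda>\<xi>. fourier_integral
            (\<lambda>x. indicator (cube 0 (real N)) x *\<^sub>R f x) \<xi> - g \<xi>)) \<longlonglongrightarrow> 0"
  have eq: "fourier_integral (\<lambda>x. indicator (cube 0 (real N)) x *\<^sub>R f x) = ft (\<lambda>x. indicator (cube 0 (real N)) x *\<^sub>R f x)" for N :: nat
    by (rule fourier_integral_eq_ft) measurable
  from plancherel_limit[OF assms] obtain g where [measurable]: "g \<in> borel_measurable borel" and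
    g: "sq_int lborel g < \<infinity>" "(\<lambda>N::nat. sq_int lborel (\<lambda>\<xi>. ft (\<lambda>x. indicator (cube 0 (real N)) x *\<^sub>R f x) \<xi> - g \<xi>)) \<longlonglongrightarrow> 0"
    by auto
  have "integrable lborel (\<lambda>x. (norm (g x))\<^sup>2)"
    by (rule integrableI_bounded) (use g(1) in auto)
  then have "in_L2 g"
    unfolding in_L2_def by (subst integrable_completion) (auto intro!: measurable_completion)
  then have "?P g" unfolding eq using g(2) by (simp add: nn_integral_completion)
  then have "?P (SOME g. ?P g)" by (rule someI[of ?P])
  moreover have "fourier f = (SOME g. ?P g)" using nint by (simp add: fourier_def)
  ultimately have P: "?P (fourier f)" by simp
  have "sq_int lebesgue (fourier f) < \<infinity>"
    using P unfolding in_L2_def integrable_iff_bounded by simp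
  with P show ?thesis unfolding eq by (intro L2) (auto simp: in_L2_def)
qed

lemma fourier_mult_integrable:
  fixes f m :: "real^'n \<Rightarrow> complex"
  assumes [measurable]: "f \<in> borel_measurable borel" and fin: "sq_int lborel f < \<infinity>"
    and m: "m \<in> borel_measurable borel" "\<And>\<xi>. norm (m \<xi>) \<le> B" "\<And>\<xi>. \<xi> \<notin> cube c A \<Longrightarrow> m \<xi> = 0" "A \<ge> 0"
  shows "integrable lebesgue (\<lambda>\<xi>. m \<xi> * e2pi (y \<bullet> \<xi>) * fourier f \<xi>)"
    and "sq_int lborel m < \<infinity>"
proof -
  note [measurable] = m(1)
  have B0: "B \<ge> 0" using m(2)[of 0] norm_ge_zero order.trans by blast
  have "sq_int lborel m \<le> (\<integral>\<^sup>+\<xi>. ennreal (B\<^sup>2) * indicator (cube c A) \<xi> \<partial>lborel)"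
  proof (rule nn_integral_mono)
    fix \<xi>
    show "ennreal ((norm (m \<xi>))\<^sup>2) \<le> ennreal (B\<^sup>2) * indicator (cube c A) \<xi>"
      using m(2)[of \<xi>] m(3)[of \<xi>] by (cases "\<xi> \<in> cube c A") (auto intro!: ennreal_leI power_mono)
  qed
  also have "\<dots> < \<infinity>" using m(4) by (simp add: nn_integral_cmult_indicator emeasure_cube ennreal_mult_less_top)
  finally show m2: "sq_int lborel m < \<infinity>" .
  show "integrable lebesgue (\<lambda>\<xi>. m \<xi> * e2pi (y \<bullet> \<xi>) * fourier f \<xi>)"
  proof (rule fourier_cases[OF _ fin])
    show "f \<in> borel_measurable borel" by measurable
  next
    assume f: "integrable lborel f" "fourier f = ft f"
    have "integrable lborel (\<lambda>\<xi>. m \<xi> * e2pi (y \<bullet> \<xi>) * ft f \<xi>)"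
    proof (rule integrable_bounded_cube(1)[OF _ m(4)])
      show "norm (m \<xi> * e2pi (y \<bullet> \<xi>) * ft f \<xi>) \<le> B * (LINT x|lborel. norm (f x))" for \<xi>
        unfolding norm_mult norm_e2pi mult_1_right by (intro mult_mono m(2) norm_ft_le[OF f(1)] B0) auto
    qed (use m(3) in auto)
    then show ?thesis using f(2) by (simp add: integrable_completion)
  next
    assume f: "fourier f \<in> borel_measurable lebesgue" "sq_int lebesgue (fourier f) < \<infinity>"
    show ?thesis
    proof (rule integrable_L2_mult[OF _ f(1) _ f(2)])
      show "(\<lambda>\<xi>. m \<xi> * e2pi (y \<bullet> \<xi>)) \<in> borel_measurable lebesgue"
        by (rule measurable_completion) measurable
      show "sq_int lebesgue (\<lambda>\<xi>. m \<xi> * e2pi (y \<bullet> \<xi>)) < \<infinity>"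
        using m2 by (simp add: norm_mult nn_integral_completion)
    qed
  qed
qed

text \<open>For integrable f this is Fubini. In the other case it is applied to truncations: the
  kernel side converges by dominated convergence, the frequency side by Cauchy-Schwarz.\<close>

lemma multiplier_formula:
  fixes f m :: "real^'n \<Rightarrow> complex"
  assumes fm: "f \<in> borel_measurable borel" and fin: "sq_int lborel f < \<infinity>"
    and m: "m \<in> borel_measurable borel" "\<And>\<xi>. norm (m \<xi>) \<le> B" "\<And>\<xi>. \<xi> \<notin> cube c A \<Longrightarrow> m \<xi> = 0" "A \<ge> 0"
    and k: "\<And>z. norm (LINT \<xi>|lborel. m \<xi> * e2pi (\<xi> \<bullet> z)) \<le> D * weight l z" and "l > 0"
  shows "(LINT \<xi>|lebesgue. m \<xi> * e2pi (y \<bullet> \<xi>) * fourier f \<xi>) =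
    (LINT w|lborel. (LINT \<xi>|lborel. m \<xi> * e2pi (\<xi> \<bullet> (y - w))) * f w)"
    and "integrable lborel (\<lambda>w. (LINT \<xi>|lborel. m \<xi> * e2pi (\<xi> \<bullet> (y - w))) * f w)"
proof -
  note [measurable] = m(1) fm
  define K where "K z = (LINT \<xi>|lborel. m \<xi> * e2pi (\<xi> \<bullet> z))" for z
  have Km [measurable]: "K \<in> borel_measurable borel" unfolding K_def[abs_def] by measurable
  have mint: "integrable lborel m" by (rule integrable_bounded_cube(1)[OF m(1,4,2,3)])
  \<comment> \<open>The weight is at most l^n, so its square is dominated by l^n times the weight,
    which is integrable: the kernel lies in L^2.\<close>
  have "sq_int lborel (\<lambda>w. K (y - w)) \<le> (\<integral>\<^sup>+w. ennreal (D\<^sup>2 * l ^ CARD('n)) * ennreal (weight l (y - w)) \<partial>lborel)"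
  proof (rule nn_integral_mono)
    fix w
    have W: "weight l (y - w) \<ge> 0" using \<open>l > 0\<close> by (simp add: weight_nonneg)
    have "weight l (y - w) \<le> l ^ CARD('n) / 1"
      unfolding weight_def using \<open>l > 0\<close> infnorm_pos_le[of "y - w"]
      by (intro divide_left_mono one_le_power) (auto simp: add_pos_nonneg)
    then have Wl: "weight l (y - w) * weight l (y - w) \<le> l ^ CARD('n) * weight l (y - w)"
      using W by (intro mult_right_mono) auto
    have "(norm (K (y - w)))\<^sup>2 \<le> (D * weight l (y - w))\<^sup>2"
      using k[of "y - w"] by (intro power_mono) (auto simp: K_def)
    also have "\<dots> = D\<^sup>2 * (weight l (y - w) * weight l (y - w))" by (simp add: power2_eq_square)
    also have "\<dots> \<le> D\<^sup>2 * (l ^ CARD('n) * weight l (y - w))" using Wl by (intro mult_left_mono) auto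
    finally have "ennreal ((norm (K (y - w)))\<^sup>2) \<le> ennreal (D\<^sup>2 * l ^ CARD('n) * weight l (y - w))"
      by (intro ennreal_leI) (simp add: mult.assoc)
    then show "ennreal ((norm (K (y - w)))\<^sup>2) \<le> ennreal (D\<^sup>2 * l ^ CARD('n)) * ennreal (weight l (y - w))"
      using W \<open>l > 0\<close> by (simp add: ennreal_mult)
  qed
  also have "\<dots> = ennreal (D\<^sup>2 * l ^ CARD('n)) * (\<integral>\<^sup>+w. ennreal (weight l (y - w)) \<partial>lborel)"
    by (rule nn_integral_cmult) measurable
  also have "\<dots> < \<infinity>"
    using weight_nn_integral[OF \<open>l > 0\<close>, of y] by (auto simp: ennreal_mult_less_top intro: le_less_trans)
  finally have K2: "sq_int lborel (\<lambda>w. K (y - w)) < \<infinity>" .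
  show int: "integrable lborel (\<lambda>w. (LINT \<xi>|lborel. m \<xi> * e2pi (\<xi> \<bullet> (y - w))) * f w)"
    unfolding K_def[symmetric] by (rule integrable_L2_mult[OF _ _ K2 fin]) measurable
  show "(LINT \<xi>|lebesgue. m \<xi> * e2pi (y \<bullet> \<xi>) * fourier f \<xi>) =
    (LINT w|lborel. (LINT \<xi>|lborel. m \<xi> * e2pi (\<xi> \<bullet> (y - w))) * f w)"
  proof (rule fourier_cases[OF fm fin])
    assume f: "integrable lborel f" "fourier f = ft f"
    have "(LINT \<xi>|lebesgue. m \<xi> * e2pi (y \<bullet> \<xi>) * ft f \<xi>) = (LINT \<xi>|lborel. m \<xi> * e2pi (y \<bullet> \<xi>) * ft f \<xi>)"
      by (rule integral_completion) measurable
    then show ?thesis using multiplier_formula_L1[OF mint f(1)] f(2) by simp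
  next
    assume f: "fourier f \<in> borel_measurable lebesgue" "sq_int lebesgue (fourier f) < \<infinity>"
      and lim: "(\<lambda>N::nat. sq_int lebesgue (\<lambda>\<xi>. ft (\<lambda>x. indicator (cube 0 (real N)) x *\<^sub>R f x) \<xi> - fourier f \<xi>)) \<longlonglongrightarrow> 0"
    define fN where "fN N x = indicator (cube 0 (real N)) x *\<^sub>R f x" for N :: nat and x
    have fNm [measurable]: "fN N \<in> borel_measurable borel" for N unfolding fN_def[abs_def] by measurable
    have fNint: "integrable lborel (fN N)" for N
      unfolding fN_def[abs_def] by (rule truncation_integrable[OF fm fin])
    let ?I = "LINT \<xi>|lebesgue. m \<xi> * e2pi (y \<bullet> \<xi>) * fourier f \<xi>"
    let ?J = "\<lambda>N. LINT \<xi>|lebesgue. m \<xi> * e2pi (y \<bullet> \<xi>) * ft (fN N) \<xi>"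
    have J: "?J N = (LINT w|lborel. K (y - w) * fN N w)" for N
    proof -
      have "?J N = (LINT \<xi>|lborel. m \<xi> * e2pi (y \<bullet> \<xi>) * ft (fN N) \<xi>)"
        by (rule integral_completion) measurable
      then show ?thesis using multiplier_formula_L1[OF mint fNint] by (simp add: K_def)
    qed
    have "?J \<longlonglongrightarrow> (LINT w|lborel. K (y - w) * f w)"
      unfolding J
    proof (rule integral_dominated_convergence)
      show "integrable lborel (\<lambda>w. norm (K (y - w) * f w))" using int by (simp add: K_def)
      show "AE w in lborel. norm (K (y - w) * fN N w) \<le> norm (K (y - w) * f w)" for N
        by (auto simp: fN_def indicator_def)
      show "AE w in lborel. (\<lambda>N. K (y - w) * fN N w) \<longlonglongrightarrow> K (y - w) * f w"
      proof (rule AE_I2)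
        fix w :: "real^'n"
        obtain N0 :: nat where "infnorm w \<le> real N0" using real_arch_simple by blast
        then have "\<forall>\<^sub>F N in sequentially. K (y - w) * fN N w = K (y - w) * f w"
          by (intro eventually_mono[OF eventually_ge_at_top[of N0]])
             (auto simp: fN_def mem_cube infnorm_neg indicator_def)
        then show "(\<lambda>N. K (y - w) * fN N w) \<longlonglongrightarrow> K (y - w) * f w" by (rule tendsto_eventually)
      qed
    qed measurable
    \<comment> \<open>The multiplier is in L^2 and the transforms of the truncations converge in L^2
      to the chosen representative.\<close>
    moreover have "?J \<longlonglongrightarrow> ?I"
    proof -
      have ml: "(\<lambda>\<xi>. m \<xi> * e2pi (y \<bullet> \<xi>)) \<in> borel_measurable lebesgue"
        by (rule measurable_completion) measurable
      have Fl [measurable]: "ft (fN N) \<in> borel_measurable lebesgue" for N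
        by (rule measurable_completion) measurable
      note [measurable] = ml f(1)
      have m2: "sq_int lebesgue (\<lambda>\<xi>. m \<xi> * e2pi (y \<bullet> \<xi>)) < \<infinity>"
        using fourier_mult_integrable(2)[OF fm fin m] by (simp add: norm_mult nn_integral_completion)
      have i1: "integrable lebesgue (\<lambda>\<xi>. m \<xi> * e2pi (y \<bullet> \<xi>) * fourier f \<xi>)"
        by (rule fourier_mult_integrable(1)[OF fm fin m])
      have "sq_int lborel (fN N) \<le> sq_int lborel f" for N
        by (intro nn_integral_mono ennreal_leI power_mono) (auto simp: fN_def indicator_def)
      then have "sq_int lborel (fN N) < \<infinity>" for N using fin le_less_trans by blast
      then have "sq_int lborel (ft (fN N)) < \<infinity>" for N
        by (intro le_less_trans[OF bessel]) (auto simp: fNint ennreal_mult_less_top)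
      then have i2: "integrable lebesgue (\<lambda>\<xi>. m \<xi> * e2pi (y \<bullet> \<xi>) * ft (fN N) \<xi>)" for N
        by (intro integrable_L2_mult[OF ml Fl m2]) (simp add: nn_integral_completion)
      define X where "X N = sq_int lebesgue (\<lambda>\<xi>. ft (fN N) \<xi> - fourier f \<xi>)" for N
      have X0: "X \<longlonglongrightarrow> 0" using lim by (simp add: X_def[abs_def] fN_def[abs_def])
      let ?Q = "sq_int lebesgue (\<lambda>\<xi>. m \<xi> * e2pi (y \<bullet> \<xi>))"
      have le: "(ennreal (norm (?J N - ?I)))\<^sup>2 \<le> ?Q * X N" for N
      proof -
        have "?J N - ?I = (LINT \<xi>|lebesgue. m \<xi> * e2pi (y \<bullet> \<xi>) * (ft (fN N) \<xi> - fourier f \<xi>))"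
          unfolding right_diff_distrib by (rule Bochner_Integration.integral_diff[symmetric, OF i2 i1])
        then have "ennreal (norm (?J N - ?I)) \<le>
            (\<integral>\<^sup>+\<xi>. ennreal (norm (m \<xi> * e2pi (y \<bullet> \<xi>) * (ft (fN N) \<xi> - fourier f \<xi>))) \<partial>lebesgue)"
          by (simp only: norm_integral_le_nn_integral)
        also have "\<dots> = (\<integral>\<^sup>+\<xi>. ennreal (norm (m \<xi> * e2pi (y \<bullet> \<xi>))) * ennreal (norm (ft (fN N) \<xi> - fourier f \<xi>)) \<partial>lebesgue)"
          by (simp add: norm_mult ennreal_mult)
        finally have "(ennreal (norm (?J N - ?I)))\<^sup>2 \<le>
            (\<integral>\<^sup>+\<xi>. ennreal (norm (m \<xi> * e2pi (y \<bullet> \<xi>))) * ennreal (norm (ft (fN N) \<xi> - fourier f \<xi>)) \<partial>lebesgue)\<^sup>2"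
          by (intro power_mono) auto
        also have "\<dots> \<le> (\<integral>\<^sup>+\<xi>. (ennreal (norm (m \<xi> * e2pi (y \<bullet> \<xi>))))\<^sup>2 \<partial>lebesgue) *
            (\<integral>\<^sup>+\<xi>. (ennreal (norm (ft (fN N) \<xi> - fourier f \<xi>)))\<^sup>2 \<partial>lebesgue)"
          by (rule Cauchy_Schwarz_nn_integral) measurable
        finally show ?thesis by (simp add: X_def ennreal_power)
      qed
      have lim0: "(\<lambda>N. ?Q * X N) \<longlonglongrightarrow> ?Q * 0" by (rule ennreal_tendsto_cmult[OF _ X0]) (use m2 in simp)
      have "(\<lambda>N. (ennreal (norm (?J N - ?I)))\<^sup>2) \<longlonglongrightarrow> 0"
      proof (rule tendsto_sandwich[OF _ _ tendsto_const lim0[unfolded mult_zero_right]])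
        show "\<forall>\<^sub>F N in sequentially. (ennreal (norm (?J N - ?I)))\<^sup>2 \<le> ?Q * X N"
          using le by (rule eventuallyI)
      qed simp
      then have "(\<lambda>N. ennreal ((norm (?J N - ?I))\<^sup>2)) \<longlonglongrightarrow> ennreal 0"
        by (simp only: ennreal_power[OF norm_ge_zero] ennreal_0)
      then have "(\<lambda>N. (norm (?J N - ?I))\<^sup>2) \<longlonglongrightarrow> 0" by (subst (asm) tendsto_ennreal_iff) auto
      then have "(\<lambda>N. sqrt ((norm (?J N - ?I))\<^sup>2)) \<longlonglongrightarrow> sqrt 0" by (rule tendsto_real_sqrt)
      then have "(\<lambda>N. norm (?J N - ?I)) \<longlonglongrightarrow> 0" by (simp only: real_sqrt_abs abs_norm_cancel real_sqrt_zero)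
      then have "(\<lambda>N. ?J N - ?I) \<longlonglongrightarrow> 0" by (rule tendsto_norm_zero_cancel)
      then show ?thesis by (rule LIM_zero_cancel)
    qed
    ultimately have "(LINT w|lborel. K (y - w) * f w) = ?I" by (rule LIMSEQ_unique)
    then show ?thesis by (simp add: K_def)
  qed
qed

end

section \<open>The singular kernel and its dyadic pieces\<close>

lemma line_bdd_uminus: "line_bdd N i l B S g \<Longrightarrow> line_bdd N i l B S (\<lambda>x. - g x)"
proof (induction N arbitrary: g B)
  case (Suc N)
  obtain g' where g: "\<forall>x\<in>S. norm (g x) \<le> B"
    "\<forall>x\<in>S. line_deriv i g (g' x) x"
    "line_bdd N i l (B / l) S g'" by (rule line_bdd_SucE[OF Suc.prems])
  show ?case
    by (rule line_bdd_SucI[OF _ _ Suc.IH[OF g(3)]])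
       (use g in \<open>auto intro!: has_vector_derivative_minus\<close>)
qed auto

lemma line_bdd_diff:
  "line_bdd N i l B S f \<Longrightarrow> line_bdd N i l C S g \<Longrightarrow> line_bdd N i l (B + C) S (\<lambda>x. f x - g x)"
  using line_bdd_add[OF _ line_bdd_uminus] by fastforce

lemma line_bdd_smaller_scale:
  "line_bdd N i l B S g \<Longrightarrow> 0 < l' \<Longrightarrow> l' \<le> l \<Longrightarrow> B \<ge> 0 \<Longrightarrow> line_bdd N i l' B S g"
proof (induction N arbitrary: g B)
  case (Suc N)
  obtain g' where g: "\<forall>x\<in>S. norm (g x) \<le> B"
    "\<forall>x\<in>S. line_deriv i g (g' x) x"
    "line_bdd N i l (B / l) S g'" by (rule line_bdd_SucE[OF Suc.prems(1)])
  have "line_bdd N i l' (B / l) S g'" by (rule Suc.IH[OF g(3)]) (use Suc.prems in auto)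
  then have "line_bdd N i l' (B / l') S g'"
    by (rule line_bdd_mono) (use Suc.prems in \<open>auto intro!: divide_left_mono\<close>)
  then show ?case using g by (intro line_bdd_SucI) auto
qed auto

lemma line_bdd_larger_scale:
  "line_bdd N i l B S g \<Longrightarrow> 0 < l \<Longrightarrow> l \<le> l' \<Longrightarrow> B \<ge> 0 \<Longrightarrow> line_bdd N i l' (B * (l' / l) ^ N) S g"
proof (induction N arbitrary: g B)
  case (Suc N)
  obtain g' where g: "\<forall>x\<in>S. norm (g x) \<le> B"
    "\<forall>x\<in>S. line_deriv i g (g' x) x"
    "line_bdd N i l (B / l) S g'" by (rule line_bdd_SucE[OF Suc.prems(1)])
  have "line_bdd N i l' (B / l * (l' / l) ^ N) S g'" by (rule Suc.IH[OF g(3)]) (use Suc.prems in auto)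
  moreover have "B / l * (l' / l) ^ N = B * (l' / l) ^ Suc N / l'" using Suc.prems by (simp add: field_simps)
  ultimately have g': "line_bdd N i l' (B * (l' / l) ^ Suc N / l') S g'" by simp
  have "B * 1 \<le> B * (l' / l) ^ Suc N" using Suc.prems by (intro mult_left_mono one_le_power) auto
  then have "\<forall>x\<in>S. norm (g x) \<le> B * (l' / l) ^ Suc N" using g(1) by (auto intro: order.trans)
  then show ?case using g(2) g' by (intro line_bdd_SucI) auto
qed auto

text \<open>With t = 2^j |x| the dyadic weight is the weight divided by 1 + t, which absorbs either
  1 or t.\<close>

lemma dyadic_weight_le_weight:
  fixes x :: "real^'n::finite"
  shows "dyadic_weight j x \<le> weight (2 powi j) x"
    and "(2 powi j * infnorm x) * dyadic_weight j x \<le> weight (2 powi j) x"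
proof -
  define t where "t = 2 powi j * infnorm x"
  have t: "t \<ge> 0" by (simp add: t_def infnorm_pos_le)
  define W where "W = weight (2 powi j) x"
  have W: "W \<ge> 0" by (simp add: W_def weight_nonneg)
  have D: "dyadic_weight j x = W / (1 + t)"
    unfolding dyadic_weight_def W_def weight_def t_def by simp
  show "dyadic_weight j x \<le> weight (2 powi j) x"
    unfolding D W_def[symmetric] using W t by (simp add: divide_le_eq mult_left_le_one_le add_pos_nonneg mult_le_cancel_left1)
  have "t * W \<le> (1 + t) * W" using W by (intro mult_right_mono) auto
  then show "(2 powi j * infnorm x) * dyadic_weight j x \<le> weight (2 powi j) x"
    unfolding D W_def[symmetric] t_def[symmetric] using t by (simp add: divide_le_eq mult.commute)
qed

section \<open>The two kinds of cutoff built from the bump\<close>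

context bump
begin

text \<open>A common bound for both kinds: the dilation by 2 in the Littlewood-Paley cutoff costs
  2^(n+2), and there are two terms.\<close>

definition X :: real where "X = 2 ^ (CARD('n) + 3) * P"

definition \<psi> :: "real^'n \<Rightarrow> complex" where "\<psi> \<xi> = of_real (Psi \<Phi> \<xi>)"

text \<open>A tile cutoff minus the bump, in the variable (\<xi> - \<eta>0) divided by the side of
  \<omega>(s); \<delta> is the rescaled offset of \<eta>0 from the centre. Subtracting the bump
  removes a neighbourhood of the singularity of the symbol.\<close>

definition shifted_cutoff :: "real^'n \<Rightarrow> real^'n \<Rightarrow> complex" where
  "shifted_cutoff \<delta> \<xi> = of_real (\<Phi> ((1 / 6) *\<^sub>R (\<xi> + \<delta>))) - of_real (\<Phi> \<xi>)"

lemma X_nonneg: "X \<ge> 0" using P_ge by (simp add: X_def)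

lemma continuous_\<Phi>: "continuous_on S f \<Longrightarrow> continuous_on S (\<lambda>x. \<Phi> (f x))"
  by (rule continuous_on_compose2[OF \<Phi>_cont]) auto

lemma cutoff_\<psi>: "cutoff X \<psi>"
  unfolding cutoff_def
proof (intro conjI allI impI)
  show "X \<ge> 0" by (rule X_nonneg)
  show "continuous_on UNIV \<psi>" unfolding \<psi>_def[abs_def] Psi_def
    by (intro continuous_intros continuous_\<Phi>)
  fix i
  have "line_bdd (CARD('n) + 2) i (1 / 2) P UNIV (\<lambda>\<xi>. of_real (\<Phi> (2 *\<^sub>R \<xi> + 0)))"
    by (rule line_bdd_affine[OF _ _ \<Phi>_bdd]) auto
  then have "line_bdd (CARD('n) + 2) i 1 (P * (1 / (1 / 2)) ^ (CARD('n) + 2)) UNIV (\<lambda>\<xi>. of_real (\<Phi> (2 *\<^sub>R \<xi> + 0)))"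
    by (rule line_bdd_larger_scale) (use P_ge in auto)
  then have "line_bdd (CARD('n) + 2) i 1 (P * 2 ^ (CARD('n) + 2)) UNIV (\<lambda>\<xi>. of_real (\<Phi> (2 *\<^sub>R \<xi>)))" by simp
  note bdd = line_bdd_diff[OF \<Phi>_bdd this]
  show "line_bdd (CARD('n) + 2) i 1 X UNIV \<psi>"
    unfolding \<psi>_def[abs_def] Psi_def of_real_diff
  proof (rule line_bdd_mono[OF bdd])
    have "P * 1 \<le> P * 2 ^ (CARD('n) + 2)" using P_ge by (intro mult_left_mono one_le_power) auto
    then show "P + P * 2 ^ (CARD('n) + 2) \<le> X" by (simp add: X_def power_add)
  qed auto
next
  fix \<xi> :: "real^'n" assume "infnorm \<xi> \<le> 1 / 25"
  \<comment> \<open>The dilated argument has size at most 2/25 = 8/100, still on the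
    plateau.\<close>
  then show "\<psi> \<xi> = 0" using \<Phi>_1[of \<xi>] \<Phi>_1[of "2 *\<^sub>R \<xi>"] by (simp add: \<psi>_def Psi_def infnorm_mul)
next
  fix \<xi> :: "real^'n" assume "infnorm \<xi> > 2"
  then show "\<psi> \<xi> = 0" using \<Phi>_0[of \<xi>] \<Phi>_0[of "2 *\<^sub>R \<xi>"] by (simp add: \<psi>_def Psi_def infnorm_mul)
qed

lemma cutoff_shifted:
  assumes "infnorm \<delta> \<le> 1 / 2"
  shows "cutoff X (shifted_cutoff \<delta>)"
  unfolding cutoff_def
proof (intro conjI allI impI)
  show "X \<ge> 0" by (rule X_nonneg)
  show "continuous_on UNIV (shifted_cutoff \<delta>)" unfolding shifted_cutoff_def[abs_def]
    by (intro continuous_intros continuous_\<Phi>)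
  fix i
  have "line_bdd (CARD('n) + 2) i (1 / (1 / 6)) P UNIV (\<lambda>\<xi>. of_real (\<Phi> ((1 / 6) *\<^sub>R \<xi> + (1 / 6) *\<^sub>R \<delta>)))"
    by (rule line_bdd_affine[OF _ _ \<Phi>_bdd]) auto
  then have "line_bdd (CARD('n) + 2) i 1 P UNIV (\<lambda>\<xi>. of_real (\<Phi> ((1 / 6) *\<^sub>R (\<xi> + \<delta>))))"
    unfolding scaleR_add_right by (rule line_bdd_smaller_scale) (use P_ge in auto)
  note bdd = line_bdd_diff[OF this \<Phi>_bdd]
  show "line_bdd (CARD('n) + 2) i 1 X UNIV (shifted_cutoff \<delta>)"
    unfolding shifted_cutoff_def[abs_def]
  proof (rule line_bdd_mono[OF bdd])
    have "2 ^ 1 * P \<le> 2 ^ (CARD('n) + 3) * P" using P_ge by (intro mult_right_mono power_increasing) auto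
    then show "P + P \<le> X" by (simp add: X_def)
  qed auto
next
  fix \<xi> :: "real^'n" assume \<xi>: "infnorm \<xi> \<le> 1 / 25"
  \<comment> \<open>The sum is 54/100, and a sixth of it is exactly the plateau radius
    9/100.\<close>
  have "infnorm (\<xi> + \<delta>) \<le> 1 / 25 + 1 / 2" using infnorm_triangle[of \<xi> \<delta>] assms \<xi> by simp
  then show "shifted_cutoff \<delta> \<xi> = 0" using \<xi> \<Phi>_1[of \<xi>] \<Phi>_1[of "(1 / 6) *\<^sub>R (\<xi> + \<delta>)"] by (simp add: shifted_cutoff_def infnorm_mul)
next
  fix \<xi> :: "real^'n" assume \<xi>: "infnorm \<xi> > 2"
  have "infnorm \<xi> \<le> infnorm (\<xi> + \<delta>) + infnorm \<delta>" using infnorm_triangle[of "\<xi> + \<delta>" "- \<delta>"] by (simp add: infnorm_neg)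
  then have "infnorm (\<xi> + \<delta>) > 3 / 2" using assms \<xi> by simp
  then show "shifted_cutoff \<delta> \<xi> = 0" using \<xi> \<Phi>_0[of \<xi>] \<Phi>_0[of "(1 / 6) *\<^sub>R (\<xi> + \<delta>)"] by (simp add: shifted_cutoff_def infnorm_mul)
qed

text \<open>The piece of index j is the bump at scale 2^j minus the bump at scale 2^(j-1), so the
  sum is over the half-open interval (I, J].\<close>

lemma Psi_telescope:
  assumes "I \<le> J"
  shows "(\<Sum>j\<in>{I<..J}. Psi \<Phi> ((1 / 2 powi j) *\<^sub>R \<xi>)) = \<Phi> ((1 / 2 powi J) *\<^sub>R \<xi>) - \<Phi> ((1 / 2 powi I) *\<^sub>R \<xi>)"
  using assms
proof (induction J rule: int_ge_induct)
  case (step J)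
  have "{I<..J + 1} = insert (J + 1) {I<..J}" using step by auto
  moreover have "2 * (1 / 2 powi (J + 1)) = (1 / 2 powi J :: real)" by (simp add: power_int_add)
  ultimately show ?case using step by (simp add: Psi_def)
qed simp

end

section \<open>Dyadic pieces of the kernel: size, off-scale decay and comparison\<close>

locale symbol_bump = symbol a a' M + bump \<Phi> P
  for a :: "real^'n::finite \<Rightarrow> real^'n \<Rightarrow> complex" and a' M
    and \<Phi> :: "real^'n \<Rightarrow> real" and P
begin

abbreviation K :: "int \<Rightarrow> real^'n \<Rightarrow> real^'n \<Rightarrow> complex" where
  "K j \<equiv> piece \<psi> (2 powi j)"

abbreviation trunc_kernel :: "real^'n \<Rightarrow> real \<Rightarrow> real^'n \<Rightarrow> complex" where
  "trunc_kernel z \<epsilon> \<equiv> \<lambda>w. indicator (- cube z \<epsilon>) w *\<^sub>R infsum (\<lambda>j. K j z (z - w)) UNIV"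

text \<open>\<open>C1\<close> bounds a piece, \<open>C2\<close> its change per unit of r l under
  moving the base point, and \<open>C3\<close> a piece whose base point has been moved.\<close>

definition C1 :: real where "C1 = osc_const TYPE('n) * (2 ^ (CARD('n) + 2) * (M * X))"
definition C2 :: real where "C2 = osc_const TYPE('n) * (incr_const TYPE('n) * (M * X))"
definition C3 :: real where "C3 = C1 + C2"
text \<open>The three summands are the off-scale tails (4 from the two-sided geometric sum), the
  modulation by the difference of the two frequencies, and the move of the base point.\<close>

definition C4 :: real where "C4 = 4 * (C3 * 2 ^ (CARD('n) + 1)) + 2 * pi * CARD('n) * C3 + C2"

lemma C_nonneg: "C1 \<ge> 0" "C2 \<ge> 0" "C3 \<ge> 0" "C4 \<ge> 0"
proof -
  have "incr_const TYPE('n) \<ge> 0" by (simp add: incr_const_def Let_def)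
  then show "C1 \<ge> 0" "C2 \<ge> 0"
    using X_nonneg M_nonneg osc_const_nonneg by (simp_all add: C1_def C2_def)
  then show "C3 \<ge> 0" "C4 \<ge> 0" by (simp_all add: C3_def C4_def)
qed

text \<open>A displacement of at most 1/l changes the piece by no more than its own size, so a piece
  based at y can be measured by its distance from z.\<close>

lemma piece_shift_bound:
  assumes "cutoff X \<theta>" "l > 0" "infnorm (y - z) \<le> r" "r * l \<le> 1"
  shows "norm (piece \<theta> l y (y - w)) \<le> C3 * (l ^ CARD('n) / (1 + l * infnorm (z - w)) ^ (CARD('n) + 2))"
proof -
  define D where "D = l ^ CARD('n) / (1 + l * infnorm (z - w)) ^ (CARD('n) + 2)"
  have D: "D \<ge> 0" using assms by (simp add: D_def infnorm_pos_le)
  have 1: "norm (piece \<theta> l z (z - w)) \<le> C1 * D"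
    using piece_bound[OF assms(1,2), of z "z - w"] by (simp add: C1_def D_def)
  have "norm (piece \<theta> l y (y - w) - piece \<theta> l z (z - w)) \<le> (r * l) * (C2 * D)"
    using piece_increment_bound[OF assms, of w] by (simp add: C2_def D_def mult_ac)
  also have "\<dots> \<le> 1 * (C2 * D)" using assms D C_nonneg by (intro mult_right_mono) auto
  finally have 2: "norm (piece \<theta> l y (y - w) - piece \<theta> l z (z - w)) \<le> C2 * D" by simp
  have "norm (piece \<theta> l y (y - w)) \<le> norm (piece \<theta> l z (z - w)) + norm (piece \<theta> l y (y - w) - piece \<theta> l z (z - w))"
    using norm_triangle_sub by blast
  also have "\<dots> \<le> C1 * D + C2 * D" using 1 2 by linarith
  finally show ?thesis unfolding D_def[symmetric] by (simp only: C3_def distrib_right)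
qed

lemma K_bound: "norm (K j z x) \<le> C3 * dyadic_weight j x"
proof -
  have "norm (K j z x) \<le> C1 * dyadic_weight j x"
    using piece_bound[OF cutoff_\<psi>, of "2 powi j" z x] by (simp add: C1_def dyadic_weight_def)
  also have "\<dots> \<le> C3 * dyadic_weight j x"
    using C_nonneg by (intro mult_right_mono) (auto simp: C3_def dyadic_weight_def infnorm_pos_le)
  finally show ?thesis .
qed

lemma K_off_scale:
  fixes x :: "real^'n"
  assumes "j \<le> \<nu> \<and> 2 powi \<nu> * infnorm x \<le> 1 \<or> \<nu> \<le> j \<and> 2 powi \<nu> * infnorm x \<ge> 1"
    and "norm k \<le> C3 * dyadic_weight j x"
  shows "norm (k::complex) \<le> (C3 * 2 ^ (CARD('n) + 1) * weight (2 powi \<nu>) x) * (1 / 2) ^ nat \<bar>j - \<nu>\<bar>"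
proof -
  have "C3 * dyadic_weight j x \<le> C3 * (2 ^ (CARD('n) + 1) * weight (2 powi \<nu>) x * (1 / 2) ^ nat \<bar>j - \<nu>\<bar>)"
    by (rule mult_left_mono[OF dyadic_weight_off_scale[OF assms(1)] C_nonneg(3)])
  with assms(2) show ?thesis by (simp add: mult_ac)
qed

text \<open>At x the scales far from 1/|x| contribute geometrically little: the lower ones when
  2^\<nu> |x| \<le> 1, the upper ones when 2^\<nu> |x| \<ge> 1.\<close>

lemma K_tails:
  shows "2 powi \<nu> * infnorm x \<le> 1 \<Longrightarrow> (\<lambda>j. K j z x) summable_on {..\<nu>}"
    and "2 powi \<nu> * infnorm x \<le> 1 \<Longrightarrow> norm (infsum (\<lambda>j. K j z x) {..\<nu>}) \<le> 4 * (C3 * 2 ^ (CARD('n) + 1) * weight (2 powi \<nu>) x)"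
    and "2 powi \<nu> * infnorm x \<ge> 1 \<Longrightarrow> (\<lambda>j. K j z x) summable_on {\<nu><..}"
    and "2 powi \<nu> * infnorm x \<ge> 1 \<Longrightarrow> norm (infsum (\<lambda>j. K j z x) {\<nu><..}) \<le> 4 * (C3 * 2 ^ (CARD('n) + 1) * weight (2 powi \<nu>) x)"
proof -
  have B: "0 \<le> C3 * 2 ^ (CARD('n) + 1) * weight (2 powi \<nu>) x" using C_nonneg by (simp add: weight_nonneg)
  show "(\<lambda>j. K j z x) summable_on {..\<nu>}" if "2 powi \<nu> * infnorm x \<le> 1"
    by (rule abs_summable_summable, rule half_powers_summation(1)[OF B], rule K_off_scale[OF _ K_bound]) (use that in auto)
  show "norm (infsum (\<lambda>j. K j z x) {..\<nu>}) \<le> 4 * (C3 * 2 ^ (CARD('n) + 1) * weight (2 powi \<nu>) x)" if "2 powi \<nu> * infnorm x \<le> 1"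
    by (rule half_powers_summation(2)[OF B], rule K_off_scale[OF _ K_bound]) (use that in auto)
  show "(\<lambda>j. K j z x) summable_on {\<nu><..}" if "2 powi \<nu> * infnorm x \<ge> 1"
    by (rule abs_summable_summable, rule half_powers_summation(1)[OF B], rule K_off_scale[OF _ K_bound]) (use that in auto)
  show "norm (infsum (\<lambda>j. K j z x) {\<nu><..}) \<le> 4 * (C3 * 2 ^ (CARD('n) + 1) * weight (2 powi \<nu>) x)" if "2 powi \<nu> * infnorm x \<ge> 1"
    by (rule half_powers_summation(2)[OF B], rule K_off_scale[OF _ K_bound]) (use that in auto)
qed

lemma sum_off_scale:
  fixes x :: "real^'n"
  assumes "finite F" and k: "\<And>j. j \<in> F \<Longrightarrow> norm (k j :: complex) \<le> C3 * dyadic_weight j x"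
    and "\<And>j. j \<in> F \<Longrightarrow> j \<le> \<nu> \<and> 2 powi \<nu> * infnorm x \<le> 1 \<or> \<nu> \<le> j \<and> 2 powi \<nu> * infnorm x \<ge> 1"
  shows "norm (\<Sum>j\<in>F. k j) \<le> 4 * (C3 * 2 ^ (CARD('n) + 1) * weight (2 powi \<nu>) x)"
proof -
  have B: "0 \<le> C3 * 2 ^ (CARD('n) + 1) * weight (2 powi \<nu>) x" using C_nonneg by (simp add: weight_nonneg)
  have "norm (infsum k F) \<le> 4 * (C3 * 2 ^ (CARD('n) + 1) * weight (2 powi \<nu>) x)"
    by (rule half_powers_summation(2)[OF B], rule K_off_scale) (use assms in auto)
  then show ?thesis using assms(1) by simp
qed

text \<open>In the inner cube and outside the outer one the pieces alone are small. In between one pays for the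
  modulation, for moving \<open>y\<close> to \<open>z\<close>, and for the scales of the full kernel outside \<open>(I, J]\<close>.\<close>

lemma kernel_comparison:
  fixes y z w \<theta> :: "real^'n"
  assumes IJ: "I \<le> J" and yz: "infnorm (y - z) \<le> 1 / 2 powi J" and \<theta>: "infnorm \<theta> \<le> 2 powi I"
  defines "x \<equiv> z - w"
  shows "norm ((\<Sum>j\<in>{I<..J}. e2pi (\<theta> \<bullet> x) * K j y (y - w)) -
      (if 1 / 2 powi J < infnorm x \<and> infnorm x \<le> 1 / 2 powi I then infsum (\<lambda>j. K j z x) UNIV else 0)) \<le>
    C4 * (weight (2 powi J) x + weight (2 powi I) x +
      (\<Sum>j\<in>{I<..J}. ((1 / 2) ^ nat \<bar>j - J\<bar> + (1 / 2) ^ nat \<bar>j - I\<bar>) * weight (2 powi j) x))"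
proof -
  define c where "c j = (1 / 2 :: real) ^ nat \<bar>j - J\<bar> + (1 / 2) ^ nat \<bar>j - I\<bar>" for j
  define S where "S = (\<Sum>j\<in>{I<..J}. c j * weight (2 powi j) x)"
  define B where "B = C3 * 2 ^ (CARD('n) + 1)"
  let ?WR = "weight (2 powi J) x" and ?Wr = "weight (2 powi I) x"
  note C = C_nonneg
  have W: "weight (2 powi j) x \<ge> 0" for j by (simp add: weight_nonneg)
  have S0: "S \<ge> 0" unfolding S_def c_def by (intro sum_nonneg mult_nonneg_nonneg W) auto
  have C4b: "2 * pi * CARD('n) * C3 + C2 \<le> C4" using C by (simp add: C4_def)
  have B4: "4 * B \<le> C4" using C by (simp add: B_def C4_def)
  have C4le: "4 * B * t \<le> C4 * (?WR + ?Wr + S)" if "t \<le> ?WR + ?Wr + S" "t \<ge> 0" for t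
  proof -
    have "4 * B * t \<le> C4 * t" by (rule mult_right_mono[OF B4 that(2)])
    also have "\<dots> \<le> C4 * (?WR + ?Wr + S)" by (rule mult_left_mono[OF that(1) C(4)])
    finally show ?thesis .
  qed
  \<comment> \<open>The displacement of y from z is at most 2^-J, hence below the wavelength of
    every piece of index j \<le> J.\<close>
  have rJ: "1 / 2 powi J * 2 powi j \<le> (1::real)" if "j \<le> J" for j
    using power_int_increasing[OF that, of "2::real"] by simp
  have Ky: "norm (K j y (y - w)) \<le> C3 * dyadic_weight j x" if "j \<le> J" for j
    using piece_shift_bound[OF cutoff_\<psi> _ yz rJ[OF that], of w] by (simp add: x_def dyadic_weight_def)
  have eKy: "norm (e2pi (\<theta> \<bullet> x) * K j y (y - w)) \<le> C3 * dyadic_weight j x" if "j \<le> J" for j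
    using Ky[OF that] by (simp add: norm_mult)
  consider (a) "infnorm x \<le> 1 / 2 powi J" | (c) "infnorm x > 1 / 2 powi I"
    | (b) "1 / 2 powi J < infnorm x" "infnorm x \<le> 1 / 2 powi I" by linarith
  then show ?thesis
    unfolding c_def[symmetric] S_def[symmetric]
  proof cases
    case a
    have "norm (\<Sum>j\<in>{I<..J}. e2pi (\<theta> \<bullet> x) * K j y (y - w)) \<le> 4 * (B * ?WR)"
      unfolding B_def by (rule sum_off_scale) (use eKy a in \<open>auto simp: field_simps\<close>)
    then show "norm ((\<Sum>j\<in>{I<..J}. e2pi (\<theta> \<bullet> x) * K j y (y - w)) -
      (if 1 / 2 powi J < infnorm x \<and> infnorm x \<le> 1 / 2 powi I then infsum (\<lambda>j. K j z x) UNIV else 0)) \<le> C4 * (?WR + ?Wr + S)"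
      using a C4le[of ?WR] W S0 by auto
  next
    case c
    have "norm (\<Sum>j\<in>{I<..J}. e2pi (\<theta> \<bullet> x) * K j y (y - w)) \<le> 4 * (B * ?Wr)"
      unfolding B_def by (rule sum_off_scale) (use eKy c in \<open>auto simp: field_simps\<close>)
    then show "norm ((\<Sum>j\<in>{I<..J}. e2pi (\<theta> \<bullet> x) * K j y (y - w)) -
      (if 1 / 2 powi J < infnorm x \<and> infnorm x \<le> 1 / 2 powi I then infsum (\<lambda>j. K j z x) UNIV else 0)) \<le> C4 * (?WR + ?Wr + S)"
      using c C4le[of ?Wr] W S0 by auto
  next
    case b
    have low: "2 powi I * infnorm x \<le> 1" and high: "2 powi J * infnorm x \<ge> 1"
      using b by (simp_all add: field_simps)
    have split: "infsum (\<lambda>j. K j z x) UNIV =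
        infsum (\<lambda>j. K j z x) {..I} + (\<Sum>j\<in>{I<..J}. K j z x) + infsum (\<lambda>j. K j z x) {J<..}"
    proof -
      have U: "UNIV = ({..I} \<union> {I<..J}) \<union> {J<..}" using IJ by auto
      have s: "(\<lambda>j. K j z x) summable_on {I<..J}" by (rule summable_on_finite) simp
      have "infsum (\<lambda>j. K j z x) UNIV = infsum (\<lambda>j. K j z x) ({..I} \<union> {I<..J}) + infsum (\<lambda>j. K j z x) {J<..}"
        unfolding U by (rule infsum_Un_disjoint) (use IJ in \<open>auto intro!: summable_on_Un_disjoint K_tails s low high\<close>)
      also have "infsum (\<lambda>j. K j z x) ({..I} \<union> {I<..J}) = infsum (\<lambda>j. K j z x) {..I} + infsum (\<lambda>j. K j z x) {I<..J}"
        by (rule infsum_Un_disjoint) (auto intro!: K_tails s low)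
      finally show ?thesis by simp
    qed
    have diff_le: "norm (e2pi (\<theta> \<bullet> x) * K j y (y - w) - K j z x) \<le>
        (2 * pi * CARD('n) * C3 + C2) * (c j * weight (2 powi j) x)" if j: "j \<in> {I<..J}" for j
    proof -
      let ?D = "dyadic_weight j x" and ?W = "weight (2 powi j) x"
      have D0: "?D \<ge> 0" by (simp add: dyadic_weight_def infnorm_pos_le)
      have h1: "(2::real) powi I / 2 powi j = (1 / 2) ^ nat \<bar>j - I\<bar>"
        using two_powi_le[of I j] j by (simp add: abs_minus_commute)
      have h2: "(2::real) powi j / 2 powi J = (1 / 2) ^ nat \<bar>j - J\<bar>"
        using two_powi_le[of j J] j by simp
      \<comment> \<open>The modulation error 2^I |x| equals 2^(I-j) times 2^j |x|: the first factor
        is the geometric gain, the second is absorbed by the spare power of decay.\<close>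
      have p1: "norm ((e2pi (\<theta> \<bullet> x) - 1) * K j y (y - w)) \<le> (2 * pi * CARD('n) * C3) * ((1 / 2) ^ nat \<bar>j - I\<bar> * ?W)"
      proof -
        have "\<bar>\<theta> \<bullet> x\<bar> \<le> CARD('n) * infnorm \<theta> * infnorm x" by (rule abs_inner_le_infnorm)
        also have "\<dots> \<le> CARD('n) * 2 powi I * infnorm x"
          by (intro mult_right_mono mult_left_mono \<theta>) (auto simp: infnorm_pos_le)
        finally have "norm (e2pi (\<theta> \<bullet> x) - 1) \<le> 2 * pi * (CARD('n) * 2 powi I * infnorm x)"
          using norm_e2pi_diff_1_le[of "\<theta> \<bullet> x"] by (auto intro: order.trans)
        then have "norm ((e2pi (\<theta> \<bullet> x) - 1) * K j y (y - w)) \<le>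
            (2 * pi * (CARD('n) * 2 powi I * infnorm x)) * (C3 * ?D)"
          unfolding norm_mult using Ky[of j] j by (intro mult_mono) (auto simp: infnorm_pos_le)
        also have "\<dots> = (2 * pi * CARD('n) * C3) * ((2 powi I / 2 powi j) * ((2 powi j * infnorm x) * ?D))"
          by (simp add: field_simps)
        also have "\<dots> \<le> (2 * pi * CARD('n) * C3) * ((2 powi I / 2 powi j) * ?W)"
          using C by (intro mult_left_mono dyadic_weight_le_weight) auto
        finally show ?thesis unfolding h1 .
      qed
      \<comment> \<open>The move of the base point gains displacement times frequency,
        2^(j-J).\<close>
      have p2: "norm (K j y (y - w) - K j z x) \<le> C2 * ((1 / 2) ^ nat \<bar>j - J\<bar> * ?W)"
      proof -
        have "norm (K j y (y - w) - K j z x) \<le> C2 * ((1 / 2 powi J * 2 powi j) * ?D)"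
          using piece_increment_bound[OF cutoff_\<psi> _ yz rJ[of j], of w] j
          by (simp add: C2_def x_def dyadic_weight_def mult_ac)
        also have "\<dots> \<le> C2 * ((1 / 2 powi J * 2 powi j) * ?W)"
          using C by (intro mult_left_mono dyadic_weight_le_weight) auto
        finally show ?thesis using h2 by simp
      qed
      have eq: "e2pi (\<theta> \<bullet> x) * K j y (y - w) - K j z x =
          (e2pi (\<theta> \<bullet> x) - 1) * K j y (y - w) + (K j y (y - w) - K j z x)" by (simp add: algebra_simps)
      have "norm (e2pi (\<theta> \<bullet> x) * K j y (y - w) - K j z x) \<le>
          (2 * pi * CARD('n) * C3) * ((1 / 2) ^ nat \<bar>j - I\<bar> * ?W) + C2 * ((1 / 2) ^ nat \<bar>j - J\<bar> * ?W)"
        unfolding eq by (rule norm_triangle_le[OF add_mono[OF p1 p2]])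
      also have "\<dots> \<le> (2 * pi * CARD('n) * C3) * (c j * ?W) + C2 * (c j * ?W)"
        using C W by (intro add_mono mult_left_mono mult_right_mono) (auto simp: c_def)
      finally show ?thesis by (simp add: distrib_right)
    qed
    have "norm (\<Sum>j\<in>{I<..J}. e2pi (\<theta> \<bullet> x) * K j y (y - w) - K j z x) \<le>
        (\<Sum>j\<in>{I<..J}. (2 * pi * CARD('n) * C3 + C2) * (c j * weight (2 powi j) x))"
      by (rule order.trans[OF norm_sum sum_mono[OF diff_le]])
    also have "\<dots> = (2 * pi * CARD('n) * C3 + C2) * S" by (simp add: S_def sum_distrib_left)
    finally have mid: "norm (\<Sum>j\<in>{I<..J}. e2pi (\<theta> \<bullet> x) * K j y (y - w) - K j z x) \<le> (2 * pi * CARD('n) * C3 + C2) * S" .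
    have lo: "norm (infsum (\<lambda>j. K j z x) {..I}) \<le> 4 * B * ?Wr" using K_tails(2)[OF low, of z] by (simp add: B_def mult_ac)
    have hi: "norm (infsum (\<lambda>j. K j z x) {J<..}) \<le> 4 * B * ?WR" using K_tails(4)[OF high, of z] by (simp add: B_def mult_ac)
    have eq: "(\<Sum>j\<in>{I<..J}. e2pi (\<theta> \<bullet> x) * K j y (y - w)) - infsum (\<lambda>j. K j z x) UNIV =
        (\<Sum>j\<in>{I<..J}. e2pi (\<theta> \<bullet> x) * K j y (y - w) - K j z x) - infsum (\<lambda>j. K j z x) {..I} - infsum (\<lambda>j. K j z x) {J<..}"
      unfolding split by (simp add: sum_subtractf)
    have three: "norm (p - q - r) \<le> a + b + c" if "norm p \<le> a" "norm q \<le> b" "norm r \<le> c" for p q r :: complex and a b c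
      using order.trans[OF norm_triangle_ineq4 add_right_mono[OF norm_triangle_ineq4], of p q r] that by linarith
    have "norm ((\<Sum>j\<in>{I<..J}. e2pi (\<theta> \<bullet> x) * K j y (y - w)) - infsum (\<lambda>j. K j z x) UNIV) \<le>
        (2 * pi * CARD('n) * C3 + C2) * S + 4 * B * ?Wr + 4 * B * ?WR"
      unfolding eq by (rule three[OF mid lo hi])
    moreover have "(2 * pi * CARD('n) * C3 + C2) * S + 4 * B * ?Wr + 4 * B * ?WR \<le> C4 * S + C4 * ?Wr + C4 * ?WR"
      by (intro add_mono mult_right_mono B4 C4b W S0)
    moreover have "C4 * S + C4 * ?Wr + C4 * ?WR = C4 * (?WR + ?Wr + S)" by (simp add: distrib_left)
    ultimately have "norm ((\<Sum>j\<in>{I<..J}. e2pi (\<theta> \<bullet> x) * K j y (y - w)) - infsum (\<lambda>j. K j z x) UNIV) \<le> C4 * (?WR + ?Wr + S)"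
      by linarith
    then show "norm ((\<Sum>j\<in>{I<..J}. e2pi (\<theta> \<bullet> x) * K j y (y - w)) -
      (if 1 / 2 powi J < infnorm x \<and> infnorm x \<le> 1 / 2 powi I then infsum (\<lambda>j. K j z x) UNIV else 0)) \<le> C4 * (?WR + ?Wr + S)"
      by (simp only: b simp_thms if_True)
  qed
qed

lemma kernel_eq_infsum: "kernel \<Phi> a x z = infsum (\<lambda>j. K j x z) UNIV"
proof -
  have "(LINT \<xi>|lebesgue. a x \<xi> * of_real (Psi \<Phi> ((2 powi (- j)) *\<^sub>R \<xi>)) * cis (2 * pi * (\<xi> \<bullet> z))) = K j x z" for j
  proof -
    have m: "(\<lambda>\<xi>. a x \<xi> * \<psi> ((1 / 2 powi j) *\<^sub>R \<xi>)) \<in> borel_measurable borel"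
      by (rule localized_integrable(2)[OF cutoff_\<psi>]) simp
    have "(LINT \<xi>|lebesgue. a x \<xi> * \<psi> ((1 / 2 powi j) *\<^sub>R \<xi>) * e2pi (\<xi> \<bullet> z)) = K j x z"
      unfolding piece_def by (rule integral_completion) (use m in measurable)
    then show ?thesis by (simp add: \<psi>_def e2pi_def power_int_minus inverse_eq_divide)
  qed
  then show ?thesis by (simp add: kernel_def)
qed

section \<open>Pointwise size and truncations of the singular kernel\<close>

lemma ex_dyadic_scale:
  fixes t :: real
  assumes "t > 0"
  obtains \<nu> :: int where "2 powi \<nu> * t \<le> 1" "2 powi (\<nu> + 1) * t \<ge> 1"
proof -
  define \<nu> where "\<nu> = \<lfloor>log 2 (1 / t)\<rfloor>"
  have "2 powr real_of_int \<nu> \<le> 1 / t" "1 / t \<le> 2 powr real_of_int (\<nu> + 1)"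
    using assms by (simp_all add: le_log_iff[symmetric] log_le_iff[symmetric] \<nu>_def)
  moreover have "2 powr real_of_int k = 2 powi k" for k by (simp add: powr_real_of_int')
  ultimately show ?thesis
    using assms by (intro that[of \<nu>]) (simp_all only: pos_le_divide_eq pos_divide_le_eq)
qed

lemma weight_le_infnorm_power:
  fixes x :: "real^'n"
  assumes "infnorm x > 0" "l > 0"
  shows "weight l x \<le> 1 / infnorm x ^ CARD('n)"
proof -
  have t: "l * infnorm x > 0" using assms by simp
  have "(l * infnorm x) ^ CARD('n) * 1 \<le> (1 + l * infnorm x) ^ CARD('n) * (1 + l * infnorm x)"
    using t by (intro mult_mono power_mono) auto
  then have "(l * infnorm x) ^ CARD('n) \<le> (1 + l * infnorm x) ^ (CARD('n) + 1)" by (simp add: mult.commute)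
  moreover have "(1 + l * infnorm x) ^ (CARD('n) + 1) > 0" using t by (intro zero_less_power) linarith
  ultimately show ?thesis
    using assms by (simp add: weight_def power_mult_distrib divide_le_eq pos_le_divide_eq mult.commute)
qed

text \<open>Splitting the scales at 2^\<nu> about 1/|x| leaves two geometric tails, each of the
  standard Calderon-Zygmund size |x|^-n.\<close>

lemma kernel_summable_bound:
  assumes "x \<noteq> 0"
  shows "(\<lambda>j. K j z x) summable_on UNIV"
    and "norm (infsum (\<lambda>j. K j z x) UNIV) \<le> 8 * (C3 * 2 ^ (CARD('n) + 1)) / infnorm x ^ CARD('n)"
proof -
  define B where "B = C3 * 2 ^ (CARD('n) + 1)"
  have B: "B \<ge> 0" using C_nonneg by (simp add: B_def)
  have x0: "infnorm x > 0" using assms by (simp add: infnorm_pos_lt)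
  then obtain \<nu> where \<nu>: "2 powi \<nu> * infnorm x \<le> 1" "2 powi (\<nu> + 1) * infnorm x \<ge> 1"
    by (rule ex_dyadic_scale)
  have s1: "(\<lambda>j. K j z x) summable_on {..\<nu>}" by (rule K_tails(1)[OF \<nu>(1)])
  \<comment> \<open>Only at \<nu> + 1 is 2^(\<nu>+1) |x| \<ge> 1 known, and that index belongs to
    the tail, whereas the upper half of \<open>K_tails\<close> omits its base index; hence the
    direct use of \<open>K_off_scale\<close>.\<close>
  have s2: "(\<lambda>j. K j z x) summable_on {\<nu> + 1..}"
    and n2: "norm (infsum (\<lambda>j. K j z x) {\<nu> + 1..}) \<le> 4 * (B * weight (2 powi (\<nu> + 1)) x)"
  proof -
    have W: "0 \<le> B * weight (2 powi (\<nu> + 1)) x" using B by (simp add: weight_nonneg)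
    show "(\<lambda>j. K j z x) summable_on {\<nu> + 1..}"
      by (rule abs_summable_summable, rule half_powers_summation(1)[OF W], unfold B_def, rule K_off_scale[OF _ K_bound]) (use \<nu> in auto)
    show "norm (infsum (\<lambda>j. K j z x) {\<nu> + 1..}) \<le> 4 * (B * weight (2 powi (\<nu> + 1)) x)"
      by (rule half_powers_summation(2)[OF W], unfold B_def, rule K_off_scale[OF _ K_bound]) (use \<nu> in auto)
  qed
  have U: "UNIV = {..\<nu>} \<union> {\<nu> + 1..}" by auto
  show "(\<lambda>j. K j z x) summable_on UNIV" unfolding U by (rule summable_on_Un_disjoint[OF s1 s2]) auto
  have "infsum (\<lambda>j. K j z x) UNIV = infsum (\<lambda>j. K j z x) {..\<nu>} + infsum (\<lambda>j. K j z x) {\<nu> + 1..}"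
    unfolding U by (rule infsum_Un_disjoint[OF s1 s2]) auto
  also have "norm \<dots> \<le> 4 * (B * weight (2 powi \<nu>) x) + 4 * (B * weight (2 powi (\<nu> + 1)) x)"
    using K_tails(2)[OF \<nu>(1), of z] n2 by (intro norm_triangle_mono) (auto simp: B_def)
  also have "\<dots> \<le> 4 * (B * (1 / infnorm x ^ CARD('n))) + 4 * (B * (1 / infnorm x ^ CARD('n)))"
    using B x0 by (intro add_mono mult_left_mono weight_le_infnorm_power) auto
  finally show "norm (infsum (\<lambda>j. K j z x) UNIV) \<le> 8 * (C3 * 2 ^ (CARD('n) + 1)) / infnorm x ^ CARD('n)"
    by (simp add: B_def)
qed

text \<open>\<open>infsum\<close> is a limit along finite sets of integers rather than along a
  sequence. The windows {-m..m} eventually contain every finite set, so the kernel is a pointwise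
  limit of measurable partial sums.\<close>

lemma truncated_kernel_measurable:
  assumes "\<epsilon> \<ge> 0"
  shows "trunc_kernel z \<epsilon> \<in> borel_measurable borel"
proof (rule borel_measurable_LIMSEQ_metric)
  have [measurable]: "K j z \<in> borel_measurable borel" for j by (rule piece_measurable[OF cutoff_\<psi>]) simp
  show "(\<lambda>w. indicator (- cube z \<epsilon>) w *\<^sub>R (\<Sum>j\<in>{- int m..int m}. K j z (z - w))) \<in> borel_measurable borel" for m
    by measurable
  fix w
  have lim: "filterlim (\<lambda>m. {- int m..int m}) (finite_subsets_at_top UNIV) sequentially"
    unfolding filterlim_finite_subsets_at_top
  proof (intro allI impI)
    fix X :: "int set" assume "finite X \<and> X \<subseteq> UNIV"
    then have "finite ((\<lambda>j. nat \<bar>j\<bar>) ` X)" by simp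
    then obtain m0 where m0: "\<And>j. j \<in> X \<Longrightarrow> nat \<bar>j\<bar> \<le> m0"
      using finite_nat_set_iff_bounded_le by auto
    show "\<forall>\<^sub>F m in sequentially. finite {- int m..int m} \<and> X \<subseteq> {- int m..int m} \<and> {- int m..int m} \<subseteq> UNIV"
      using eventually_ge_at_top[of m0]
    proof eventually_elim
      case (elim m)
      then have "\<bar>j\<bar> \<le> int m" if "j \<in> X" for j using m0[OF that] by linarith
      then show ?case by (auto simp: abs_le_iff) (smt (verit))+
    qed
  qed
  show "(\<lambda>m. indicator (- cube z \<epsilon>) w *\<^sub>R (\<Sum>j\<in>{- int m..int m}. K j z (z - w))) \<longlonglongrightarrow>
      trunc_kernel z \<epsilon> w"
  proof (cases "w \<in> cube z \<epsilon>")
    case False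
    then have "z - w \<noteq> 0" using assms by (auto simp: mem_cube infnorm_0)
    from has_sum_infsum[OF kernel_summable_bound(1)[OF this, of z]]
    have "((\<lambda>F. \<Sum>j\<in>F. K j z (z - w)) \<longlongrightarrow> infsum (\<lambda>j. K j z (z - w)) UNIV) (finite_subsets_at_top UNIV)"
      by (simp add: has_sum_def)
    from filterlim_compose[OF this lim] show ?thesis by (intro tendsto_scaleR tendsto_const)
  qed simp
qed

text \<open>Off the cube |x|^-2n is dominated by a multiple of the weight at scale 1/\<epsilon>,
  because 2 n \<ge> n + 1 and there 1 + |x|/\<epsilon> is at most 2 |x|/\<epsilon>.\<close>

lemma truncated_kernel_L2:
  assumes "\<epsilon> > 0"
  shows "sq_int lborel (trunc_kernel z \<epsilon>) < \<infinity>"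
proof -
  define A where "A = 8 * (C3 * 2 ^ (CARD('n) + 1))"
  define D where "D = A\<^sup>2 * (2 ^ (CARD('n) + 1) * (1 / \<epsilon>) ^ CARD('n))"
  have A: "A \<ge> 0" using C_nonneg by (simp add: A_def)
  have D: "D \<ge> 0" using assms by (simp add: D_def)
  have "sq_int lborel (trunc_kernel z \<epsilon>) \<le>
      (\<integral>\<^sup>+w. ennreal D * ennreal (weight (1 / \<epsilon>) (z - w)) \<partial>lborel)"
  proof (rule nn_integral_mono)
    fix w
    show "ennreal ((norm (trunc_kernel z \<epsilon> w))\<^sup>2) \<le>
      ennreal D * ennreal (weight (1 / \<epsilon>) (z - w))"
    proof (cases "w \<in> cube z \<epsilon>")
      case False
      define s where "s = infnorm (z - w)"
      have s: "s > \<epsilon>" using False by (simp add: s_def mem_cube)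
      define t where "t = s / \<epsilon>"
      have t: "t > 1" "s = \<epsilon> * t" using s assms by (simp_all add: t_def)
      define e where "e = (1 / \<epsilon>) ^ CARD('n)"
      define p where "p = t ^ (2 * CARD('n))"
      define q where "q = (1 + t) ^ (CARD('n) + 1)"
      define c where "c = (2::real) ^ (CARD('n) + 1)"
      have p: "p > 0" and q: "q > 0" unfolding p_def q_def using t by (auto intro: zero_less_power)
      have "z - w \<noteq> 0" using s assms by (auto simp: s_def infnorm_0)
      from kernel_summable_bound(2)[OF this, of z]
      have "norm (infsum (\<lambda>j. K j z (z - w)) UNIV) \<le> A / s ^ CARD('n)" by (simp add: A_def s_def)
      then have "(norm (infsum (\<lambda>j. K j z (z - w)) UNIV))\<^sup>2 \<le> (A / s ^ CARD('n))\<^sup>2" by (intro power_mono) auto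
      also have "\<dots> = A\<^sup>2 * (e * (e * (1 / p)))"
      proof -
        have "s ^ CARD('n) = \<epsilon> ^ CARD('n) * t ^ CARD('n)" unfolding t(2) by (rule power_mult_distrib)
        moreover have "e = 1 / \<epsilon> ^ CARD('n)" unfolding e_def by (rule power_one_over)
        moreover have "p = t ^ CARD('n) * t ^ CARD('n)" unfolding p_def mult_2 by (rule power_add)
        ultimately show ?thesis by (simp add: power2_eq_square)
      qed
      also have "\<dots> \<le> A\<^sup>2 * (e * (e * (c / q)))"
      proof (intro mult_left_mono)
        have "q \<le> (2 * t) ^ (CARD('n) + 1)" unfolding q_def using t by (intro power_mono) auto
        also have "\<dots> = c * t ^ (CARD('n) + 1)" unfolding c_def by (rule power_mult_distrib)
        also have "\<dots> \<le> c * p"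
        proof (rule mult_left_mono)
          have "CARD('n) + 1 \<le> 2 * CARD('n)" using zero_less_card_finite[where 'a='n] by linarith
          then show "t ^ (CARD('n) + 1) \<le> p" unfolding p_def using t by (intro power_increasing) auto
        qed (simp add: c_def)
        finally show "1 / p \<le> c / q" using p q by (simp add: field_simps)
      qed (use assms in \<open>auto simp: e_def\<close>)
      also have "\<dots> = D * weight (1 / \<epsilon>) (z - w)"
      proof -
        have "weight (1 / \<epsilon>) (z - w) = e / q"
          unfolding weight_def s_def[symmetric] e_def q_def t_def by simp
        then show ?thesis by (simp only: D_def e_def[symmetric] c_def[symmetric]) (simp add: mult_ac)
      qed
      finally have "ennreal ((norm (infsum (\<lambda>j. K j z (z - w)) UNIV))\<^sup>2) \<le> ennreal (D * weight (1 / \<epsilon>) (z - w))"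
        by (rule ennreal_leI)
      then show ?thesis using False D assms by (simp add: ennreal_mult weight_nonneg)
    qed simp
  qed
  also have "\<dots> = ennreal D * (\<integral>\<^sup>+w. ennreal (weight (1 / \<epsilon>) (z - w)) \<partial>lborel)"
    by (rule nn_integral_cmult) measurable
  also have "\<dots> < \<infinity>"
    using weight_nn_integral[of "1 / \<epsilon>" z] assms by (auto simp: ennreal_mult_less_top intro: le_less_trans)
  finally show ?thesis .
qed

end

section \<open>Comparison of the tile operators\<close>

lemma power_le_weight:
  fixes x :: "real^'n::finite"
  assumes "l > 0"
  shows "l ^ CARD('n) / (1 + l * infnorm x) ^ (CARD('n) + 2) \<le> weight l x"
  unfolding weight_def
proof (rule divide_left_mono)
  have t: "1 \<le> 1 + l * infnorm x" using assms by (simp add: infnorm_pos_le)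
  then show "(1 + l * infnorm x) ^ (CARD('n) + 1) \<le> (1 + l * infnorm x) ^ (CARD('n) + 2)"
    by (intro power_increasing) auto
  show "0 < (1 + l * infnorm x) ^ (CARD('n) + 2) * (1 + l * infnorm x) ^ (CARD('n) + 1)"
    using t by (intro mult_pos_pos zero_less_power) linarith+
qed (use assms in simp)

lemma (in symbol) symbol_measurable: "a x \<in> borel_measurable borel"
proof -
  have "(\<lambda>\<xi>. indicator (- {0}) \<xi> *\<^sub>R a x \<xi>) \<in> borel_measurable borel"
    by (rule borel_measurable_continuous_on_indicator[OF _ cont]) auto
  then have "(\<lambda>\<xi>. indicator (- {0}) \<xi> *\<^sub>R a x \<xi> + indicator {0} \<xi> *\<^sub>R a x 0) \<in> borel_measurable borel"
    by measurable
  moreover have "(\<lambda>\<xi>. indicator (- {0}) \<xi> *\<^sub>R a x \<xi> + indicator {0} \<xi> *\<^sub>R a x 0) = a x"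
    by (auto simp: fun_eq_iff indicator_def)
  ultimately show ?thesis by simp
qed

text \<open>If the inner cube had side s > t, it would contain its lower corner and that corner
  shifted by t in every coordinate; a half-open cube of side t contains no two such points.\<close>

lemma dyadic_cube_subset_scale:
  fixes m m' :: "int^'n::finite"
  assumes "dyadic_cube \<nu> m \<subseteq> dyadic_cube \<mu> m'"
  shows "dyadic_side \<nu> \<le> dyadic_side \<mu>"
proof (rule ccontr)
  assume *: "\<not> dyadic_side \<nu> \<le> dyadic_side \<mu>"
  define s where "s = dyadic_side \<nu>"
  define t where "t = dyadic_side \<mu>"
  have st: "t < s" "t > 0" using * by (auto simp: s_def t_def dyadic_side_def)
  define p :: "real^'n" where "p = (\<chi> j. s * of_int (m $ j))"
  define q :: "real^'n" where "q = (\<chi> j. s * of_int (m $ j) + t)"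
  have "p \<in> dyadic_cube \<nu> m" "q \<in> dyadic_cube \<nu> m"
    using st by (auto simp: dyadic_cube_def p_def q_def s_def[unfolded dyadic_side_def, symmetric] algebra_simps)
  then have "p \<in> dyadic_cube \<mu> m'" "q \<in> dyadic_cube \<mu> m'" using assms by auto
  then have "t * of_int (m' $ j) \<le> s * of_int (m $ j)" "s * of_int (m $ j) + t < t * (of_int (m' $ j) + 1)" for j
    by (auto simp: dyadic_cube_def p_def q_def t_def[unfolded dyadic_side_def, symmetric])
  then show False by (simp add: algebra_simps) (meson not_less)
qed

lemma dyadic_cube_center:
  fixes m :: "int^'n::finite"
  assumes "x \<in> dyadic_cube \<nu> m"
  shows "infnorm (x - dyadic_center \<nu> m) \<le> dyadic_side \<nu> / 2"
proof -
  obtain j where "infnorm (x - dyadic_center \<nu> m) = \<bar>(x - dyadic_center \<nu> m) $ j\<bar>" by (rule infnorm_attained)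
  moreover have "\<bar>(x - dyadic_center \<nu> m) $ j\<bar> \<le> dyadic_side \<nu> / 2"
  proof -
    define s where "s = dyadic_side \<nu>"
    have "s * of_int (m $ j) \<le> x $ j" "x $ j < s * (of_int (m $ j) + 1)"
      using assms by (auto simp: dyadic_cube_def s_def dyadic_side_def)
    then have "x $ j - s * (of_int (m $ j) + 1 / 2) \<le> s / 2" "- (x $ j - s * (of_int (m $ j) + 1 / 2)) \<le> s / 2"
      by (simp_all add: distrib_left)
    then have "\<bar>x $ j - s * (of_int (m $ j) + 1 / 2)\<bar> \<le> s / 2" by (rule abs_leI)
    then show ?thesis by (simp add: dyadic_center_def s_def dyadic_side_def)
  qed
  ultimately show ?thesis by simp
qed

lemma dyadic_cube_diameter:
  fixes m :: "int^'n::finite"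
  assumes "x \<in> dyadic_cube \<nu> m" "y \<in> dyadic_cube \<nu> m"
  shows "infnorm (x - y) \<le> dyadic_side \<nu>"
proof -
  have "infnorm (x - y) \<le> infnorm (x - dyadic_center \<nu> m) + infnorm (dyadic_center \<nu> m - y)"
    using infnorm_triangle[of "x - dyadic_center \<nu> m" "dyadic_center \<nu> m - y"] by simp
  with dyadic_cube_center[OF assms(1)] dyadic_cube_center[OF assms(2)] show ?thesis
    by (simp add: infnorm_sub[of "dyadic_center \<nu> m"])
qed

text \<open>The cube \<omega>(s) has index \<open>- scale s\<close> and therefore side
  2^(\<open>scale s\<close>), so inclusion of frequency cubes orders the scales; the rest is
  distance to the centre and diameter.\<close>

lemma tile_geometry:
  fixes u v :: "'n::finite tile"
  assumes "tile_le u v" and "\<eta>0 \<in> tile_\<omega> v" "\<eta>1 \<in> tile_\<omega> v"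
  shows "scale v \<le> scale u"
    and "infnorm (\<eta>0 - center_\<omega> v) \<le> 2 powi scale v / 2"
    and "infnorm (\<eta>0 - center_\<omega> u) \<le> 2 powi scale u / 2"
    and "infnorm (\<eta>0 - \<eta>1) \<le> 2 powi scale v"
proof -
  have sub: "tile_\<omega> v \<subseteq> tile_\<omega> u" using assms(1) by (simp add: tile_le_def)
  then have "(2::real) powi scale v \<le> 2 powi scale u"
    using dyadic_cube_subset_scale[of "- scale v" "freq v" "- scale u" "freq u"]
    by (simp add: tile_\<omega>_def dyadic_side_def)
  then show "scale v \<le> scale u"
    using power_int_strict_increasing[of "scale u" "scale v" "2::real"] by force
  show "infnorm (\<eta>0 - center_\<omega> v) \<le> 2 powi scale v / 2"
    using dyadic_cube_center[of \<eta>0 "- scale v" "freq v"] assms by (simp add: tile_\<omega>_def center_\<omega>_def dyadic_side_def)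
  show "infnorm (\<eta>0 - center_\<omega> u) \<le> 2 powi scale u / 2"
    using dyadic_cube_center[of \<eta>0 "- scale u" "freq u"] assms sub by (auto simp: tile_\<omega>_def center_\<omega>_def dyadic_side_def)
  show "infnorm (\<eta>0 - \<eta>1) \<le> 2 powi scale v"
    using dyadic_cube_diameter[of \<eta>0 "- scale v" "freq v" \<eta>1] assms by (simp add: tile_\<omega>_def dyadic_side_def)
qed

context symbol_bump
begin

text \<open>Two end pieces with \<open>C3\<close>, ten units of \<open>C4\<close> from the
  comparison of kernels, and the factor 2^(n+2) of \<open>weight_maximal\<close>.\<close>

definition tile_const :: real where
  "tile_const = (2 * C3 + 10 * C4) * 2 ^ (CARD('n) + 2)"

lemma tile_const_nonneg: "tile_const \<ge> 0"
  unfolding tile_const_def using C_nonneg by (intro mult_nonneg_nonneg add_nonneg_nonneg) auto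

section \<open>Estimates for a fixed Borel function in L^2\<close>

context
  fixes f :: "real^'n \<Rightarrow> complex"
  assumes fm [measurable]: "f \<in> borel_measurable borel" and fin: "sq_int lborel f < \<infinity>"
begin

text \<open>Translating the multiplier by \<eta> multiplies its kernel by the character of frequency
  \<eta>, and \<open>multiplier_formula\<close> applies.\<close>

lemma modulated_piece:
  fixes \<eta> y :: "real^'n"
  assumes \<theta>: "cutoff X \<theta>" and l: "l > 0"
  shows "(LINT \<xi>|lebesgue. (a y (\<xi> - \<eta>) * \<theta> ((1 / l) *\<^sub>R (\<xi> - \<eta>))) * e2pi (y \<bullet> \<xi>) * fourier f \<xi>) =
      (LINT w|lborel. (e2pi (\<eta> \<bullet> (y - w)) * piece \<theta> l y (y - w)) * f w)" (is ?eq)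
    and "integrable lborel (\<lambda>w. (e2pi (\<eta> \<bullet> (y - w)) * piece \<theta> l y (y - w)) * f w)" (is ?int)
    and "integrable lebesgue (\<lambda>\<xi>. (a y (\<xi> - \<eta>) * \<theta> ((1 / l) *\<^sub>R (\<xi> - \<eta>))) * e2pi (y \<bullet> \<xi>) * fourier f \<xi>)" (is ?int')
proof -
  define g where "g \<xi> = a y \<xi> * \<theta> ((1 / l) *\<^sub>R \<xi>)" for \<xi>
  define m where "m \<xi> = g (\<xi> - \<eta>)" for \<xi>
  note loc = localized_integrable[OF \<theta> l, of y, folded g_def]
  have [measurable]: "g \<in> borel_measurable borel" using loc(2) by simp
  have mm [measurable]: "m \<in> borel_measurable borel" unfolding m_def[abs_def] by measurable
  have mb: "norm (m \<xi>) \<le> 2 ^ (CARD('n) + 2) * (M * X)" for \<xi> unfolding m_def by (rule loc(3))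
  have ms: "m \<xi> = 0" if "\<xi> \<notin> cube \<eta> (2 * l)" for \<xi>
  proof -
    have "\<xi> - \<eta> \<notin> cube 0 (2 * l)" using that infnorm_sub[of \<eta> \<xi>] by (simp add: mem_cube infnorm_neg)
    then show ?thesis unfolding m_def g_def by (rule localized_support[OF \<theta> l])
  qed
  have K: "(LINT \<xi>|lborel. m \<xi> * e2pi (\<xi> \<bullet> z)) = e2pi (\<eta> \<bullet> z) * piece \<theta> l y z" for z
  proof -
    have "(LINT \<xi>|lborel. m \<xi> * e2pi (\<xi> \<bullet> z)) = (LINT \<xi>|lborel. m (\<xi> + \<eta>) * e2pi ((\<xi> + \<eta>) \<bullet> z))"
      by (rule integral_lborel_translate[where g="\<lambda>\<xi>. m \<xi> * e2pi (\<xi> \<bullet> z)", symmetric]) measurable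
    also have "\<dots> = (LINT \<xi>|lborel. e2pi (\<eta> \<bullet> z) * (g \<xi> * e2pi (\<xi> \<bullet> z)))"
      by (simp add: m_def inner_add_left e2pi_add mult_ac)
    finally show ?thesis by (simp add: piece_def g_def)
  qed
  have Kb: "norm (LINT \<xi>|lborel. m \<xi> * e2pi (\<xi> \<bullet> z)) \<le> C3 * weight l z" for z
  proof -
    \<comment> \<open>The shift bound with displacement 0, so that the constant is the same
      \<open>C3\<close> as elsewhere.\<close>
    have "norm (piece \<theta> l y (y - (y - z))) \<le> C3 * (l ^ CARD('n) / (1 + l * infnorm (y - (y - z))) ^ (CARD('n) + 2))"
      by (rule piece_shift_bound[OF \<theta> l, of y y 0]) (auto simp: infnorm_0)
    also have "\<dots> \<le> C3 * weight l (y - (y - z))"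
      by (intro mult_left_mono power_le_weight l C_nonneg)
    finally show ?thesis by (simp add: K norm_mult)
  qed
  have l2: "0 \<le> 2 * l" using l by simp
  note F = multiplier_formula[OF fm fin mm mb ms l2 Kb l, where y=y, unfolded K]
  show ?eq using F(1) unfolding m_def g_def .
  show ?int using F(2) .
  show ?int' using fourier_mult_integrable(1)[OF fm fin mm mb ms l2, where y=y] unfolding m_def g_def .
qed

lemma modulated_piece_bound:
  fixes \<eta> y z :: "real^'n"
  assumes \<theta>: "cutoff X \<theta>" "l > 0" "infnorm (y - z) \<le> r" "r * l \<le> 1" "r > 0"
  shows "ennreal (norm (LINT w|lborel. (e2pi (\<eta> \<bullet> (y - w)) * piece \<theta> l y (y - w)) * f w)) \<le>
    ennreal (C3 * 2 ^ (CARD('n) + 2)) * maximal_ge r f z"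
proof -
  have "ennreal (norm (LINT w|lborel. (e2pi (\<eta> \<bullet> (y - w)) * piece \<theta> l y (y - w)) * f w)) \<le>
      (\<integral>\<^sup>+w. ennreal (norm ((e2pi (\<eta> \<bullet> (y - w)) * piece \<theta> l y (y - w)) * f w)) \<partial>lborel)"
    by (rule norm_integral_le_nn_integral)
  also have "\<dots> \<le> (\<integral>\<^sup>+w. ennreal C3 * (ennreal (weight l (z - w)) * ennreal (norm (f w))) \<partial>lborel)"
  proof (rule nn_integral_mono)
    fix w
    have "norm (piece \<theta> l y (y - w)) \<le> C3 * weight l (z - w)"
      using piece_shift_bound[OF \<theta>(1-4)] mult_left_mono[OF power_le_weight[OF \<theta>(2), of "z - w"] C_nonneg(3)]
      by (rule order.trans)
    then have "norm ((e2pi (\<eta> \<bullet> (y - w)) * piece \<theta> l y (y - w)) * f w) \<le> C3 * weight l (z - w) * norm (f w)"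
      unfolding norm_mult norm_e2pi mult_1_left by (rule mult_right_mono) simp
    then have "ennreal (norm ((e2pi (\<eta> \<bullet> (y - w)) * piece \<theta> l y (y - w)) * f w)) \<le> ennreal (C3 * weight l (z - w) * norm (f w))"
      by (rule ennreal_leI)
    then show "ennreal (norm ((e2pi (\<eta> \<bullet> (y - w)) * piece \<theta> l y (y - w)) * f w)) \<le>
        ennreal C3 * (ennreal (weight l (z - w)) * ennreal (norm (f w)))"
      using C_nonneg \<theta>(2) by (simp add: ennreal_mult weight_nonneg mult.assoc)
  qed
  also have "\<dots> = ennreal C3 * (\<integral>\<^sup>+w. ennreal (weight l (z - w)) * ennreal (norm (f w)) \<partial>lborel)"
    by (rule nn_integral_cmult) measurable
  also have "\<dots> \<le> ennreal C3 * (ennreal (2 ^ (CARD('n) + 2)) * maximal_ge r f z)"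
    using \<theta> by (intro mult_left_mono weight_maximal) (auto simp: mult.commute)
  finally show ?thesis using C_nonneg by (simp add: ennreal_mult mult.assoc)
qed

text \<open>Away from the cube the kernel is square integrable, so its product with f is absolutely
  integrable.\<close>

lemma kernel_op_truncated:
  fixes \<eta> z :: "real^'n"
  assumes "\<epsilon> > 0"
  defines "T w \<equiv> e2pi (\<eta> \<bullet> (z - w)) * trunc_kernel z \<epsilon> w * f w"
  shows "kernel_op \<Phi> a \<eta> (\<lambda>w. indicator (- cube z \<epsilon>) w *\<^sub>R f w) z = (LINT w|lborel. T w)"
    and "integrable lborel T"
proof -
  have tm [measurable]: "trunc_kernel z \<epsilon> \<in> borel_measurable borel"
    by (rule truncated_kernel_measurable) (use assms in simp)
  have Tm: "T \<in> borel_measurable lborel" unfolding T_def by measurable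
  have "(\<lambda>w. cis (2 * pi * (\<eta> \<bullet> (z - w))) * kernel \<Phi> a z (z - w) * (indicator (- cube z \<epsilon>) w *\<^sub>R f w)) = T"
    by (simp add: fun_eq_iff T_def kernel_eq_infsum e2pi_def)
  then show "kernel_op \<Phi> a \<eta> (\<lambda>w. indicator (- cube z \<epsilon>) w *\<^sub>R f w) z = (LINT w|lborel. T w)"
    unfolding kernel_op_def using integral_completion[OF Tm] by simp
  have m: "(\<lambda>w. e2pi (\<eta> \<bullet> (z - w)) * trunc_kernel z \<epsilon> w) \<in> borel_measurable lborel"
    by measurable
  show "integrable lborel T"
    unfolding T_def
    by (rule integrable_L2_mult[OF m _ _ fin])
       (use truncated_kernel_L2[OF assms(1), of z] in \<open>simp_all add: norm_mult\<close>)
qed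

text \<open>After the phase independent of w is taken out, the integrand is the error of
  \<open>kernel_comparison\<close> times f, and each weight in that error is controlled by the
  maximal function.\<close>

lemma truncation_comparison:
  fixes \<eta>0 \<eta>1 y z :: "real^'n"
  assumes IJ: "I \<le> J" and yz: "infnorm (y - z) \<le> 1 / 2 powi J" and \<eta>: "infnorm (\<eta>0 - \<eta>1) \<le> 2 powi I"
  defines "T \<equiv> \<lambda>\<epsilon>. kernel_op \<Phi> a \<eta>1 (\<lambda>w. indicator (- cube z \<epsilon>) w *\<^sub>R f w) z"
  shows "ennreal (norm ((\<Sum>j\<in>{I<..J}. LINT w|lborel. (e2pi (\<eta>0 \<bullet> (y - w)) * K j y (y - w)) * f w) -
      e2pi (\<eta>0 \<bullet> (y - z)) * (T (1 / 2 powi J) - T (1 / 2 powi I)))) \<le>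
    ennreal (10 * C4 * 2 ^ (CARD('n) + 2)) * maximal_ge (1 / 2 powi J) f z"
proof -
  let ?r = "1 / 2 powi J :: real" and ?R = "1 / 2 powi I :: real" and ?\<theta> = "\<eta>0 - \<eta>1"
  let ?Mf = "maximal_ge ?r f z"
  define c where "c j = (1 / 2 :: real) ^ nat \<bar>j - J\<bar> + (1 / 2) ^ nat \<bar>j - I\<bar>" for j
  define k where "k x = infsum (\<lambda>j. K j z x) UNIV" for x
  define E where "E w = (\<Sum>j\<in>{I<..J}. e2pi (?\<theta> \<bullet> (z - w)) * K j y (y - w)) -
      (if ?r < infnorm (z - w) \<and> infnorm (z - w) \<le> ?R then k (z - w) else 0)" for w
  define Tf where "Tf \<epsilon> w = e2pi (\<eta>1 \<bullet> (z - w)) * (indicator (- cube z \<epsilon>) w *\<^sub>R k (z - w)) * f w" for \<epsilon> w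
  define G where "G j w = (e2pi (\<eta>0 \<bullet> (y - w)) * K j y (y - w)) * f w" for j w
  define H where "H w = C4 * (weight (2 powi J) (z - w) + weight (2 powi I) (z - w) +
      (\<Sum>j\<in>{I<..J}. c j * weight (2 powi j) (z - w)))" for w
  have rR: "?r \<le> ?R" using power_int_increasing[OF IJ, of "2::real"] by (intro divide_left_mono) auto
  have Ti: "integrable lborel (Tf \<epsilon>)" "T \<epsilon> = (LINT w|lborel. Tf \<epsilon> w)" if "\<epsilon> > 0" for \<epsilon>
    using kernel_op_truncated[OF that, of \<eta>1 z] by (simp_all add: Tf_def[abs_def] k_def T_def)
  have Gi: "integrable lborel (G j)" for j
    unfolding G_def[abs_def] by (rule modulated_piece(2)[OF cutoff_\<psi>]) simp
  have pointwise: "(\<Sum>j\<in>{I<..J}. G j w) - e2pi (\<eta>0 \<bullet> (y - z)) * (Tf ?r w - Tf ?R w) =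
      e2pi (\<eta>0 \<bullet> (y - z)) * e2pi (\<eta>1 \<bullet> (z - w)) * E w * f w" for w
  proof -
    \<comment> \<open>The phase splits into a part constant in w, the phase of the truncated
      operator, and the slowly varying remainder.\<close>
    have ph: "e2pi (\<eta>0 \<bullet> (y - w)) = e2pi (\<eta>0 \<bullet> (y - z)) * e2pi (\<eta>1 \<bullet> (z - w)) * e2pi (?\<theta> \<bullet> (z - w))"
      unfolding e2pi_add[symmetric] by (simp add: inner_diff_left inner_diff_right)
    \<comment> \<open>The difference of the two truncations keeps the shell ?r < |z - w| \<le> ?R,
      with the half-open ends used in \<open>kernel_comparison\<close>.\<close>
    have "Tf ?r w - Tf ?R w = e2pi (\<eta>1 \<bullet> (z - w)) *
        (if ?r < infnorm (z - w) \<and> infnorm (z - w) \<le> ?R then k (z - w) else 0) * f w"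
      using rR by (auto simp: Tf_def mem_cube indicator_def)
    moreover have "(\<Sum>j\<in>{I<..J}. G j w) = e2pi (\<eta>0 \<bullet> (y - z)) * e2pi (\<eta>1 \<bullet> (z - w)) *
        (\<Sum>j\<in>{I<..J}. e2pi (?\<theta> \<bullet> (z - w)) * K j y (y - w)) * f w"
      unfolding G_def ph by (simp add: sum_distrib_left sum_distrib_right mult_ac)
    ultimately show ?thesis unfolding E_def by (simp add: algebra_simps)
  qed
  have EH: "norm (E w) \<le> H w" for w
    unfolding E_def H_def k_def c_def by (rule kernel_comparison[OF IJ yz \<eta>])
  have WM: "(\<integral>\<^sup>+w. ennreal (weight (2 powi j) (z - w)) * ennreal (norm (f w)) \<partial>lborel) \<le> ennreal (2 ^ (CARD('n) + 2)) * ?Mf"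
    if "j \<le> J" for j
    by (rule weight_maximal) (use power_int_increasing[OF that, of "2::real"] in auto)
  have c0: "c j \<ge> 0" for j by (simp add: c_def)
  \<comment> \<open>At most 4 from each of the two centres; together with the two end weights this
    yields 10.\<close>
  have csum: "(\<Sum>j\<in>{I<..J}. c j) \<le> 8"
    using sum_half_powers_le[of "{I<..J}" J] sum_half_powers_le[of "{I<..J}" I] by (simp add: c_def sum.distrib)
  have Hint: "(\<integral>\<^sup>+w. ennreal (H w) * ennreal (norm (f w)) \<partial>lborel) \<le> ennreal (10 * C4 * 2 ^ (CARD('n) + 2)) * ?Mf"
  proof -
    let ?W = "\<lambda>j w. ennreal (weight (2 powi j) (z - w)) * ennreal (norm (f w))"
    have "ennreal (H w) * ennreal (norm (f w)) = ennreal C4 * (?W J w + ?W I w + (\<Sum>j\<in>{I<..J}. ennreal (c j) * ?W j w))" for w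
    proof -
      have "ennreal (H w) = ennreal C4 * (ennreal (weight (2 powi J) (z - w)) + ennreal (weight (2 powi I) (z - w)) +
          (\<Sum>j\<in>{I<..J}. ennreal (c j) * ennreal (weight (2 powi j) (z - w))))"
        unfolding H_def using C_nonneg c0
        by (simp add: ennreal_mult ennreal_plus weight_nonneg sum_nonneg sum_ennreal[symmetric])
      then show ?thesis by (simp add: distrib_right sum_distrib_right mult.assoc)
    qed
    then have "(\<integral>\<^sup>+w. ennreal (H w) * ennreal (norm (f w)) \<partial>lborel) =
        (\<integral>\<^sup>+w. ennreal C4 * (?W J w + ?W I w + (\<Sum>j\<in>{I<..J}. ennreal (c j) * ?W j w)) \<partial>lborel)" by simp
    also have "\<dots> = ennreal C4 * ((\<integral>\<^sup>+w. ?W J w \<partial>lborel) + (\<integral>\<^sup>+w. ?W I w \<partial>lborel) +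
        (\<Sum>j\<in>{I<..J}. ennreal (c j) * (\<integral>\<^sup>+w. ?W j w \<partial>lborel)))"
      by (simp add: nn_integral_cmult nn_integral_add nn_integral_sum)
    also have "\<dots> \<le> ennreal C4 * (ennreal (2 ^ (CARD('n) + 2)) * ?Mf + ennreal (2 ^ (CARD('n) + 2)) * ?Mf +
        (\<Sum>j\<in>{I<..J}. ennreal (c j) * (ennreal (2 ^ (CARD('n) + 2)) * ?Mf)))"
      using IJ by (intro mult_left_mono add_mono sum_mono WM) auto
    also have "\<dots> = ennreal C4 * (ennreal (2 + (\<Sum>j\<in>{I<..J}. c j)) * (ennreal (2 ^ (CARD('n) + 2)) * ?Mf))"
    proof -
      have *: "ennreal (2 + (\<Sum>j\<in>{I<..J}. c j)) = 1 + 1 + (\<Sum>j\<in>{I<..J}. ennreal (c j))"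
        using c0 by (simp add: ennreal_plus sum_nonneg sum_ennreal)
      show ?thesis by (simp only: * distrib_right sum_distrib_right mult_1_left)
    qed
    also have "\<dots> \<le> ennreal C4 * (ennreal 10 * (ennreal (2 ^ (CARD('n) + 2)) * ?Mf))"
      using csum by (intro mult_left_mono mult_right_mono ennreal_leI) auto
    also have "\<dots> = ennreal (10 * C4 * 2 ^ (CARD('n) + 2)) * ?Mf"
      using C_nonneg by (simp add: ennreal_mult mult_ac)
    finally show ?thesis .
  qed
  have "(\<Sum>j\<in>{I<..J}. LINT w|lborel. G j w) - e2pi (\<eta>0 \<bullet> (y - z)) * (T ?r - T ?R) =
      (LINT w|lborel. (\<Sum>j\<in>{I<..J}. G j w) - e2pi (\<eta>0 \<bullet> (y - z)) * (Tf ?r w - Tf ?R w))"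
    using Gi Ti by (simp add: Bochner_Integration.integral_diff Bochner_Integration.integral_sum)
  also have "\<dots> = (LINT w|lborel. e2pi (\<eta>0 \<bullet> (y - z)) * e2pi (\<eta>1 \<bullet> (z - w)) * E w * f w)"
    by (simp only: pointwise)
  finally have "ennreal (norm ((\<Sum>j\<in>{I<..J}. LINT w|lborel. G j w) - e2pi (\<eta>0 \<bullet> (y - z)) * (T ?r - T ?R))) \<le>
      (\<integral>\<^sup>+w. ennreal (norm (e2pi (\<eta>0 \<bullet> (y - z)) * e2pi (\<eta>1 \<bullet> (z - w)) * E w * f w)) \<partial>lborel)"
    by (simp only: norm_integral_le_nn_integral)
  also have "\<dots> \<le> (\<integral>\<^sup>+w. ennreal (H w) * ennreal (norm (f w)) \<partial>lborel)"
  proof (rule nn_integral_mono)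
    fix w
    have "norm (E w) * norm (f w) \<le> H w * norm (f w)" by (intro mult_right_mono EH) auto
    then have "ennreal (norm (E w) * norm (f w)) \<le> ennreal (H w * norm (f w))" by (rule ennreal_leI)
    moreover have "0 \<le> H w" using EH[of w] norm_ge_zero order.trans by blast
    ultimately show "ennreal (norm (e2pi (\<eta>0 \<bullet> (y - z)) * e2pi (\<eta>1 \<bullet> (z - w)) * E w * f w)) \<le> ennreal (H w) * ennreal (norm (f w))"
      by (simp add: norm_mult ennreal_mult)
  qed
  also note Hint
  finally show ?thesis unfolding G_def .
qed

lemma tile_symbol_integrable:
  "integrable lebesgue (\<lambda>\<xi>. tile_symbol \<Phi> a s \<eta> y \<xi> * e2pi (y \<bullet> \<xi>) * fourier f \<xi>)"
proof (rule fourier_mult_integrable(1)[OF fm fin])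
  have \<Phi>m [measurable]: "\<Phi> \<in> borel_measurable borel" by (rule borel_measurable_continuous_onI[OF \<Phi>_cont])
  have [measurable]: "a y \<in> borel_measurable borel" by (rule symbol_measurable)
  have len: "len_\<omega> s > 0" by (simp add: len_\<omega>_def dyadic_side_def)
  show "tile_symbol \<Phi> a s \<eta> y \<in> borel_measurable borel" unfolding tile_symbol_def[abs_def] by measurable
  \<comment> \<open>The value of a at frequency 0 is not covered by \<open>M\<close>, so it is
    added. This bound serves integrability alone and does not enter the final constant.\<close>
  show "norm (tile_symbol \<Phi> a s \<eta> y \<xi>) \<le> (M + norm (a y 0)) * 1" for \<xi>
    unfolding tile_symbol_def norm_mult
  proof (intro mult_mono)
    show "norm (a y (\<xi> - \<eta>)) \<le> M + norm (a y 0)"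
      using bounded[of "\<xi> - \<eta>" y] M_nonneg by (cases "\<xi> - \<eta> = 0") (auto intro: order.trans)
  qed (use M_nonneg \<Phi>_nonneg \<Phi>_le_1 in auto)
  show "tile_symbol \<Phi> a s \<eta> y \<xi> = 0" if "\<xi> \<notin> cube (center_\<omega> s) (len_\<omega> s)" for \<xi>
  proof -
    have "infnorm (\<xi> - center_\<omega> s) > len_\<omega> s"
      using that infnorm_sub[of \<xi> "center_\<omega> s"] by (simp add: mem_cube)
    then have "infnorm ((1 / (6 * len_\<omega> s)) *\<^sub>R (\<xi> - center_\<omega> s)) > 1 / 10"
      unfolding infnorm_mul using len by (simp add: field_simps)
    then show ?thesis by (simp add: tile_symbol_def \<Phi>_0)
  qed
  show "len_\<omega> s \<ge> 0" using len by simp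
qed

text \<open>To each tile cutoff the bump dilated to the same scale and centred at \<eta>0 is
  subtracted and added back: the differences are shifted cutoffs, and the two added bumps
  telescope.\<close>

lemma tile_symbol_decomposition:
  fixes u v :: "'n tile" and \<eta>0 y \<xi> :: "real^'n"
  assumes "scale v \<le> scale u"
  defines "\<delta> \<equiv> \<lambda>s. (1 / 2 powi scale s) *\<^sub>R (\<eta>0 - center_\<omega> s)"
  defines "m \<equiv> \<lambda>\<theta> l. a y (\<xi> - \<eta>0) * \<theta> ((1 / l) *\<^sub>R (\<xi> - \<eta>0))"
  shows "tile_symbol \<Phi> a v \<eta>0 y \<xi> - tile_symbol \<Phi> a u \<eta>0 y \<xi> =
    m (shifted_cutoff (\<delta> v)) (2 powi scale v) - m (shifted_cutoff (\<delta> u)) (2 powi scale u) -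
    (\<Sum>j\<in>{scale v<..scale u}. m \<psi> (2 powi j))"
proof -
  define \<zeta> where "\<zeta> = \<xi> - \<eta>0"
  have S: "(\<Sum>j\<in>{scale v<..scale u}. m \<psi> (2 powi j)) = a y \<zeta> *
      of_real (\<Phi> ((1 / 2 powi scale u) *\<^sub>R \<zeta>) - \<Phi> ((1 / 2 powi scale v) *\<^sub>R \<zeta>))"
    unfolding Psi_telescope[OF assms(1), symmetric] m_def \<zeta>_def \<psi>_def by (simp add: sum_distrib_left)
  have C: "m (shifted_cutoff (\<delta> s)) (2 powi scale s) = tile_symbol \<Phi> a s \<eta>0 y \<xi> -
      a y \<zeta> * of_real (\<Phi> ((1 / 2 powi scale s) *\<^sub>R \<zeta>))" for s :: "'n tile"
  proof -
    have "(1 / 6) *\<^sub>R ((1 / 2 powi scale s) *\<^sub>R (\<xi> - \<eta>0) + \<delta> s) = (1 / (6 * len_\<omega> s)) *\<^sub>R (\<xi> - center_\<omega> s)"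
      unfolding \<delta>_def len_\<omega>_def dyadic_side_def
      by (simp add: scaleR_add_right[symmetric])
    then show ?thesis by (simp add: m_def shifted_cutoff_def tile_symbol_def \<zeta>_def right_diff_distrib)
  qed
  show ?thesis unfolding S C by (simp add: right_diff_distrib)
qed

lemma tile_estimate:
  fixes u v :: "'n tile" and \<eta>0 \<eta>1 y z :: "real^'n"
  assumes uv: "tile_le u v" and \<eta>: "\<eta>0 \<in> tile_\<omega> v" "\<eta>1 \<in> tile_\<omega> v" and z: "z \<in> cube y (len_I u)"
  shows "ennreal (norm (psido (tile_symbol \<Phi> a v \<eta>0) f y - psido (tile_symbol \<Phi> a u \<eta>0) f y)) \<le>
    ennreal (tile_const + 2) * (maximal_ge (len_I u) f z + (SUP \<epsilon>\<in>{0<..}. ennreal (norm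
      (kernel_op \<Phi> a \<eta>1 (\<lambda>w. indicator (- cube z \<epsilon>) w *\<^sub>R f w) z))))"
proof -
  let ?I = "scale v" and ?J = "scale u"
  let ?r = "1 / 2 powi ?J :: real" and ?R = "1 / 2 powi ?I :: real"
  note geo = tile_geometry[OF uv \<eta>]
  have len: "len_I u = ?r" by (simp add: len_I_def dyadic_side_def power_int_minus inverse_eq_divide)
  have yz: "infnorm (y - z) \<le> ?r" using z by (simp add: mem_cube len)
  let ?Mf = "maximal_ge ?r f z"
  define T where "T \<epsilon> = kernel_op \<Phi> a \<eta>1 (\<lambda>w. indicator (- cube z \<epsilon>) w *\<^sub>R f w) z" for \<epsilon>
  define S where "S = (SUP \<epsilon>\<in>{0<..}. ennreal (norm (T \<epsilon>)))"
  define \<delta> where "\<delta> s = (1 / 2 powi scale s) *\<^sub>R (\<eta>0 - center_\<omega> s)" for s :: "'n tile"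
  define L where "L \<theta> l = (LINT w|lborel. (e2pi (\<eta>0 \<bullet> (y - w)) * piece \<theta> l y (y - w)) * f w)" for \<theta> l
  define m where "m \<theta> l \<xi> = (a y (\<xi> - \<eta>0) * \<theta> ((1 / l) *\<^sub>R (\<xi> - \<eta>0))) * e2pi (y \<bullet> \<xi>) * fourier f \<xi>" for \<theta> l \<xi>
  have \<delta>: "cutoff X (shifted_cutoff (\<delta> v))" "cutoff X (shifted_cutoff (\<delta> u))"
  proof -
    \<comment> \<open>\<eta>0 lies in both frequency cubes, hence within half a side of each
      centre.\<close>
    have "infnorm (\<delta> s) \<le> 1 / 2" if "infnorm (\<eta>0 - center_\<omega> s) \<le> 2 powi scale s / 2" for s
      unfolding \<delta>_def infnorm_mul using that by (simp add: divide_le_eq)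
    then show "cutoff X (shifted_cutoff (\<delta> v))" "cutoff X (shifted_cutoff (\<delta> u))"
      using geo(2,3) by (simp_all add: cutoff_shifted)
  qed
  have mi: "integrable lebesgue (m \<theta> l)" "(LINT \<xi>|lebesgue. m \<theta> l \<xi>) = L \<theta> l" if "cutoff X \<theta>" "l > 0" for \<theta> l
    using modulated_piece[OF that, of y \<eta>0] by (simp_all add: m_def[abs_def] L_def)
  define A where "A = L (shifted_cutoff (\<delta> v)) (2 powi ?I)"
  define B where "B = L (shifted_cutoff (\<delta> u)) (2 powi ?J)"
  define D where "D = (\<Sum>j\<in>{?I<..?J}. L \<psi> (2 powi j))"
  have "psido (tile_symbol \<Phi> a v \<eta>0) f y - psido (tile_symbol \<Phi> a u \<eta>0) f y =
      (LINT \<xi>|lebesgue. tile_symbol \<Phi> a v \<eta>0 y \<xi> * e2pi (y \<bullet> \<xi>) * fourier f \<xi> -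
        tile_symbol \<Phi> a u \<eta>0 y \<xi> * e2pi (y \<bullet> \<xi>) * fourier f \<xi>)"
    unfolding psido_def e2pi_def[symmetric]
    by (rule Bochner_Integration.integral_diff[symmetric]) (rule tile_symbol_integrable)+
  also have "\<dots> = (LINT \<xi>|lebesgue. m (shifted_cutoff (\<delta> v)) (2 powi ?I) \<xi> -
      m (shifted_cutoff (\<delta> u)) (2 powi ?J) \<xi> - (\<Sum>j\<in>{?I<..?J}. m \<psi> (2 powi j) \<xi>))"
    unfolding left_diff_distrib[symmetric] tile_symbol_decomposition[OF geo(1)]
    by (simp add: m_def \<delta>_def left_diff_distrib sum_distrib_right)
  also have "\<dots> = A - B - D"
    using mi \<delta> cutoff_\<psi> by (simp add: A_def B_def D_def Bochner_Integration.integral_diff Bochner_Integration.integral_sum)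
  finally have dec: "psido (tile_symbol \<Phi> a v \<eta>0) f y - psido (tile_symbol \<Phi> a u \<eta>0) f y = A - B - D" .
  let ?c = "ennreal (C3 * 2 ^ (CARD('n) + 2)) * ?Mf"
  have A: "ennreal (norm A) \<le> ?c"
    unfolding A_def L_def
    by (rule modulated_piece_bound[OF \<delta>(1) _ yz]) (use power_int_increasing[OF geo(1), of "2::real"] in auto)
  have B: "ennreal (norm B) \<le> ?c"
    unfolding B_def L_def by (rule modulated_piece_bound[OF \<delta>(2) _ yz]) auto
  define Z where "Z = e2pi (\<eta>0 \<bullet> (y - z)) * (T ?r - T ?R)"
  have DZ: "ennreal (norm (D - Z)) \<le> ennreal (10 * C4 * 2 ^ (CARD('n) + 2)) * ?Mf"
    unfolding D_def L_def Z_def T_def by (rule truncation_comparison[OF geo(1) yz geo(4)])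
  have TS: "ennreal (norm (T \<epsilon>)) \<le> S" if "\<epsilon> > 0" for \<epsilon> unfolding S_def by (rule SUP_upper) (use that in simp)
  \<comment> \<open>Each of the two truncations is bounded by the supremum separately; this is the 2
    in the final constant.\<close>
  have Z: "ennreal (norm Z) \<le> S + S"
  proof -
    have "norm Z \<le> norm (T ?r) + norm (T ?R)" unfolding Z_def norm_mult norm_e2pi mult_1_left by (rule norm_triangle_ineq4)
    then have "ennreal (norm Z) \<le> ennreal (norm (T ?r)) + ennreal (norm (T ?R))"
      by (simp flip: ennreal_plus add: ennreal_leI)
    also have "\<dots> \<le> S + S" by (intro add_mono TS) auto
    finally show ?thesis .
  qed
  have "norm (A - B - D) \<le> norm A + norm B + norm (D - Z) + norm Z"
  proof -
    have "norm (A - B - D) \<le> norm A + norm B + norm D"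
      using norm_triangle_ineq4[of "A - B" D] norm_triangle_ineq4[of A B] by linarith
    moreover have "norm D \<le> norm (D - Z) + norm Z" using norm_triangle_sub[of D Z] by simp
    ultimately show ?thesis by linarith
  qed
  then have "ennreal (norm (A - B - D)) \<le> ennreal (norm A) + ennreal (norm B) + ennreal (norm (D - Z)) + ennreal (norm Z)"
    by (simp flip: ennreal_plus add: ennreal_leI)
  also have "\<dots> \<le> ?c + ?c + ennreal (10 * C4 * 2 ^ (CARD('n) + 2)) * ?Mf + (S + S)"
    by (intro add_mono A B DZ Z)
  also have "\<dots> = ennreal tile_const * ?Mf + ennreal 2 * S"
  proof -
    have *: "ennreal tile_const = ennreal (C3 * 2 ^ (CARD('n) + 2)) + ennreal (C3 * 2 ^ (CARD('n) + 2)) + ennreal (10 * C4 * 2 ^ (CARD('n) + 2))"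
      using C_nonneg by (simp add: tile_const_def algebra_simps flip: ennreal_plus)
    have **: "ennreal 2 = 1 + 1" by simp
    show ?thesis by (simp only: * ** distrib_right mult_1_left)
  qed
  also have "\<dots> \<le> ennreal (tile_const + 2) * ?Mf + ennreal (tile_const + 2) * S"
    using tile_const_nonneg by (intro add_mono mult_right_mono ennreal_leI) auto
  finally show ?thesis unfolding dec len S_def T_def by (simp add: distrib_left)
qed

end

lemma kernel_op_cong:
  fixes f g :: "real^'n \<Rightarrow> complex"
  assumes [measurable]: "f \<in> borel_measurable lebesgue" "g \<in> borel_measurable lebesgue"
    and "AE w in lebesgue. f w = g w" and "\<epsilon> > 0"
  shows "kernel_op \<Phi> a \<eta> (\<lambda>w. indicator (- cube z \<epsilon>) w *\<^sub>R f w) z = kernel_op \<Phi> a \<eta> (\<lambda>w. indicator (- cube z \<epsilon>) w *\<^sub>R g w) z"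
proof -
  have [measurable]: "trunc_kernel z \<epsilon> \<in> borel_measurable borel"
    by (rule truncated_kernel_measurable) (use assms in simp)
  have km [measurable]: "(\<lambda>w. e2pi (\<eta> \<bullet> (z - w)) * trunc_kernel z \<epsilon> w) \<in> borel_measurable lebesgue"
    by (rule measurable_completion) measurable
  have eq: "(\<lambda>w. cis (2 * pi * (\<eta> \<bullet> (z - w))) * kernel \<Phi> a z (z - w) * (indicator (- cube z \<epsilon>) w *\<^sub>R h w)) =
      (\<lambda>w. e2pi (\<eta> \<bullet> (z - w)) * trunc_kernel z \<epsilon> w * h w)" for h
    by (simp add: fun_eq_iff kernel_eq_infsum e2pi_def)
  show ?thesis
    unfolding kernel_op_def eq
  proof (rule integral_cong_AE)
    show "AE w in lebesgue. e2pi (\<eta> \<bullet> (z - w)) * trunc_kernel z \<epsilon> w * f w =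
        e2pi (\<eta> \<bullet> (z - w)) * trunc_kernel z \<epsilon> w * g w"
      using assms(3) by eventually_elim simp
  qed measurable
qed

end

section \<open>From Borel to Lebesgue measurable functions\<close>

lemma ex_borel_representative:
  fixes f :: "real^'n::finite \<Rightarrow> complex"
  assumes "f \<in> borel_measurable lebesgue"
  shows "\<exists>g\<in>borel_measurable borel. AE x in lebesgue. f x = g x"
proof -
  have "(\<lambda>x. Re (f x)) \<in> borel_measurable lebesgue" "(\<lambda>x. Im (f x)) \<in> borel_measurable lebesgue"
    using assms by measurable
  then obtain p q where [measurable]: "p \<in> borel_measurable lborel" "q \<in> borel_measurable lborel"
    and pq: "AE x in lborel. Re (f x) = p x" "AE x in lborel. Im (f x) = q x"
    using completion_ex_borel_measurable_real by metis
  have "(\<lambda>x. Complex (p x) (q x)) = (\<lambda>x. of_real (p x) + \<i> * of_real (q x))"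
    by (simp add: fun_eq_iff complex_eq_iff)
  then have "(\<lambda>x. Complex (p x) (q x)) \<in> borel_measurable borel" by simp
  moreover have "AE x in lebesgue. f x = Complex (p x) (q x)"
    by (rule AE_completion) (use pq in eventually_elim, simp add: complex_eq_iff)
  ultimately show ?thesis by (intro bexI)
qed

text \<open>Equality everywhere, not merely almost everywhere: \<open>fourier\<close> sees f only
  through integrals, so both branches coincide and the choice is made from the same
  predicate.\<close>

lemma fourier_cong:
  fixes f g :: "real^'n::finite \<Rightarrow> complex"
  assumes fg [measurable]: "f \<in> borel_measurable lebesgue" "g \<in> borel_measurable lebesgue"
    and ae: "AE x in lebesgue. f x = g x"
  shows "fourier f = fourier g"
proof -
  have fi: "fourier_integral f = fourier_integral g"
    if [measurable]: "f \<in> borel_measurable lebesgue" "g \<in> borel_measurable lebesgue" and ae: "AE x in lebesgue. f x = g x"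
    for f g :: "real^'n \<Rightarrow> complex"
  proof
    fix \<xi> :: "real^'n"
    have [measurable]: "(\<lambda>x::real^'n. cis (- 2 * pi * (x \<bullet> \<xi>))) \<in> borel_measurable lebesgue"
      by (intro measurable_completion) (simp add: borel_measurable_continuous_onI continuous_intros)
    show "fourier_integral f \<xi> = fourier_integral g \<xi>"
      unfolding fourier_integral_def
      by (rule integral_cong_AE) (use ae in \<open>measurable, eventually_elim, simp\<close>)
  qed
  have tr: "fourier_integral (\<lambda>x. indicator (cube 0 (real N)) x *\<^sub>R f x) =
      fourier_integral (\<lambda>x. indicator (cube 0 (real N)) x *\<^sub>R g x)" for N :: nat
  proof (rule fi)
    have [measurable]: "cube (0::real^'n) (real N) \<in> sets lebesgue" by (simp add: cube_eq_cbox)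
    show "(\<lambda>x. indicator (cube 0 (real N)) x *\<^sub>R f x) \<in> borel_measurable lebesgue"
      "(\<lambda>x. indicator (cube 0 (real N)) x *\<^sub>R g x) \<in> borel_measurable lebesgue" by measurable
    show "AE x in lebesgue. indicator (cube 0 (real N)) x *\<^sub>R f x = indicator (cube 0 (real N)) x *\<^sub>R g x"
      using ae by eventually_elim simp
  qed
  have "integrable lebesgue f \<longleftrightarrow> integrable lebesgue g"
    by (rule integrable_cong_AE[OF fg ae])
  then show ?thesis unfolding fourier_def tr fi[OF fg ae] by simp
qed

lemma maximal_ge_cong:
  fixes f g :: "real^'n::finite \<Rightarrow> complex"
  assumes ae: "AE x in lebesgue. f x = g x"
  shows "maximal_ge b f z = maximal_ge b g z"
proof -
  have "(\<integral>\<^sup>+y\<in>cube z r. ennreal (norm (f y)) \<partial>lebesgue) = (\<integral>\<^sup>+y\<in>cube z r. ennreal (norm (g y)) \<partial>lebesgue)" for r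
    by (rule nn_integral_cong_AE) (use ae in eventually_elim, simp)
  then show ?thesis by (simp add: maximal_ge_def)
qed

text \<open>The factor c is moved across by division, which in \<open>ennreal\<close> requires it to
  be neither 0 nor infinite.\<close>

lemma le_cmult_INF_ennreal:
  fixes c N :: ennreal
  assumes "\<And>z. z \<in> A \<Longrightarrow> N \<le> c * F z" "c \<noteq> 0" "c \<noteq> top"
  shows "N \<le> c * (INF z\<in>A. F z)"
proof -
  have "N / c \<le> (INF z\<in>A. F z)"
    using assms by (intro INF_greatest divide_le_posI_ennreal) (auto simp: mult.commute zero_less_iff_neq_zero)
  then have "c * (N / c) \<le> c * (INF z\<in>A. F z)" by (rule mult_left_mono) simp
  moreover have "c * (N / c) = N"
    using mult_divide_eq_ennreal[OF assms(2,3), of N] by (simp add: ennreal_times_divide mult.commute)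
  ultimately show ?thesis by simp
qed

theorem proposition4p1:
  fixes \<Phi> :: "real^'n \<Rightarrow> real"
  assumes "schwartz \<Phi>"
    and "\<And>x. indicator (cube 0 (9/100)) x \<le> \<Phi> x"
    and "\<And>x. \<Phi> x \<le> indicator (cube 0 (1/10)) x"
  shows "\<exists>C :: ('n multiindex \<Rightarrow> 'n multiindex \<Rightarrow> ennreal) \<Rightarrow> real.
    \<forall>a :: real^'n \<Rightarrow> real^'n \<Rightarrow> complex.
      in_Linfty (\<lambda>(x, \<xi>). a x \<xi>) \<and>
      smooth_on (UNIV \<times> (- {0})) (\<lambda>(x, \<xi>). a x \<xi>) \<and>
      (\<forall>\<alpha> \<beta>. symbol_const a \<alpha> \<beta> < \<infinity>) \<and>
      adjoint_kills_one a \<longrightarrow>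
      (\<forall>u v :: 'n tile. tile_le u v \<longrightarrow>
        (\<forall>y. \<forall>\<eta>0\<in>tile_\<omega> v. \<forall>\<eta>1\<in>tile_\<omega> v. \<forall>f. in_L2 f \<longrightarrow>
          ennreal (norm (psido (tile_symbol \<Phi> a v \<eta>0) f y - psido (tile_symbol \<Phi> a u \<eta>0) f y))
          \<le> ennreal (C (symbol_const a)) *
            (INF z\<in>cube y (len_I u).
               maximal_ge (len_I u) f z +
               (SUP \<epsilon>\<in>{0<..}. ennreal (norm
                  (kernel_op \<Phi> a \<eta>1 (\<lambda>w. indicator (- cube z \<epsilon>) w *\<^sub>R f w) z))))))"
proof -
  obtain P where bump: "bump \<Phi> P" using bump_of_schwartz[OF assms] by blast
  define size where "size c = 30 ^ (CARD('n) + 2) * (3 * CARD('n)) * symbol_size c"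
    for c :: "'n multiindex \<Rightarrow> 'n multiindex \<Rightarrow> ennreal"
  \<comment> \<open>The exported \<open>tile_const\<close> takes only the numbers
    \<open>size c\<close> and \<open>P\<close> as arguments, so C sees a only through its table of
    seminorms. The summand 2 also keeps C positive, as taking the infimum requires.\<close>
  define C where "C c = symbol_bump.tile_const TYPE('n) (size c) P + 2"
    for c :: "'n multiindex \<Rightarrow> 'n multiindex \<Rightarrow> ennreal"
  show ?thesis
  proof (intro exI[of _ C] allI impI ballI)
    fix a :: "real^'n \<Rightarrow> real^'n \<Rightarrow> complex" and u v :: "'n tile" and y \<eta>0 \<eta>1 :: "real^'n" and f :: "real^'n \<Rightarrow> complex"
    assume a: "in_Linfty (\<lambda>(x, \<xi>). a x \<xi>) \<and> smooth_on (UNIV \<times> (- {0})) (\<lambda>(x, \<xi>). a x \<xi>) \<and>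
      (\<forall>\<alpha> \<beta>. symbol_const a \<alpha> \<beta> < \<infinity>) \<and> adjoint_kills_one a"
      and uv: "tile_le u v" and \<eta>: "\<eta>0 \<in> tile_\<omega> v" "\<eta>1 \<in> tile_\<omega> v" and f: "in_L2 f"
    have "symbol a (\<lambda>j x \<xi>. partial_deriv j (\<lambda>x'. a x' \<xi>) x) (size (symbol_const a))"
      unfolding size_def by (rule symbol_of_symbol_const) (use a in auto)
    then interpret symbol_bump a "\<lambda>j x \<xi>. partial_deriv j (\<lambda>x'. a x' \<xi>) x" "size (symbol_const a)" \<Phi> P
      using bump by (simp add: symbol_bump_def)
    have fl: "f \<in> borel_measurable lebesgue" using f by (simp add: in_L2_def)
    \<comment> \<open>Joint measurability in Fubini arguments is at hand for Borel functions; all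
      quantities in the estimate are unchanged when f is altered on a null set.\<close>
    obtain g where g: "g \<in> borel_measurable borel" and fg: "AE x in lebesgue. f x = g x"
      using ex_borel_representative[OF fl] by blast
    have gl: "g \<in> borel_measurable lebesgue" using g by (intro measurable_completion) simp
    have "sq_int lborel g = sq_int lebesgue g" by (simp add: nn_integral_completion)
    also have "\<dots> = sq_int lebesgue f"
      by (rule nn_integral_cong_AE) (use fg in eventually_elim, simp)
    also have "\<dots> < \<infinity>" using f unfolding in_L2_def integrable_iff_bounded by simp
    finally have g2: "sq_int lborel g < \<infinity>" .
    let ?N = "ennreal (norm (psido (tile_symbol \<Phi> a v \<eta>0) f y - psido (tile_symbol \<Phi> a u \<eta>0) f y))"
    let ?F = "\<lambda>z. maximal_ge (len_I u) f z + (SUP \<epsilon>\<in>{0<..}. ennreal (norm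
                  (kernel_op \<Phi> a \<eta>1 (\<lambda>w. indicator (- cube z \<epsilon>) w *\<^sub>R f w) z)))"
    have "?N \<le> ennreal (C (symbol_const a)) * ?F z" if "z \<in> cube y (len_I u)" for z
    proof -
      have "psido b f = psido b g" for b unfolding psido_def[abs_def] fourier_cong[OF fl gl fg] ..
      moreover have "maximal_ge (len_I u) f z = maximal_ge (len_I u) g z" by (rule maximal_ge_cong[OF fg])
      moreover have "(SUP \<epsilon>\<in>{0<..}. ennreal (norm (kernel_op \<Phi> a \<eta>1 (\<lambda>w. indicator (- cube z \<epsilon>) w *\<^sub>R f w) z))) =
          (SUP \<epsilon>\<in>{0<..}. ennreal (norm (kernel_op \<Phi> a \<eta>1 (\<lambda>w. indicator (- cube z \<epsilon>) w *\<^sub>R g w) z)))"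
        by (intro SUP_cong refl) (simp add: kernel_op_cong[OF fl gl fg])
      ultimately show ?thesis using tile_estimate[OF g g2 uv \<eta> that] by (simp add: C_def)
    qed
    then show "?N \<le> ennreal (C (symbol_const a)) * (INF z\<in>cube y (len_I u). ?F z)"
      by (rule le_cmult_INF_ennreal) (use tile_const_nonneg in \<open>auto simp: C_def\<close>)
  qed
qed

end
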